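(* Let $h\in[1,n]$, $N=2n+1$ and $A=(a_{i,j})\in\Xi_{N,2r}$. (1) If $B=E^\theta_{h,h+1}+\mathrm{diag}(\widehat\lambda)\in\Xi_{N,2r}$ for some $\lambda\in\Lambda(n+1,r-1)$, and $\mathrm{ro}(A)=\mathrm{co}(B)$, then in $S^{B}_{\boldsymbol q,1}(n,r)$ $$e_B\,e_A=\sum_{p\in[1,N],\ a_{h+1,p}>0}\boldsymbol q^{\sum_{j>p}a_{h,j}}\,[\![a_{h,p}+1]\!]\;e_{{}_hA_p}.$$ (2) If $C=E^\theta_{h+1,h}+\mathrm{diag}(\widehat\mu)\in\Xi_{N,2r}$ for some $\mu\in\Lambda(n+1,r-1)$, and $\mathrm{ro}(A)=\mathrm{co}(C)$, then, with $\delta=1-\delta_{a_{n,n+1},0}$, in $S^{B}_{\boldsymbol q,1}(n,r)$: if $h\ne n$, $$e_C\,e_A=\sum_{p\in[1,N],\ a_{h,p}>0}\boldsymbol q^{\sum_{j<p}a_{h+1,j}}\,[\![a_{h+1,p}+1]\!]\;e_{{}_hA_{\overline p}};$$ if $h=n$, $$e_C\,e_A=\sum_{\substack{p\in[1,N],\ p\ne n+1\\ a_{n,p}>0}}\boldsymbol q^{\sum_{j<p}a_{n+1,j}}[\![a_{n+1,p}+1]\!]\,e_{{}_nA_{\overline p}}+\delta\,\boldsymbol q^{\sum_{j<n+1}a_{n+1,j}}\Big([\![a_{n+1,n+1}+1]\!]+\boldsymbol q^{\frac{a_{n+1,n+1}}2}\Big)e_{{}_nA_{\overline{n+1}}}.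$$
   Context: Let $n\ge1$, $r\ge2$, $N=2n+1$, $[a,b]=\{x\in\mathbb Z:a\le x\le b\}$, $\mathcal A=\mathbb Z[\boldsymbol q]$ with $\boldsymbol q$ an indeterminate, $[\![m]\!]=(\boldsymbol q^m-1)/(\boldsymbol q-1)$ for $m\ge0$. $W$ is the group of permutations $w$ of $[1,2r]$ with $w(i)+w(2r+1-i)=2r+1$ for all $i$ (Weyl group of type $B_r$), with Coxeter generators $s_i=(i,i+1)(2r-i,2r+1-i)$ ($1\le i<r$) and $s_r=(r,r+1)$. $H=H_{\boldsymbol q,1}$ is the $\mathcal A$-algebra generated by $T_1,\dots,T_r$ with relations $T_iT_j=T_jT_i$ ($|i-j|\ge2$), $T_jT_{j+1}T_j=T_{j+1}T_jT_{j+1}$ ($1\le j<r-1$), $T_{r-1}T_rT_{r-1}T_r=T_rT_{r-1}T_rT_{r-1}$, $T_i^2=(\boldsymbol q-1)T_i+\boldsymbol q$ ($i<r$), $T_r^2=1$; it has basis $\{T_w\}_{w\in W}$, $T_w=T_{i_1}\cdots T_{i_l}$ for a reduced expression $w=s_{i_1}\cdots s_{i_l}$. $\Lambda(n+1,m)=\{\lambda\in\mathbb N^{n+1}:\sum\lambda_i=m\}$, $\widehat\lambda=(\lambda_1,\dots,\lambda_n,2\lambda_{n+1},\lambda_n,\dots,\lambda_1)$. For $\lambda\in\Lambda(n+1,r)$, $W_\lambda$ is generated by the $s_j$, $j\in[1,r]$, with $j\notin\{\lambda_1+\dots+\lambda_i:i\in[1,n]\}$; $x_\lambda=\sum_{w\in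 W_\lambda}T_w$. $S^{B}_{\boldsymbol q,1}(n,r)=\mathrm{End}_H(\bigoplus_{\lambda\in\Lambda(n+1,r)}x_\lambda H)$ (product is composition of endomorphisms acting on the left). $\Xi_{N,2r}$ is the set of $N\times N$ matrices $A=(a_{i,j})$ over $\mathbb N$ with $a_{i,j}=a_{N+1-i,N+1-j}$ and $\sum a_{i,j}=2r$; $\mathrm{ro}(A)$, $\mathrm{co}(A)$ are the vectors of row sums and column sums. For $\lambda\in\Lambda(n+1,r)$ let $R_i^{\widehat\lambda}$ ($1\le i\le N$) be the consecutive intervals of lengths $\widehat\lambda_i$ partitioning $[1,2r]$. The map $(\lambda,d,\mu)\mapsto(|R_i^{\widehat\lambda}\cap dR_j^{\widehat\mu}|)_{i,j}$, with $\lambda,\mu\in\Lambda(n+1,r)$ and $d$ a minimal length representative of a $W_\lambda$-$W_\mu$ double coset, is a bijection onto $\Xi_{N,2r}$; if $A$ is the image of $(\lambda,d,\mu)$, then $e_A\in S^{B}_{\boldsymbol q,1}(n,r)$ is given by $e_A(x_\nu h)=\delta_{\mu,\nu}\big(\sum_{w\in W_\lambda dW_\mu}T_w\big)h$. The $e_A$ form an $\mathcal A$-basis. (Under specialization of $\boldsymbol q$ to an odd prime power $q$, $e_A$ corresponds to the characteristic function of an $\mathrm O_{2r}(q)$-orbit in a convolution algebra, so the product is also written $*$.) $E_{i,j}$ are the $N\times N$ matrix units, $E^\theta_{i,j}=E_{i,j}+E_{N+1-i,N+1-j}$, ${}_hA_p=A+E^\theta_{h,p}-E^\theta_{h+1,p}$,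 ${}_hA_{\overline p}=A-E^\theta_{h,p}+E^\theta_{h+1,p}$; $\mathrm{diag}(\widehat\lambda)$ is the diagonal matrix with diagonal $\widehat\lambda$. *)

theory Defs
  imports
    "HOL-Algebra.Algebra"
    "HOL-Combinatorics.Permutations"
    "HOL-Computational_Algebra.Polynomial"
    "HOL-Library.Poly_Mapping"
begin

section \<open>The ground ring of integer polynomials in \<open>q\<close>\<close>

definition qv :: "int poly" where
  "qv = [:0, 1:]"

text \<open>The division is exact: \<open>q - 1\<close> divides \<open>q ^ m - 1\<close>.\<close>

definition qnum :: "nat \<Rightarrow> int poly" where
  "qnum m = (qv ^ m - 1) div (qv - 1)"


section \<open>The Weyl group of type B\<close>

definition weyl :: "nat \<Rightarrow> (nat \<Rightarrow> nat) monoid" where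
  "weyl r = \<lparr>carrier = {w. w permutes {1..2*r} \<and> (\<forall>i\<in>{1..2*r}. w i + w (2*r+1-i) = 2*r+1)},
             monoid.mult = (\<circ>), one = id\<rparr>"

definition simple_refl :: "nat \<Rightarrow> nat \<Rightarrow> nat \<Rightarrow> nat" where
  "simple_refl r i =
     (if i < r then transpose i (i+1) \<circ> transpose (2*r-i) (2*r+1-i) else transpose r (r+1))"

definition word_perm :: "nat \<Rightarrow> nat list \<Rightarrow> nat \<Rightarrow> nat" where
  "word_perm r is = foldr (\<lambda>i w. simple_refl r i \<circ> w) is id"

text \<open>A chosen reduced expression of \<open>w\<close>, as a list of indices of simple reflections.\<close>

definition reduced_word :: "nat \<Rightarrow> (nat \<Rightarrow> nat) \<Rightarrow> nat list" where
  "reduced_word r w = (ARG_MIN length is. set is \<subseteq> {1..r} \<and> word_perm r is = w)"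

definition cox_length :: "nat \<Rightarrow> (nat \<Rightarrow> nat) \<Rightarrow> nat" where
  "cox_length r w = length (reduced_word r w)"


section \<open>The Hecke algebra with parameters \<open>q\<close> and 1\<close>

text \<open>
  The free associative algebra over the integer polynomials is the monoid algebra of the free
  monoid: finitely supported functions on words, with convolution as product. The library
  supplies the convolution product for keys in \<^class>\<open>monoid_add\<close>, so concatenation of words is
  written additively.
\<close>

datatype word = Word "nat list"

instantiation word :: monoid_add
begin

definition zero_word :: word where
  "0 = Word []"

fun plus_word :: "word \<Rightarrow> word \<Rightarrow> word" where
  "Word xs + Word ys = Word (xs @ ys)"

instance
proof
  fix a b c :: word
  show "a + b + c = a + (b + c)" by (cases a; cases b; cases c) simp
  show "0 + a = a" by (cases a) (simp add: zero_word_def)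
  show "a + 0 = a" by (cases a) (simp add: zero_word_def)
qed

end

type_synonym free_elem = "word \<Rightarrow>\<^sub>0 int poly"

definition free_algebra :: "nat \<Rightarrow> free_elem ring" where
  "free_algebra r =
     \<lparr>carrier = {f. \<forall>is. Word is \<in> Poly_Mapping.keys f \<longrightarrow> set is \<subseteq> {1..r}},
      monoid.mult = (*), one = 1, ring.zero = 0, add = (+)\<rparr>"

definition gen :: "nat \<Rightarrow> free_elem" where
  "gen i = Poly_Mapping.single (Word [i]) 1"

definition const :: "int poly \<Rightarrow> free_elem" where
  "const c = Poly_Mapping.single 0 c"

text \<open>Each relation \<open>u = v\<close> is encoded as the element \<open>u - v\<close>.\<close>

definition hecke_relations :: "nat \<Rightarrow> free_elem set" where
  "hecke_relations r =
     {gen i * gen j - gen j * gen i | i j.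
        i \<in> {1..r} \<and> j \<in> {1..r} \<and> (i + 2 \<le> j \<or> j + 2 \<le> i)}
   \<union> {gen j * gen (j+1) * gen j - gen (j+1) * gen j * gen (j+1) | j. 1 \<le> j \<and> j + 1 < r}
   \<union> {gen (r-1) * gen r * gen (r-1) * gen r - gen r * gen (r-1) * gen r * gen (r-1)}
   \<union> {gen i * gen i - (const (qv - 1) * gen i + const qv) | i. 1 \<le> i \<and> i < r}
   \<union> {gen r * gen r - 1}"

definition hecke_ideal :: "nat \<Rightarrow> free_elem set" where
  "hecke_ideal r = Idl\<^bsub>free_algebra r\<^esub> (hecke_relations r)"

type_synonym hecke_elem = "free_elem set"

definition hecke :: "nat \<Rightarrow> hecke_elem ring" where
  "hecke r = free_algebra r Quot hecke_ideal r"

definition hecke_T :: "nat \<Rightarrow> nat \<Rightarrow> hecke_elem" where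
  "hecke_T r i = hecke_ideal r +>\<^bsub>free_algebra r\<^esub> gen i"

text \<open>The structure map of the algebra; its image is central.\<close>

definition hecke_const :: "nat \<Rightarrow> int poly \<Rightarrow> hecke_elem" where
  "hecke_const r c = hecke_ideal r +>\<^bsub>free_algebra r\<^esub> const c"

definition hecke_Tw :: "nat \<Rightarrow> (nat \<Rightarrow> nat) \<Rightarrow> hecke_elem" where
  "hecke_Tw r w =
     foldr (\<lambda>i t. hecke_T r i \<otimes>\<^bsub>hecke r\<^esub> t) (reduced_word r w) \<one>\<^bsub>hecke r\<^esub>"

definition Tsum :: "nat \<Rightarrow> (nat \<Rightarrow> nat) set \<Rightarrow> hecke_elem" where
  "Tsum r D = (\<Oplus>\<^bsub>hecke r\<^esub>w\<in>D. hecke_Tw r w)"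


section \<open>Compositions and parabolic subgroups\<close>

text \<open>
  Vectors and matrices are 1-indexed functions on the natural numbers that vanish outside
  their index range.
\<close>

definition Comp :: "nat \<Rightarrow> nat \<Rightarrow> (nat \<Rightarrow> nat) set" where
  "Comp k m = {l. (\<forall>i. i \<notin> {1..k} \<longrightarrow> l i = 0) \<and> (\<Sum>i\<in>{1..k}. l i) = m}"

definition hat :: "nat \<Rightarrow> (nat \<Rightarrow> nat) \<Rightarrow> nat \<Rightarrow> nat" where
  "hat n l i =
     (if 1 \<le> i \<and> i \<le> n then l i
      else if i = n + 1 then 2 * l (n+1)
      else if n + 1 < i \<and> i \<le> 2*n+1 then l (2*n+2-i)
      else 0)"

definition parabolic :: "nat \<Rightarrow> nat \<Rightarrow> (nat \<Rightarrow> nat) \<Rightarrow> (nat \<Rightarrow> nat) set" where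
  "parabolic n r l =
     generate (weyl r) (simple_refl r ` ({1..r} - {(\<Sum>k\<in>{1..i}. l k) | i. i \<in> {1..n}}))"

definition x_elem :: "nat \<Rightarrow> nat \<Rightarrow> (nat \<Rightarrow> nat) \<Rightarrow> hecke_elem" where
  "x_elem n r l = Tsum r (parabolic n r l)"

definition double_coset ::
  "nat \<Rightarrow> nat \<Rightarrow> (nat \<Rightarrow> nat) \<Rightarrow> (nat \<Rightarrow> nat) \<Rightarrow> (nat \<Rightarrow> nat) \<Rightarrow> (nat \<Rightarrow> nat) set" where
  "double_coset n r l d m = (parabolic n r l #>\<^bsub>weyl r\<^esub> d) <#>\<^bsub>weyl r\<^esub> parabolic n r m"


section \<open>The endomorphism algebra\<close>

definition x_module :: "nat \<Rightarrow> nat \<Rightarrow> (nat \<Rightarrow> nat) \<Rightarrow> hecke_elem monoid" where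
  "x_module n r l =
     \<lparr>carrier = {x_elem n r l \<otimes>\<^bsub>hecke r\<^esub> h | h. h \<in> carrier (hecke r)},
      monoid.mult = add (hecke r), one = \<zero>\<^bsub>hecke r\<^esub>\<rparr>"

text \<open>
  The additive group of the direct sum of the modules \<open>x\<^sub>\<lambda> H\<close>, written multiplicatively as in
  \<^const>\<open>sum_group\<close>; the right action of the Hecke algebra on it is componentwise.
\<close>

definition tensor_module ::
  "nat \<Rightarrow> nat \<Rightarrow> ((nat \<Rightarrow> nat) \<Rightarrow> hecke_elem) monoid" where
  "tensor_module n r = sum_group (Comp (n+1) r) (x_module n r)"

definition right_act ::
  "nat \<Rightarrow> nat \<Rightarrow> ((nat \<Rightarrow> nat) \<Rightarrow> hecke_elem) \<Rightarrow> hecke_elem \<Rightarrow> (nat \<Rightarrow> nat) \<Rightarrow> hecke_elem" where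
  "right_act n r v h = (\<lambda>l\<in>Comp (n+1) r. v l \<otimes>\<^bsub>hecke r\<^esub> h)"

definition incl :: "nat \<Rightarrow> nat \<Rightarrow> (nat \<Rightarrow> nat) \<Rightarrow> hecke_elem \<Rightarrow> (nat \<Rightarrow> nat) \<Rightarrow> hecke_elem" where
  "incl n r k y = (\<lambda>l\<in>Comp (n+1) r. if l = k then y else \<zero>\<^bsub>hecke r\<^esub>)"

type_synonym schur_elem =
  "((nat \<Rightarrow> nat) \<Rightarrow> hecke_elem) \<Rightarrow> (nat \<Rightarrow> nat) \<Rightarrow> hecke_elem"

definition schur :: "nat \<Rightarrow> nat \<Rightarrow> (int poly, schur_elem) module" where
  "schur n r = (let M = tensor_module n r in
     \<lparr>carrier = {f \<in> hom M M \<inter> extensional (carrier M).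
                  \<forall>v\<in>carrier M. \<forall>h\<in>carrier (hecke r).
                    f (right_act n r v h) = right_act n r (f v) h},
      monoid.mult = compose (carrier M),
      one = (\<lambda>v\<in>carrier M. v),
      ring.zero = (\<lambda>v\<in>carrier M. \<one>\<^bsub>M\<^esub>),
      add = (\<lambda>f g. \<lambda>v\<in>carrier M. f v \<otimes>\<^bsub>M\<^esub> g v),
      module.smult = (\<lambda>c f. \<lambda>v\<in>carrier M. right_act n r (f v) (hecke_const r c))\<rparr>)"


section \<open>Matrices and the standard basis\<close>

type_synonym mat = "nat \<Rightarrow> nat \<Rightarrow> nat"

definition Xi :: "nat \<Rightarrow> nat \<Rightarrow> mat set" where
  "Xi N t = {A. (\<forall>i j. (i \<notin> {1..N} \<or> j \<notin> {1..N}) \<longrightarrow> A i j = 0) \<and>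
                (\<forall>i\<in>{1..N}. \<forall>j\<in>{1..N}. A i j = A (N+1-i) (N+1-j)) \<and>
                (\<Sum>i\<in>{1..N}. \<Sum>j\<in>{1..N}. A i j) = t}"

definition ro :: "nat \<Rightarrow> mat \<Rightarrow> nat \<Rightarrow> nat" where
  "ro N A i = (\<Sum>j\<in>{1..N}. A i j)"

definition co :: "nat \<Rightarrow> mat \<Rightarrow> nat \<Rightarrow> nat" where
  "co N A j = (\<Sum>i\<in>{1..N}. A i j)"

definition block :: "nat \<Rightarrow> (nat \<Rightarrow> nat) \<Rightarrow> nat \<Rightarrow> nat set" where
  "block n l i = {(\<Sum>k\<in>{1..<i}. hat n l k) <.. (\<Sum>k\<in>{1..i}. hat n l k)}"

definition min_reps :: "nat \<Rightarrow> nat \<Rightarrow> (nat \<Rightarrow> nat) \<Rightarrow> (nat \<Rightarrow> nat) \<Rightarrow> (nat \<Rightarrow> nat) set" where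
  "min_reps n r l m =
     {d \<in> carrier (weyl r). \<forall>w\<in>double_coset n r l d m. cox_length r d \<le> cox_length r w}"

definition triples ::
  "nat \<Rightarrow> nat \<Rightarrow> ((nat \<Rightarrow> nat) \<times> (nat \<Rightarrow> nat) \<times> (nat \<Rightarrow> nat)) set" where
  "triples n r = {(l, d, m). l \<in> Comp (n+1) r \<and> m \<in> Comp (n+1) r \<and> d \<in> min_reps n r l m}"

definition triple_mat :: "nat \<Rightarrow> (nat \<Rightarrow> nat) \<times> (nat \<Rightarrow> nat) \<times> (nat \<Rightarrow> nat) \<Rightarrow> mat" where
  "triple_mat n = (\<lambda>(l, d, m) i j.
     if i \<in> {1..2*n+1} \<and> j \<in> {1..2*n+1} then card (block n l i \<inter> d ` block n m j) else 0)"

text \<open>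
  Convention: \<open>e_elem n r A = 0\<close> if \<open>A\<close> is not in \<open>Xi (2*n+1) (2*r)\<close>.
\<close>

definition e_elem :: "nat \<Rightarrow> nat \<Rightarrow> mat \<Rightarrow> schur_elem" where
  "e_elem n r A =
     (if A \<in> Xi (2*n+1) (2*r) then
        (case inv_into (triples n r) (triple_mat n) A of (l, d, m) \<Rightarrow>
           (THE f. f \<in> carrier (schur n r) \<and>
              (\<forall>k\<in>Comp (n+1) r. \<forall>h\<in>carrier (hecke r).
                 f (incl n r k (x_elem n r k \<otimes>\<^bsub>hecke r\<^esub> h)) =
                   (if m = k then incl n r l (Tsum r (double_coset n r l d m) \<otimes>\<^bsub>hecke r\<^esub> h)
                    else \<one>\<^bsub>tensor_module n r\<^esub>))))
      else \<zero>\<^bsub>schur n r\<^esub>)"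

definition unit_mat :: "nat \<Rightarrow> nat \<Rightarrow> mat" where
  "unit_mat i j = (\<lambda>a b. if a = i \<and> b = j then 1 else 0)"

definition E_theta :: "nat \<Rightarrow> nat \<Rightarrow> nat \<Rightarrow> mat" where
  "E_theta N i j = (\<lambda>a b. unit_mat i j a b + unit_mat (N+1-i) (N+1-j) a b)"

definition diag :: "(nat \<Rightarrow> nat) \<Rightarrow> mat" where
  "diag v = (\<lambda>a b. if a = b then v a else 0)"

text \<open>
  The subtractions are truncated. Truncation does not occur for \<open>A\<close> in \<open>Xi N t\<close> (\<open>N = 2*n+1\<close>,
  \<open>1 \<le> h \<le> n\<close>, \<open>1 \<le> p \<le> N\<close>, \<open>t\<close> even) if \<open>A (h+1) p > 0\<close>, respectively \<open>A h p > 0\<close>; in particular the centre entry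
  of \<open>A\<close> is even, so it is at least 2 when positive. In the remaining cases the true difference
  has a negative entry, and the truncated one is not in \<open>Xi N t\<close> because its entries sum to more
  than \<open>t\<close>.
\<close>

definition mat_up :: "nat \<Rightarrow> mat \<Rightarrow> nat \<Rightarrow> nat \<Rightarrow> mat" where
  "mat_up N A h p = (\<lambda>a b. A a b + E_theta N h p a b - E_theta N (h+1) p a b)"

definition mat_down :: "nat \<Rightarrow> mat \<Rightarrow> nat \<Rightarrow> nat \<Rightarrow> mat" where
  "mat_down N A h p = (\<lambda>a b. A a b + E_theta N (h+1) p a b - E_theta N h p a b)"

end

theory Submission imports Defs "HOL-Library.Product_Lexorder" begin

text \<open>A position in [1,2r] is coloured by the number of the block of \<open>hat n l\<close>
  that contains it (\<open>col\<close>). The parabolic subgroup of l is then a colour stabiliser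
  (\<open>parabolic_eq\<close>), and a double coset consists of all w for which the matrix counting
  the pairs (colour of k, colour of w^-1 k) is a given A (\<open>count_class_double_coset\<close>).

  Elements of the Hecke algebra are written as \<open>theta \<phi>\<close>, the sum of \<phi>(v)
  T_(v^-1) over v in \<open>W\<close>. Left multiplication by T_i becomes the operator
  \<open>tau i\<close> on functions, which only compares v(i) with v(i+1)
  (\<open>gen_theta\<close>). The sum of T_w over the double coset of A has as coefficient function
  the indicator \<open>phi\<close> of the matrix A. That T_w may be computed from any reduced word
  is \<open>matsumoto\<close>.

  Let e_A send x_m to the double coset sum of A, written as x_l z, and let e_B send x_l to the
  double coset sum of B. For the matrices B and C of the theorem that coset contains the identity,
  and its sum is G x_l, where G is the sum of T_w over the shortest representatives w of W_l' modulo
  W_l' \<inter> W_l. Hence e_B e_A sends x_m to G times the double coset sum of A, and it remains to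
  apply G to \<open>phi\<close> (\<open>product_formula\<close>).

  A single T_w produces many terms with a factor q - 1, but in the sum over w they combine into
  geometric series (\<open>rank_sum\<close>). By \<open>up_formula\<close> and
  \<open>down_formula\<close> the result at v is one term for each position i of the enlarged block:
  a power of q counting the positions j of the block whose values lie below (or above) v(i), times
  \<open>phi\<close> at v with i moved to the edge of the block. If the enlarged block is the
  central one, the words also pass through s_r, whose parameter is 1. As a consequence a position is
  not compared with its own mirror image (\<open>center_formula\<close>).

  Moving i across the edge shifts one symmetric pair of entries of the matrix, in a column p that is
  the colour of v(i) (\<open>phi_move_up\<close>, \<open>phi_move_down\<close>). Grouping the
  positions by p, the other colours give the power of q and the ranks inside colour p give the
  q-number. In the central block with p = n + 1 there are 2k + 2 positions of colour p, where 2k is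
  the central entry, and omitting mirror images turns their ranks into 0, ..., k, k, ..., 2k. This
  yields the exceptional coefficient (\<open>colour_sum_center\<close>).

  For the basis elements themselves, \<open>e_elem_rep\<close> shows that the choices in
  \<open>e_elem\<close> give the intended map: each A is realised by some permutation
  (\<open>exists_count\<close>), and its double coset sum factors through the generators on both
  sides (\<open>tsum_right_factor\<close>, \<open>tsum_left_factor\<close>).\<close>

locale type_B =
  fixes r :: nat
  assumes r2: "2 \<le> r"
begin

section \<open>The Weyl group as a group of symmetric permutations\<close>

abbreviation W where "W \<equiv> carrier (weyl r)"
abbreviation s where "s \<equiv> simple_refl r"
abbreviation pinv :: "(nat \<Rightarrow> nat) \<Rightarrow> nat \<Rightarrow> nat" where "pinv \<equiv> inv_into UNIV"

lemma W_iff: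
  "w \<in> W \<longleftrightarrow> w permutes {1..2*r} \<and> (\<forall>x\<in>{1..2*r}. w x + w (2*r+1-x) = 2*r+1)"
  by (simp add: weyl_def)

lemma W_permutes: "w \<in> W \<Longrightarrow> w permutes {1..2*r}"
  by (simp add: W_iff)

lemma W_mirror: "w \<in> W \<Longrightarrow> x \<in> {1..2*r} \<Longrightarrow> w (2*r+1-x) = 2*r+1 - w x"
  unfolding W_iff by (metis add_diff_cancel_left')

lemma W_in: "w \<in> W \<Longrightarrow> w x \<in> {1..2*r} \<longleftrightarrow> x \<in> {1..2*r}"
  by (rule permutes_in_image[OF W_permutes])

lemma W_inj: "w \<in> W \<Longrightarrow> w x = w y \<longleftrightarrow> x = y"
  using permutes_inj[OF W_permutes] by (simp add: inj_eq)

lemma W_bij: "w \<in> W \<Longrightarrow> bij w"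
  by (rule permutes_bij[OF W_permutes])

lemma finite_W: "finite W"
  by (rule finite_subset[OF _ finite_permutations[of "{1..2*r}"]]) (auto simp: W_iff)

lemma id_W: "id \<in> W"
  by (auto simp: W_iff permutes_id)

lemma comp_W: "u \<in> W \<Longrightarrow> v \<in> W \<Longrightarrow> u \<circ> v \<in> W"
proof -
  assume u: "u \<in> W" and v: "v \<in> W"
  have "(u \<circ> v) x + (u \<circ> v) (2*r+1-x) = 2*r+1" if x: "x \<in> {1..2*r}" for x
    using W_mirror[OF v x] W_in[OF v] x u by (auto simp: W_iff)
  with u v show ?thesis by (auto simp: W_iff permutes_compose)
qed

lemma inv_W: "w \<in> W \<Longrightarrow> pinv w \<in> W"
proof -
  assume w: "w \<in> W"
  have p: "pinv w permutes {1..2*r}" using W_permutes[OF w] by (rule permutes_inv)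
  have "pinv w x + pinv w (2*r+1-x) = 2*r+1" if x: "x \<in> {1..2*r}" for x
  proof -
    let ?y = "pinv w x"
    have y: "?y \<in> {1..2*r}" using x permutes_in_image[OF p] by simp
    have "w ?y = x" using W_bij[OF w] by (simp add: bij_is_surj surj_f_inv_f)
    then have "w (2*r+1 - ?y) = 2*r+1-x" using W_mirror[OF w y] by simp
    then have "pinv w (2*r+1-x) = 2*r+1 - ?y"
      using W_bij[OF w] by (metis bij_inv_eq_iff)
    then show ?thesis using y by auto
  qed
  with p show ?thesis by (auto simp: W_iff)
qed

lemma W_inv_f [simp]: "w \<in> W \<Longrightarrow> pinv w (w x) = x" "w \<in> W \<Longrightarrow> w (pinv w x) = x"
  using W_bij by (auto simp: bij_is_inj bij_is_surj surj_f_inv_f)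

lemma W_inv_o: "w \<in> W \<Longrightarrow> pinv w \<circ> w = id" "w \<in> W \<Longrightarrow> w \<circ> pinv w = id"
  by (auto simp: fun_eq_iff)

lemma W_inv_inv: "w \<in> W \<Longrightarrow> pinv (pinv w) = w"
  by (rule inv_inv_eq[OF W_bij])

lemma W_inv_comp: "u \<in> W \<Longrightarrow> v \<in> W \<Longrightarrow> pinv (u \<circ> v) = pinv v \<circ> pinv u"
  by (rule o_inv_distrib[OF W_bij W_bij])

lemma weyl_mult [simp]: "u \<otimes>\<^bsub>weyl r\<^esub> v = u \<circ> v" and weyl_one [simp]: "\<one>\<^bsub>weyl r\<^esub> = id"
  by (simp_all add: weyl_def)

lemma group_weyl: "group (weyl r)"
proof (rule groupI)
  fix x y z assume x: "x \<in> W" and y: "y \<in> W"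
  show "x \<otimes>\<^bsub>weyl r\<^esub> y \<in> W" using comp_W[OF x y] by simp
  show "x \<otimes>\<^bsub>weyl r\<^esub> y \<otimes>\<^bsub>weyl r\<^esub> z = x \<otimes>\<^bsub>weyl r\<^esub> (y \<otimes>\<^bsub>weyl r\<^esub> z)"
    by (simp add: comp_assoc)
  show "\<one>\<^bsub>weyl r\<^esub> \<otimes>\<^bsub>weyl r\<^esub> x = x" by simp
  show "\<exists>y\<in>W. y \<otimes>\<^bsub>weyl r\<^esub> x = \<one>\<^bsub>weyl r\<^esub>"
    by (rule bexI[of _ "pinv x"]) (simp_all add: inv_W W_inv_o x)
qed (simp add: id_W)

lemma weyl_m_inv: "w \<in> W \<Longrightarrow> inv\<^bsub>weyl r\<^esub> w = pinv w"
  by (rule group.inv_equality[OF group_weyl]) (simp_all add: W_inv_o inv_W)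

section \<open>Simple reflections and Coxeter length\<close>

lemma s_last: "s r x = (if x = r then r+1 else if x = r+1 then r else x)"
  by (auto simp: simple_refl_def transpose_def)

text \<open>Naming the difference k = r - i removes the truncated subtractions from the definition,
  so that identities between composites are decided by case analysis on the argument.\<close>

lemma s_split:
  "1 \<le> i \<Longrightarrow> 1 \<le> k \<Longrightarrow> r = i + k \<Longrightarrow>
    s i x = (if x = i then i+1 else if x = i+1 then i
      else if x = i+2*k then i+2*k+1 else if x = i+2*k+1 then i+2*k else x)"
  by (simp add: simple_refl_def transpose_def)

lemma s_splitE:
  assumes "i \<in> {1..<r}"
  obtains k where "1 \<le> i" "1 \<le> k" "r = i + k"
  using assms that[of "r - i"] by simp

lemma s_invol: "i \<in> {1..r} \<Longrightarrow> s i (s i x) = x"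
proof (cases "i = r")
  case False
  assume "i \<in> {1..r}"
  with False have "i \<in> {1..<r}" by auto
  then obtain k where k: "1 \<le> i" "1 \<le> k" "r = i + k" by (rule s_splitE)
  then show ?thesis unfolding s_split[OF k] by simp
qed (simp add: s_last)

lemma s_invol_comp: "i \<in> {1..r} \<Longrightarrow> s i \<circ> s i = id"
  by (simp add: fun_eq_iff s_invol)

lemma comp_s_s [simp]: "i \<in> {1..r} \<Longrightarrow> w \<circ> s i \<circ> s i = w"
  by (simp add: fun_eq_iff s_invol)

lemma s_W: "i \<in> {1..r} \<Longrightarrow> s i \<in> W"
proof -
  assume i: "i \<in> {1..r}"
  have *: "(x \<in> {1..2*r} \<longrightarrow> s i x \<in> {1..2*r} \<and> s i x + s i (2*r+1-x) = 2*r+1) \<and>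
      (x \<notin> {1..2*r} \<longrightarrow> s i x = x)" for x
  proof (cases "i = r")
    case True
    then show ?thesis using r2 by (auto simp: s_last)
  next
    case False
    with i have "i \<in> {1..<r}" by auto
    then obtain k where k: "1 \<le> i" "1 \<le> k" "r = i + k" by (rule s_splitE)
    show ?thesis unfolding s_split[OF k] using k by auto
  qed
  have "s i permutes {1..2*r}"
    by (rule bij_imp_permutes[OF bij_betw_byWitness[where f'="s i"]])
      (use * s_invol[OF i] in auto)
  with * show ?thesis unfolding W_iff by blast
qed

lemma inv_s: "i \<in> {1..r} \<Longrightarrow> pinv (s i) = s i"
  by (simp add: inv_unique_comp s_invol_comp)

lemma s_at: "i \<in> {1..r} \<Longrightarrow> s i i = i + 1" "i \<in> {1..r} \<Longrightarrow> s i (i + 1) = i"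
  using s_invol[of i i] by (simp_all add: simple_refl_def transpose_def split: if_splits)

lemma s_Suc: "i \<in> {1..r} \<Longrightarrow> s i (Suc i) = i"
  using s_at(2) by simp

lemma s_low:
  assumes "i \<in> {1..<r}" "x \<le> r"
  shows "s i x = (if x = i then i+1 else if x = i+1 then i else x)"
proof -
  obtain k where k: "1 \<le> i" "1 \<le> k" "r = i + k" using assms(1) by (rule s_splitE)
  show ?thesis unfolding s_split[OF k] using assms(2) k by auto
qed

lemma s_commute:
  assumes "i \<in> {1..r}" "j \<in> {1..r}" "i + 2 \<le> j"
  shows "s i \<circ> s j = s j \<circ> s i"
proof (cases "j = r")
  case True
  obtain k where k: "1 \<le> i" "2 \<le> k" "r = i + k"
    using assms True that[of "r - i"] by auto
  then have "1 \<le> k" by simp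
  note s_i = s_split[OF k(1) this k(3)]
  show ?thesis unfolding fun_eq_iff o_apply True s_last s_i using k by simp
next
  case False
  define k l where "k = j - i" and "l = r - j"
  have k: "1 \<le> i" "2 \<le> k" "1 \<le> l" "r = i + k + l" "j = i + k"
    using assms False by (auto simp: k_def l_def)
  then have "1 \<le> i + k" "1 \<le> k + l" "r = i + (k + l)" by auto
  note s_j = s_split[OF this(1) k(3,4)] and s_i = s_split[OF k(1) this(2,3)]
  show ?thesis unfolding fun_eq_iff o_apply k(5) s_j s_i using k(1-3) by simp
qed

lemma s_braid:
  assumes "1 \<le> i" "i + 1 < r"
  shows "s i \<circ> s (i+1) \<circ> s i = s (i+1) \<circ> s i \<circ> s (i+1)"
proof -
  define l where "l = r - (i+1)"
  have l: "1 \<le> i" "1 \<le> l + 1" "r = i + (l + 1)" "1 \<le> i + 1" "1 \<le> l" "r = i + 1 + l"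
    using assms by (auto simp: l_def)
  show ?thesis
    unfolding fun_eq_iff o_apply s_split[OF l(1-3)] s_split[OF l(4-6)] using l(1,5) by simp
qed

lemma s_braid_last: "s (r-1) \<circ> s r \<circ> s (r-1) \<circ> s r = s r \<circ> s (r-1) \<circ> s r \<circ> s (r-1)"
proof -
  define i where "i = r - 1"
  have i: "1 \<le> i" "r = i + 1" using r2 by (auto simp: i_def)
  show ?thesis
    unfolding fun_eq_iff o_apply i_def[symmetric] s_split[OF i(1) order.refl i(2)] s_last
    using i by simp
qed

text \<open>Twice the Coxeter length of \<open>w\<close>: each simple reflection \<open>s\<^sub>i\<close>, \<open>i < r\<close>, changes two inversions,
  while \<open>s\<^sub>r\<close> changes one inversion and one sign.\<close>

definition inversions :: "(nat \<Rightarrow> nat) \<Rightarrow> (nat \<times> nat) set" where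
  "inversions v = {(a, b). 1 \<le> a \<and> a < b \<and> b \<le> 2*r \<and> v b < v a}"

definition negs :: "(nat \<Rightarrow> nat) \<Rightarrow> nat set" where
  "negs v = {a \<in> {1..r}. r < v a}"

definition len2 :: "(nat \<Rightarrow> nat) \<Rightarrow> nat" where
  "len2 v = card (inversions v) + card (negs v)"

lemma finite_inversions: "finite (inversions v)"
  by (rule finite_subset[of _ "{1..2*r} \<times> {1..2*r}"]) (auto simp: inversions_def)

text \<open>Relabelling positions by the transposition carries the old inversions to new ones; the
  pair (i, i+1) is the only new inversion not obtained in this way.\<close>

lemma card_inversions_transpose:
  assumes i: "1 \<le> i" "i + 1 \<le> 2*r" and v: "v i < v (i+1)"
  shows "card (inversions (v \<circ> transpose i (i+1))) = Suc (card (inversions v))"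
proof -
  let ?t = "transpose i (i+1)"
  let ?f = "\<lambda>(a, b). (?t a, ?t b)"
  have eq: "inversions (v \<circ> ?t) = insert (i, i+1) (?f ` inversions v)"
  proof (intro Set.set_eqI iffI)
    fix p assume p: "p \<in> inversions (v \<circ> ?t)"
    obtain a b where ab: "p = (a, b)" by fastforce
    show "p \<in> insert (i, i+1) (?f ` inversions v)"
    proof (cases "p = (i, i+1)")
      case False
      have "(?t a, ?t b) \<in> inversions v"
        using p False i v by (auto simp: ab inversions_def transpose_def split: if_splits)
      then have "?f (?t a, ?t b) \<in> ?f ` inversions v" by blast
      then show ?thesis by (simp add: ab)
    qed simp
  next
    fix p assume p: "p \<in> insert (i, i+1) (?f ` inversions v)"
    show "p \<in> inversions (v \<circ> ?t)"
    proof (cases "p = (i, i+1)")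
      case True then show ?thesis using i v by (auto simp: inversions_def)
    next
      case False
      then obtain a b where ab: "(a, b) \<in> inversions v" "p = (?t a, ?t b)" using p by auto
      then show ?thesis using i v by (auto simp: inversions_def transpose_def split: if_splits)
    qed
  qed
  have "inj_on ?f (inversions v)"
    by (auto simp: inj_on_def dest: injD[OF inj_transpose])
  moreover have "(i, i+1) \<notin> ?f ` inversions v"
    by (auto simp: inversions_def transpose_def split: if_splits)
  ultimately show ?thesis
    unfolding eq by (simp add: card_image finite_inversions)
qed

text \<open>For i < r the reflection is a product of two adjacent transpositions at mirror places,
  each creating one inversion, and it only permutes the set \<open>negs\<close>; s_r creates one
  inversion and one sign.\<close>

lemma len2_asc:
  assumes w: "w \<in> W" and i: "i \<in> {1..r}" and asc: "w i < w (i+1)"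
  shows "len2 (w \<circ> s i) = len2 w + 2"
proof (cases "i = r")
  case True
  have *: "w \<circ> s i = w \<circ> transpose r (r+1)" by (simp add: True simple_refl_def)
  have m: "w r + w (r+1) = 2*r+1" using W_iff[of w] w r2 by (auto dest: bspec[where x=r])
  have "negs (w \<circ> s i) = insert r (negs w)"
    using m asc r2 True by (auto simp: negs_def s_last split: if_splits)
  moreover have "r \<notin> negs w" using m asc True by (auto simp: negs_def)
  moreover have "finite (negs w)" by (simp add: negs_def)
  ultimately have "card (negs (w \<circ> s i)) = card (negs w) + 1" by simp
  moreover have "card (inversions (w \<circ> s i)) = card (inversions w) + 1"
    unfolding * using card_inversions_transpose[of r w] asc True r2 by simp
  ultimately show ?thesis by (simp add: len2_def)
next
  case False
  then have i': "i \<in> {1..<r}" using i by auto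
  let ?w = "w \<circ> transpose i (i+1)"
  let ?j = "2*r-i"
  have j1: "2*r+1-i = ?j+1" using i' by auto
  have *: "w \<circ> s i = ?w \<circ> transpose ?j (?j+1)"
    using i' j1 by (simp add: simple_refl_def comp_assoc)
  have "w (2*r+1-i) = 2*r+1 - w i" "w (2*r+1-(i+1)) = 2*r+1 - w (i+1)"
    using W_mirror[OF w, of i] W_mirror[OF w, of "i+1"] i' by auto
  moreover have "2*r+1-(i+1) = ?j" by auto
  moreover have "w (i+1) \<le> 2*r" using W_in[OF w, of "i+1"] i' by auto
  \<comment> \<open>The mirror pair ascends as well, so the second transposition also adds an
    inversion.\<close>
  ultimately have wj: "w ?j < w (?j+1)" using j1 asc by auto
  have "?w ?j < ?w (?j+1)" using wj i' by (auto simp: transpose_def)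
  then have "card (inversions (w \<circ> s i)) = Suc (card (inversions ?w))"
    unfolding * using i' by (intro card_inversions_transpose) auto
  moreover have "card (inversions ?w) = Suc (card (inversions w))"
    using i' asc by (intro card_inversions_transpose) auto
  ultimately have c: "card (inversions (w \<circ> s i)) = card (inversions w) + 2" by linarith
  have "negs (w \<circ> s i) = s i ` negs w"
  proof
    show "negs (w \<circ> s i) \<subseteq> s i ` negs w"
    proof
      fix a assume a: "a \<in> negs (w \<circ> s i)"
      then have "s i a \<in> negs w" using i' by (auto simp: negs_def s_low split: if_splits)
      then show "a \<in> s i ` negs w" using s_invol[OF i, of a] by (metis imageI)
    qed
    show "s i ` negs w \<subseteq> negs (w \<circ> s i)"
      using i' s_invol[OF i] by (auto simp: negs_def s_low split: if_splits)
  qed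
  moreover have "inj_on (s i) (negs w)" using W_inj[OF s_W[OF i]] by (auto simp: inj_on_def)
  ultimately have "card (negs (w \<circ> s i)) = card (negs w)" by (simp add: card_image)
  then show ?thesis unfolding len2_def using c by linarith
qed

lemma len2_desc:
  assumes w: "w \<in> W" and i: "i \<in> {1..r}" and desc: "w (i+1) < w i"
  shows "len2 w = len2 (w \<circ> s i) + 2"
proof -
  have "len2 (w \<circ> s i \<circ> s i) = len2 (w \<circ> s i) + 2"
    using i desc s_at[OF i] by (intro len2_asc comp_W w s_W) auto
  then show ?thesis using i by simp
qed

lemma W_asc_or_desc:
  "w \<in> W \<Longrightarrow> \<not> w i < w (i+1) \<Longrightarrow> w (i+1) < w i"
  using W_inj[of w i "i+1"] by linarith

lemma len2_id: "len2 id = 0"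
proof -
  have "inversions id = {}" "negs id = {}" by (auto simp: inversions_def negs_def)
  then show ?thesis by (simp add: len2_def)
qed

section \<open>Symmetric colourings and their stabilisers\<close>

text \<open>A colour is the number of the block containing a position. Reversing the positions
  reverses the blocks, as for the palindromic vectors \<open>hat n l\<close>; parabolic subgroups
  become colour stabilisers.\<close>

definition sym_colouring :: "nat \<Rightarrow> (nat \<Rightarrow> nat) \<Rightarrow> bool" where
  "sym_colouring N c \<longleftrightarrow> mono_on {1..2*r} c \<and> (\<forall>x\<in>{1..2*r}. c x + c (2*r+1-x) = N + 1)"

definition stab :: "(nat \<Rightarrow> nat) \<Rightarrow> (nat \<Rightarrow> nat) set" where
  "stab c = {w \<in> W. \<forall>x\<in>{1..2*r}. c (w x) = c x}"

text \<open>Indices of the simple reflections that lie in \<open>stab c\<close>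
  (\<open>s_stab\<close>).\<close>

definition adj :: "(nat \<Rightarrow> nat) \<Rightarrow> nat set" where
  "adj c = {i \<in> {1..r}. c i = c (i+1)}"

text \<open>With a single colour the stabiliser is all of \<open>W\<close>, so induction over
  \<open>W\<close> becomes a special case of induction over a stabiliser.\<close>

lemma sym_colouring_trivial: "sym_colouring 1 (\<lambda>x. 1)"
  by (simp add: sym_colouring_def mono_on_def)

lemma stab_W: "u \<in> stab c \<Longrightarrow> u \<in> W"
  by (simp add: stab_def)

lemma stab_comp: "u \<in> stab c \<Longrightarrow> v \<in> stab c \<Longrightarrow> u \<circ> v \<in> stab c"
  using W_in by (auto simp: stab_def comp_W)

lemma stab_id: "id \<in> stab c"
  by (simp add: stab_def id_W)

lemma stab_inv: "u \<in> stab c \<Longrightarrow> pinv u \<in> stab c"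
  unfolding stab_def using W_in inv_W W_inv_f(2) by (smt (verit) mem_Collect_eq)

lemma colouring_mirror_eq:
  assumes c: "sym_colouring N c" and "x \<in> {1..2*r}" "y \<in> {1..2*r}"
  shows "c (2*r+1-x) = c (2*r+1-y) \<longleftrightarrow> c x = c y"
proof -
  have "c x + c (2*r+1-x) = N+1" "c y + c (2*r+1-y) = N+1"
    using assms unfolding sym_colouring_def by blast+
  then show ?thesis by linarith
qed

lemma s_stab:
  assumes c: "sym_colouring N c" and i: "i \<in> adj c"
  shows "s i \<in> stab c"
proof -
  have i': "i \<in> {1..r}" "c i = c (i+1)" using i by (auto simp: adj_def)
  have "c (s i x) = c x" if x: "x \<in> {1..2*r}" for x
  proof (cases "i = r")
    case True then show ?thesis using i' by (simp add: s_last)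
  next
    case False
    then have "c (2*r+1-i) = c (2*r+1-(i+1))"
      using i' by (subst colouring_mirror_eq[OF c]) auto
    then have "c (2*r+1-i) = c (2*r-i)" by simp
    moreover obtain k where k: "1 \<le> i" "1 \<le> k" "r = i + k"
      using i' False that[of "r - i"] by auto
    moreover from k have "2*r+1-i = i+2*k+1" "2*r-i = i+2*k" by auto
    ultimately show ?thesis unfolding s_split[OF k] using i' by auto
  qed
  then show ?thesis using s_W i' by (simp add: stab_def)
qed

text \<open>Ascents in the left half mirror to ascents in the right half, so w ascends at every
  adjacent pair of equal colour. Since c is monotone, colour classes are intervals and the ascents
  chain along them.\<close>

lemma asc_colour:
  assumes c: "sym_colouring N c" and w: "w \<in> W" and asc: "\<forall>i\<in>adj c. w i < w (i+1)"
    and xy: "x \<in> {1..2*r}" "y \<in> {1..2*r}" "x < y" "c x = c y"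
  shows "w x < w y"
proof -
  have step: "w i < w (Suc i)" if i: "i \<in> {1..<2*r}" "c i = c (i+1)" for i
  proof (cases "i \<le> r")
    case True then show ?thesis using asc i by (auto simp: adj_def)
  next
    case False
    let ?j = "2*r-i"
    have j: "?j \<in> {1..r}" using False i by auto
    have "c (2*r+1-i) = c (2*r+1-(i+1))"
      using i by (subst colouring_mirror_eq[OF c]) auto
    moreover have "2*r+1-i = ?j+1" "2*r+1-(i+1) = ?j" using i False by auto
    ultimately have "?j \<in> adj c" using j by (auto simp: adj_def)
    then have "w ?j < w (?j+1)" using asc by blast
    moreover have "w (2*r+1-?j) = 2*r+1 - w ?j" "w (2*r+1-(?j+1)) = 2*r+1 - w (?j+1)"
      using W_mirror[OF w, of ?j] W_mirror[OF w, of "?j+1"] j i by auto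
    moreover have "2*r+1-?j = Suc i" "2*r+1-(?j+1) = i" using i False by auto
    moreover have "w (?j+1) \<le> 2*r" using W_in[OF w, of "?j+1"] j i by auto
    ultimately show ?thesis by (simp add: diff_less_mono2)
  qed
  have "y \<le> 2*r \<Longrightarrow> c x = c y \<Longrightarrow> w x < w y"
    using xy(3)
  proof (induction y)
    case (Suc y)
    show ?case
    proof (cases "x = y")
      case True then show ?thesis using step[of y] xy(1) Suc.prems by simp
    next
      case False
      then have "x < y" using Suc.prems by simp
      have "mono_on {1..2*r} c" using c by (simp add: sym_colouring_def)
      then have "c x \<le> c y" "c y \<le> c (Suc y)"
        using Suc.prems(1) \<open>x < y\<close> xy(1) by (auto intro: mono_onD)
      then have "c x = c y" "c y = c (y+1)" using Suc.prems by simp_all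
      then show ?thesis
        using Suc.IH \<open>x < y\<close> Suc.prems(1) xy(1) step[of y] by fastforce
    qed
  qed simp
  then show ?thesis using xy by simp
qed

text \<open>Take the least moved point x0. Then u x0 > x0, while the preimage of x0 lies to the
  right of x0, has the same colour and a smaller image, against \<open>asc_colour\<close>.\<close>

lemma stab_asc_id:
  assumes c: "sym_colouring N c" and u: "u \<in> stab c" and asc: "\<forall>i\<in>adj c. u i < u (i+1)"
  shows "u = id"
proof (rule ccontr)
  assume "u \<noteq> id"
  then obtain x where x: "u x \<noteq> x" by (auto simp: fun_eq_iff)
  define x0 where "x0 = (LEAST x. u x \<noteq> x)"
  have x0: "u x0 \<noteq> x0" "\<And>y. y < x0 \<Longrightarrow> u y = y"
    unfolding x0_def using LeastI[of "\<lambda>x. u x \<noteq> x", OF x] not_less_Least by blast+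
  have uW: "u \<in> W" using u by (rule stab_W)
  have x0r: "x0 \<in> {1..2*r}" using x0(1) permutes_not_in[OF W_permutes[OF uW]] by blast
  have gt: "x0 < u x0" using x0 W_inj[OF uW] by (metis linorder_neqE_nat)
  let ?y = "pinv u x0"
  have uy: "u ?y = x0" using uW by simp
  have y: "?y \<in> {1..2*r}" using uy x0r W_in[OF uW] by metis
  have cy: "c ?y = c x0" using u y uy unfolding stab_def by force
  have "x0 < ?y" using x0 uy by (metis linorder_neqE_nat)
  then have "u x0 < u ?y" using asc_colour[OF c uW asc x0r y] cy by simp
  then show False using uy gt by simp
qed

text \<open>An element other than the identity has a descent in \<open>adj c\<close> by
  \<open>stab_asc_id\<close>; removing it shortens the element and stays in the stabiliser.\<close>

lemma stab_descent_induct [consumes 2, case_names id desc]: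
  assumes c: "sym_colouring N c" and u: "u \<in> stab c"
    and "P id"
    and "\<And>u i. u \<in> stab c \<Longrightarrow> i \<in> adj c \<Longrightarrow> u i < u (i+1) \<Longrightarrow> P u \<Longrightarrow> P (u \<circ> s i)"
  shows "P u"
  using u
proof (induction "len2 u" arbitrary: u rule: less_induct)
  case less
  show ?case
  proof (cases "u = id")
    case False
    then obtain i where i: "i \<in> adj c" "\<not> u i < u (i+1)"
      using stab_asc_id[OF c less.prems] by blast
    have ir: "i \<in> {1..r}" using i by (simp add: adj_def)
    have uW: "u \<in> W" using less.prems by (rule stab_W)
    have d: "u (i+1) < u i" using W_asc_or_desc[OF uW i(2)] .
    have us: "u \<circ> s i \<in> stab c" using stab_comp[OF less.prems s_stab[OF c i(1)]] .
    have "P (u \<circ> s i)" using len2_desc[OF uW ir d] us by (intro less.hyps) auto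
    then have "P (u \<circ> s i \<circ> s i)" using assms(4)[OF us i(1)] d s_at[OF ir] by simp
    then show ?thesis using ir by simp
  qed (use assms(3) in simp)
qed

lemma stab_trivial: "stab (\<lambda>x. 1) = W"
  by (auto simp: stab_def)

lemma W_descent_induct [consumes 1, case_names id desc]:
  assumes "w \<in> W" "P id"
    and "\<And>w i. w \<in> W \<Longrightarrow> i \<in> {1..r} \<Longrightarrow> w i < w (i+1) \<Longrightarrow> P w \<Longrightarrow> P (w \<circ> s i)"
  shows "P w"
  using stab_descent_induct[OF sym_colouring_trivial, unfolded stab_trivial, of w P] assms
  by (simp add: adj_def)

section \<open>Words and reduced expressions\<close>

lemma word_perm_append: "word_perm r (xs @ ys) = word_perm r xs \<circ> word_perm r ys"
  by (induction xs) (auto simp: word_perm_def comp_assoc)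

lemma word_perm_simps: "word_perm r [] = id" "word_perm r (i # xs) = s i \<circ> word_perm r xs"
  by (auto simp: word_perm_def)

lemma word_perm_W: "set xs \<subseteq> {1..r} \<Longrightarrow> word_perm r xs \<in> W"
  by (induction xs) (auto simp: word_perm_simps id_W comp_W s_W)

lemma word_perm_rev: "set xs \<subseteq> {1..r} \<Longrightarrow> word_perm r (rev xs) = pinv (word_perm r xs)"
  by (induction xs)
    (auto simp: word_perm_simps word_perm_append W_inv_comp s_W word_perm_W inv_s)

lemma len2_word_le: "set xs \<subseteq> {1..r} \<Longrightarrow> len2 (word_perm r xs) \<le> 2 * length xs"
proof (induction xs rule: rev_induct)
  case (snoc i xs)
  have i: "i \<in> {1..r}" and xs: "set xs \<subseteq> {1..r}" using snoc.prems by auto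
  have w: "word_perm r xs \<in> W" by (rule word_perm_W[OF xs])
  have "len2 (word_perm r xs \<circ> s i) \<le> len2 (word_perm r xs) + 2"
    using len2_asc[OF w i] len2_desc[OF w i] W_asc_or_desc[OF w, of i] by fastforce
  moreover have "word_perm r (xs @ [i]) = word_perm r xs \<circ> s i"
    by (simp add: word_perm_append word_perm_simps)
  ultimately have "len2 (word_perm r (xs @ [i])) \<le> len2 (word_perm r xs) + 2" by presburger
  with snoc.IH[OF xs] show ?case by simp
qed (simp add: word_perm_simps len2_id)

lemma exists_word: "w \<in> W \<Longrightarrow> \<exists>xs. set xs \<subseteq> {1..r} \<and> word_perm r xs = w \<and> 2 * length xs = len2 w"
proof (induction w rule: W_descent_induct)
  case id
  show ?case
    by (rule exI[of _ "[]"]) (simp add: word_perm_simps[unfolded id_def] len2_id[unfolded id_def])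
next
  case (desc u i)
  then obtain xs where xs: "set xs \<subseteq> {1..r}" "word_perm r xs = u" "2 * length xs = len2 u" by blast
  have "word_perm r (xs @ [i]) = u \<circ> s i"
    using xs by (simp add: word_perm_append word_perm_simps)
  moreover have "2 * length (xs @ [i]) = len2 (u \<circ> s i)"
    using len2_asc[OF desc(1-3)] xs by simp
  moreover have "set (xs @ [i]) \<subseteq> {1..r}" using xs desc(2) by simp
  ultimately show ?case by blast
qed

text \<open>Stripping descents yields a word that attains the lower bound of
  \<open>len2_word_le\<close>, so a shortest word attains it as well.\<close>

lemma reduced_word:
  assumes "w \<in> W"
  shows "set (reduced_word r w) \<subseteq> {1..r}" "word_perm r (reduced_word r w) = w"
    "2 * length (reduced_word r w) = len2 w"
proof -
  let ?Q = "\<lambda>xs. set xs \<subseteq> {1..r} \<and> word_perm r xs = w"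
  obtain xs where xs: "?Q xs" "2 * length xs = len2 w" using exists_word[OF assms] by blast
  have Q: "?Q (reduced_word r w)" and le: "length (reduced_word r w) \<le> length xs"
    unfolding reduced_word_def using xs(1) by (rule arg_min_natI, rule arg_min_nat_le)
  show "set (reduced_word r w) \<subseteq> {1..r}" "word_perm r (reduced_word r w) = w" using Q by auto
  show "2 * length (reduced_word r w) = len2 w"
    using len2_word_le[of "reduced_word r w"] Q xs(2) le by auto
qed

lemma cox_length: "w \<in> W \<Longrightarrow> 2 * cox_length r w = len2 w"
  by (simp add: cox_length_def reduced_word)

text \<open>Reversing a reduced word shows that inversion does not increase the length; used for w
  and for its inverse this gives equality.\<close>

lemma len2_inv: "w \<in> W \<Longrightarrow> len2 (pinv w) = len2 w"
proof -
  have le: "len2 (pinv w) \<le> len2 w" if w: "w \<in> W" for w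
    using len2_word_le[of "rev (reduced_word r w)"] reduced_word[OF w]
    by (simp add: word_perm_rev)
  assume "w \<in> W"
  then show ?thesis using le[of w] le[of "pinv w"] inv_W W_inv_inv by fastforce
qed

text \<open>Descent induction writes a colour-preserving element as a product of generators, one
  generator per step.\<close>

lemma parabolic_eq_stab:
  assumes c: "sym_colouring N c"
  shows "generate (weyl r) (s ` adj c) = stab c"
proof
  have ir: "i \<in> {1..r}" if "i \<in> adj c" for i using that by (simp add: adj_def)
  show "generate (weyl r) (s ` adj c) \<subseteq> stab c"
  proof
    fix w assume "w \<in> generate (weyl r) (s ` adj c)"
    then show "w \<in> stab c"
    proof (induction w rule: generate.induct)
      case one
      show ?case unfolding weyl_one by (rule stab_id)
    next
      case (incl h)
      then show ?case using s_stab[OF c] by blast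
    next
      case (inv h)
      then obtain i where i: "i \<in> adj c" "h = s i" by blast
      then show ?case using s_stab[OF c i(1)] ir by (simp add: weyl_m_inv s_W inv_s)
    next
      case (eng h1 h2)
      then show ?case unfolding weyl_mult by (intro stab_comp)
    qed
  qed
  show "stab c \<subseteq> generate (weyl r) (s ` adj c)"
  proof
    fix u assume "u \<in> stab c"
    with c show "u \<in> generate (weyl r) (s ` adj c)"
    proof (induction u rule: stab_descent_induct)
      case id
      show ?case using generate.one[of "weyl r"] unfolding weyl_one .
    next
      case (desc u i)
      then show ?case
        using generate.eng[OF desc(4) generate.incl[of "s i"]] unfolding weyl_mult by blast
    qed
  qed
qed

end

section \<open>The free algebra and its central constants\<close>

lemma keys_mult_words:
  assumes "\<And>xs. Word xs \<in> Poly_Mapping.keys f \<Longrightarrow> set xs \<subseteq> A"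
    and "\<And>xs. Word xs \<in> Poly_Mapping.keys g \<Longrightarrow> set xs \<subseteq> A"
    and "Word xs \<in> Poly_Mapping.keys (f * g)"
  shows "set xs \<subseteq> A"
proof -
  obtain a b where ab: "Word xs = a + b" "a \<in> Poly_Mapping.keys f" "b \<in> Poly_Mapping.keys g"
    using keys_mult[of f g] assms(3) by blast
  obtain as bs where "a = Word as" "b = Word bs" by (cases a; cases b) auto
  with ab assms(1,2) show ?thesis by auto
qed

lemma ring_free_algebra: "ring (free_algebra r)"
proof (intro ringI abelian_groupI monoidI)
  fix x assume x: "x \<in> carrier (free_algebra r)"
  then have "- x \<in> carrier (free_algebra r)"
    by (simp add: free_algebra_def)
  then show "\<exists>y\<in>carrier (free_algebra r). y \<oplus>\<^bsub>free_algebra r\<^esub> x = \<zero>\<^bsub>free_algebra r\<^esub>"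
    by (intro bexI[of _ "- x"]) (simp_all add: free_algebra_def)
next
  fix x y assume "x \<in> carrier (free_algebra r)" "y \<in> carrier (free_algebra r)"
  then show "x \<otimes>\<^bsub>free_algebra r\<^esub> y \<in> carrier (free_algebra r)"
    using keys_mult_words[of x "{1..r}" y] by (auto simp: free_algebra_def)
next
  fix x y assume xy: "x \<in> carrier (free_algebra r)" "y \<in> carrier (free_algebra r)"
  have "Poly_Mapping.keys (x + y) \<subseteq> Poly_Mapping.keys x \<union> Poly_Mapping.keys y"
    by (rule keys_add)
  with xy show "x \<oplus>\<^bsub>free_algebra r\<^esub> y \<in> carrier (free_algebra r)"
    by (auto simp: free_algebra_def)
qed (auto simp: free_algebra_def zero_word_def algebra_simps)

lemma update_as_add: "a \<notin> Poly_Mapping.keys f \<Longrightarrow> Poly_Mapping.update a b f = f + Poly_Mapping.single a b"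
  by (rule poly_mapping_eqI) (auto simp: lookup_update lookup_add lookup_single in_keys_iff when_def)

text \<open>A constant sits on the empty word, which is neutral for concatenation.\<close>

lemma const_central: "const c * f = f * const c"
proof (induction f rule: update_induct)
  case (update f a b)
  then show ?case
    by (simp add: update_as_add const_def distrib_left distrib_right mult_single mult.commute)
qed simp

lemma const_left_comm: "f * (const c * g) = const c * (f * g)"
  by (metis const_central mult.assoc)

lemma const_simps: "const (a + b) = const a + const b" "const (a * b) = const a * const b"
  "const (a - b) = const a - const b" "const 0 = 0" "const 1 = 1"
  by (simp_all add: const_def single_add single_diff mult_single single_one)

lemma const_sum: "const (sum f A) = (\<Sum>x\<in>A. const (f x))"
  by (induction A rule: infinite_finite_induct) (simp_all add: const_simps)

section \<open>The Hecke relations as a congruence on the free algebra\<close>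

context type_B begin

abbreviation FA where "FA \<equiv> carrier (free_algebra r)"

sublocale FR: ring "free_algebra r" by (rule ring_free_algebra)

lemma FA_ops: "x \<otimes>\<^bsub>free_algebra r\<^esub> y = x * y" "x \<oplus>\<^bsub>free_algebra r\<^esub> y = x + y"
  "\<zero>\<^bsub>free_algebra r\<^esub> = 0" "\<one>\<^bsub>free_algebra r\<^esub> = 1"
  by (simp_all add: free_algebra_def)

lemma FA_mult [simp]: "x \<in> FA \<Longrightarrow> y \<in> FA \<Longrightarrow> x * y \<in> FA"
  by (rule FR.m_closed[unfolded FA_ops])

lemma FA_add [simp]: "x \<in> FA \<Longrightarrow> y \<in> FA \<Longrightarrow> x + y \<in> FA"
  by (rule FR.a_closed[unfolded FA_ops])

lemma FA_zero_one [simp]: "0 \<in> FA" "1 \<in> FA"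
  using FR.zero_closed FR.one_closed by (simp_all add: FA_ops)

lemma FA_uminus [simp]: "x \<in> FA \<Longrightarrow> - x \<in> FA"
  by (simp add: free_algebra_def)

lemma FA_const [simp]: "const c \<in> FA"
  by (simp add: free_algebra_def const_def zero_word_def)

lemma FA_gen [simp]: "i \<in> {1..r} \<Longrightarrow> gen i \<in> FA"
  by (simp add: free_algebra_def gen_def)

lemma FA_diff [simp]: "x \<in> FA \<Longrightarrow> y \<in> FA \<Longrightarrow> x - y \<in> FA"
  using FA_add[of x "- y"] by simp

lemma FA_a_inv: "x \<in> FA \<Longrightarrow> \<ominus>\<^bsub>free_algebra r\<^esub> x = - x"
  by (rule FR.minus_equality) (simp_all add: FA_ops)

lemma FA_sum [simp]: "(\<And>x. x \<in> A \<Longrightarrow> f x \<in> FA) \<Longrightarrow> sum f A \<in> FA"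
  by (induction A rule: infinite_finite_induct) simp_all

lemma hecke_relations_FA: "hecke_relations r \<subseteq> FA"
proof -
  have "r \<in> {1..r}" "r - 1 \<in> {1..r}" using r2 by auto
  then show ?thesis by (auto simp: hecke_relations_def)
qed

sublocale HI: ideal "hecke_ideal r" "free_algebra r"
  unfolding hecke_ideal_def by (rule FR.genideal_ideal[OF hecke_relations_FA])

lemma relation_in_ideal: "x \<in> hecke_relations r \<Longrightarrow> x \<in> hecke_ideal r"
  unfolding hecke_ideal_def using FR.genideal_self[OF hecke_relations_FA] by blast

lemma ideal_closed:
  "x \<in> hecke_ideal r \<Longrightarrow> y \<in> hecke_ideal r \<Longrightarrow> x + y \<in> hecke_ideal r"
  "x \<in> hecke_ideal r \<Longrightarrow> - x \<in> hecke_ideal r"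
  "0 \<in> hecke_ideal r"
  "x \<in> hecke_ideal r \<Longrightarrow> y \<in> FA \<Longrightarrow> x * y \<in> hecke_ideal r"
  "x \<in> hecke_ideal r \<Longrightarrow> y \<in> FA \<Longrightarrow> y * x \<in> hecke_ideal r"
  using HI.a_closed[of x y] HI.a_inv_closed[of x] HI.zero_closed HI.I_l_closed[of x y]
    HI.I_r_closed[of x y] HI.Icarr[of x]
  by (simp_all add: FA_ops FA_a_inv)

text \<open>Congruence modulo the relations between representatives. Calculations take place in the
  type class ring \<open>free_elem\<close> and pass to the quotient only through
  \<open>proj_heq\<close>.\<close>

definition heq :: "free_elem \<Rightarrow> free_elem \<Rightarrow> bool" (infix "\<doteq>" 50) where
  "x \<doteq> y \<longleftrightarrow> x \<in> FA \<and> y \<in> FA \<and> x - y \<in> hecke_ideal r"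

lemma heq_FA: "x \<doteq> y \<Longrightarrow> x \<in> FA" "x \<doteq> y \<Longrightarrow> y \<in> FA"
  by (auto simp: heq_def)

lemma heq_refl: "x \<in> FA \<Longrightarrow> x \<doteq> x"
  by (simp add: heq_def ideal_closed)

lemma heq_sym: "x \<doteq> y \<Longrightarrow> y \<doteq> x"
  using ideal_closed(2)[of "x - y"] by (simp add: heq_def)

lemma heq_trans [trans]: "x \<doteq> y \<Longrightarrow> y \<doteq> z \<Longrightarrow> x \<doteq> z"
  using ideal_closed(1)[of "x - y" "y - z"] by (simp add: heq_def)

lemma heq_add: "x \<doteq> y \<Longrightarrow> x' \<doteq> y' \<Longrightarrow> x + x' \<doteq> y + y'"
  using ideal_closed(1)[of "x - y" "x' - y'"] by (simp add: heq_def algebra_simps)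

lemma heq_mult: "x \<doteq> y \<Longrightarrow> x' \<doteq> y' \<Longrightarrow> x * x' \<doteq> y * y'"
proof -
  assume a: "x \<doteq> y" "x' \<doteq> y'"
  then have "(x - y) * x' + y * (x' - y') \<in> hecke_ideal r"
    by (intro ideal_closed) (auto simp: heq_def)
  with a show ?thesis by (simp add: heq_def algebra_simps)
qed

lemma heq_sum: "(\<And>x. x \<in> A \<Longrightarrow> f x \<doteq> g x) \<Longrightarrow> sum f A \<doteq> sum g A"
  by (induction A rule: infinite_finite_induct) (auto intro: heq_refl heq_add)

lemma heq_multL: "x \<in> FA \<Longrightarrow> y \<doteq> z \<Longrightarrow> x * y \<doteq> x * z"
  and heq_multR: "x \<in> FA \<Longrightarrow> y \<doteq> z \<Longrightarrow> y * x \<doteq> z * x"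
  by (auto intro: heq_mult heq_refl)

text \<open>The parameter of the i-th quadratic relation; with it both kinds of relation take the
  common shape of \<open>gen_square\<close>.\<close>

definition qpar :: "nat \<Rightarrow> int poly" where
  "qpar i = (if i < r then qv else 1)"

lemma heqI_relation: "x - y \<in> hecke_relations r \<Longrightarrow> x \<in> FA \<Longrightarrow> y \<in> FA \<Longrightarrow> x \<doteq> y"
  by (simp add: heq_def relation_in_ideal)

lemma gen_commute:
  assumes "i \<in> {1..r}" "j \<in> {1..r}" "i + 2 \<le> j"
  shows "gen i * gen j \<doteq> gen j * gen i"
proof (rule heqI_relation)
  show "gen i * gen j - gen j * gen i \<in> hecke_relations r"
    unfolding hecke_relations_def using assms by blast
qed (use assms in simp_all)

lemma gen_braid:
  assumes "1 \<le> i" "i + 1 < r"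
  shows "gen i * gen (i+1) * gen i \<doteq> gen (i+1) * gen i * gen (i+1)"
proof (rule heqI_relation)
  show "gen i * gen (i+1) * gen i - gen (i+1) * gen i * gen (i+1) \<in> hecke_relations r"
    unfolding hecke_relations_def using assms by blast
qed (use assms in simp_all)

lemma gen_braid_last:
  "gen (r-1) * gen r * gen (r-1) * gen r \<doteq> gen r * gen (r-1) * gen r * gen (r-1)"
proof (rule heqI_relation)
  show "gen (r-1) * gen r * gen (r-1) * gen r - gen r * gen (r-1) * gen r * gen (r-1)
      \<in> hecke_relations r"
    unfolding hecke_relations_def by blast
qed (use r2 in simp_all)

lemma gen_square:
  assumes "i \<in> {1..r}"
  shows "gen i * gen i \<doteq> const (qpar i - 1) * gen i + const (qpar i)"
proof (cases "i < r")
  case True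
  have "gen i * gen i \<doteq> const (qv - 1) * gen i + const qv"
  proof (rule heqI_relation)
    show "gen i * gen i - (const (qv - 1) * gen i + const qv) \<in> hecke_relations r"
      unfolding hecke_relations_def using assms True by fastforce
  qed (use assms in simp_all)
  with True show ?thesis by (simp add: qpar_def)
next
  case False
  then have i: "i = r" using assms by simp
  have "gen r * gen r \<doteq> 1"
  proof (rule heqI_relation)
    show "gen r * gen r - 1 \<in> hecke_relations r" unfolding hecke_relations_def by blast
  qed (use r2 in simp_all)
  then show ?thesis by (simp add: i qpar_def const_simps)
qed

section \<open>Independence of the reduced word\<close>

definition gens :: "nat list \<Rightarrow> free_elem" where
  "gens xs = prod_list (map gen xs)"

lemma gens_simps: "gens [] = 1" "gens (x # xs) = gen x * gens xs" "gens (xs @ ys) = gens xs * gens ys"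
  by (simp_all add: gens_def)

lemma gens_FA [simp]: "set xs \<subseteq> {1..r} \<Longrightarrow> gens xs \<in> FA"
  by (induction xs) (simp_all add: gens_simps)

definition reduced :: "nat list \<Rightarrow> bool" where
  "reduced xs \<longleftrightarrow> set xs \<subseteq> {1..r} \<and> 2 * length xs = len2 (word_perm r xs)"

lemma word_perm_snoc: "word_perm r (xs @ [i]) = word_perm r xs \<circ> s i"
  by (simp add: word_perm_append word_perm_simps)

lemma reduced_snocD:
  assumes "reduced (xs @ [i])"
  shows "reduced xs" "i \<in> {1..r}" "word_perm r xs i < word_perm r xs (i+1)"
proof -
  let ?w = "word_perm r xs"
  show i: "i \<in> {1..r}" using assms by (simp add: reduced_def)
  have xs: "set xs \<subseteq> {1..r}" using assms by (simp add: reduced_def)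
  have w: "?w \<in> W" by (rule word_perm_W[OF xs])
  have l: "2 * length xs + 2 = len2 (?w \<circ> s i)"
    using assms unfolding reduced_def word_perm_snoc by simp
  have le: "len2 ?w \<le> 2 * length xs" by (rule len2_word_le[OF xs])
  show asc: "?w i < ?w (i+1)"
    using len2_desc[OF w i] W_asc_or_desc[OF w, of i] l le by linarith
  show "reduced xs"
    using len2_asc[OF w i asc] l le xs by (simp add: reduced_def)
qed

lemma reduced_snocI:
  assumes "reduced xs" "i \<in> {1..r}" "word_perm r xs i < word_perm r xs (i+1)"
  shows "reduced (xs @ [i])"
proof -
  have w: "word_perm r xs \<in> W" using assms(1) by (intro word_perm_W) (simp add: reduced_def)
  show ?thesis
    using assms len2_asc[OF w assms(2,3)] unfolding reduced_def word_perm_snoc by simp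
qed

lemma reduced_reduced_word: "w \<in> W \<Longrightarrow> reduced (reduced_word r w)"
  unfolding reduced_def using reduced_word[of w] by simp

text \<open>Each letter is a descent of what remains of w after the earlier letters have been
  removed on the right.\<close>

fun descends :: "(nat \<Rightarrow> nat) \<Rightarrow> nat list \<Rightarrow> bool" where
  "descends w [] \<longleftrightarrow> True"
| "descends w (u # us) \<longleftrightarrow> u \<in> {1..r} \<and> w (u+1) < w u \<and> descends (w \<circ> s u) us"

lemma descends_reduced:
  assumes "w \<in> W" "descends w us" "reduced ks" "word_perm r ks = w \<circ> word_perm r us"
  shows "reduced (ks @ rev us) \<and> word_perm r (ks @ rev us) = w"
  using assms
proof (induction us arbitrary: w)
  case Nil
  then show ?case by (simp add: word_perm_simps)
next
  case (Cons u us)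
  have u: "u \<in> {1..r}" "w (u+1) < w u" using Cons.prems by auto
  have "w \<circ> s u \<in> W" using Cons.prems u by (intro comp_W s_W)
  moreover have "word_perm r ks = (w \<circ> s u) \<circ> word_perm r us"
    unfolding Cons.prems(4) word_perm_simps comp_assoc ..
  moreover have "descends (w \<circ> s u) us" using Cons.prems(2) by simp
  ultimately have ks: "reduced (ks @ rev us)" "word_perm r (ks @ rev us) = w \<circ> s u"
    using Cons.IH Cons.prems(3) by blast+
  have "reduced ((ks @ rev us) @ [u])"
    by (rule reduced_snocI[OF ks(1) u(1)]) (use u s_at[OF u(1)] in \<open>simp add: ks(2)\<close>)
  moreover have "word_perm r ((ks @ rev us) @ [u]) = w"
    unfolding word_perm_snoc ks(2) by (rule comp_s_s[OF u(1)])
  ultimately show ?case by simp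
qed

text \<open>The inductive step of Matsumoto's theorem. In its uses \<open>i # us\<close> and
  \<open>j # vs\<close> spell the longest element of the subgroup generated by s_i and s_j, and ks
  is a reduced word for w with that element stripped off. After deleting the last letter, the
  induction hypothesis identifies each given word with ks followed by the reversal of one of the two
  lists; the braid relation joins these.\<close>

lemma exchange_words:
  assumes IH: "\<And>bs cs. length bs < length (as @ [i]) \<Longrightarrow> reduced bs \<Longrightarrow> reduced cs \<Longrightarrow>
      word_perm r bs = word_perm r cs \<Longrightarrow> gens bs \<doteq> gens cs"
    and as: "reduced (as @ [i])" "word_perm r (as @ [i]) = w"
    and bs: "reduced (bs @ [j])" "word_perm r (bs @ [j]) = w"
    and us: "descends w (i # us)" "descends w (j # vs)"
    and eq: "word_perm r (i # us) = word_perm r (j # vs)"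
      "gens (rev (i # us)) \<doteq> gens (rev (j # vs))"
  shows "gens (as @ [i]) \<doteq> gens (bs @ [j])"
proof -
  have W: "w \<in> W" using as word_perm_W[of "as @ [i]"] by (simp add: reduced_def)
  have ij: "i \<in> {1..r}" "j \<in> {1..r}" using us by auto
  have "set us \<subseteq> {1..r}" if "descends w us" for w us
    using that by (induction w us rule: descends.induct) auto
  with us have "set us \<subseteq> {1..r}" by fastforce
  then have "w \<circ> word_perm r (i # us) \<in> W"
    using ij by (intro comp_W W word_perm_W) auto
  then obtain ks where ks: "reduced ks" "word_perm r ks = w \<circ> word_perm r (i # us)"
    using reduced_reduced_word reduced_word(2) by blast
  have cancel: "u = v" if "u \<circ> s k = v \<circ> s k" "k \<in> {1..r}" for u v k
    using that comp_s_s by metis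
  have *: "gens (cs @ [k]) \<doteq> gens ks * gens (rev (k # ws))"
    if cs: "reduced (cs @ [k])" "word_perm r (cs @ [k]) = w"
      and ws: "descends w (k # ws)" "word_perm r (i # us) = word_perm r (k # ws)" for cs k ws
  proof -
    have len: "length cs < length (as @ [i])" using cs as by (simp add: reduced_def)
    have kr: "k \<in> {1..r}" using ws by auto
    have ksr: "reduced (ks @ rev (k # ws))" "word_perm r (ks @ rev (k # ws)) = w"
      using descends_reduced[OF W ws(1) ks(1)] ks(2) ws(2) by auto
    have "gens cs \<doteq> gens (ks @ rev ws)"
    proof (rule IH[OF len])
      show "reduced cs" using cs(1) by (rule reduced_snocD)
      show "reduced (ks @ rev ws)" using ksr(1) reduced_snocD(1)[of "ks @ rev ws" k] by simp
      show "word_perm r cs = word_perm r (ks @ rev ws)"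
      proof (rule cancel[OF _ kr])
        have "word_perm r (ks @ rev ws) \<circ> s k = w"
          using ksr(2) word_perm_snoc[of "ks @ rev ws" k] by simp
        with cs(2) show "word_perm r cs \<circ> s k = word_perm r (ks @ rev ws) \<circ> s k"
          unfolding word_perm_snoc by simp
      qed
    qed
    then have "gens cs * gen k \<doteq> gens (ks @ rev ws) * gen k"
      using kr by (intro heq_multR) auto
    then show ?thesis by (simp add: gens_simps mult.assoc)
  qed
  have "gens (as @ [i]) \<doteq> gens ks * gens (rev (i # us))"
    by (rule *[OF as us(1) refl])
  also have "gens ks * gens (rev (i # us)) \<doteq> gens ks * gens (rev (j # vs))"
    using ks(1) by (intro heq_multL eq(2)) (simp add: reduced_def)
  also have "gens ks * gens (rev (j # vs)) \<doteq> gens (bs @ [j])"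
    by (rule heq_sym[OF *[OF bs us(2) eq(1)]])
  finally show ?thesis .
qed

lemma s_fixes: "i \<in> {1..r} \<Longrightarrow> x \<notin> {i, i+1, 2*r-i, 2*r+1-i} \<Longrightarrow> s i x = x"
  by (auto simp: simple_refl_def transpose_def)

text \<open>Induction on the length, comparing last letters. If these differ, both are descents of
  w, so w ends in the longest element of a subgroup of type A1 x A1, A2 or B2, and the relation of
  that subgroup applies.\<close>

theorem matsumoto:
  assumes "reduced as" "reduced bs" "word_perm r as = word_perm r bs"
  shows "gens as \<doteq> gens bs"
  using assms
proof (induction "length as" arbitrary: as bs rule: less_induct)
  case less
  show ?case
  proof (cases "length as = 0")
    case True
    then have "length bs = 0" using less.prems by (simp add: reduced_def)
    then show ?thesis using True by (simp add: gens_simps heq_refl)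
  next
    case False
    then have "length bs \<noteq> 0" using less.prems by (auto simp: reduced_def)
    with False obtain as' i bs' j where eq: "as = as' @ [i]" "bs = bs' @ [j]"
      by (metis length_0_conv rev_exhaust)
    define w where "w = word_perm r as"
    have W: "w \<in> W" unfolding w_def using less.prems by (intro word_perm_W) (simp add: reduced_def)
    have as: "reduced (as' @ [i])" "word_perm r (as' @ [i]) = w"
      and bs: "reduced (bs' @ [j])" "word_perm r (bs' @ [j]) = w"
      using less.prems eq w_def by auto
    have desc: "k \<in> {1..r} \<and> w (k+1) < w k"
      if "reduced (cs @ [k])" "word_perm r (cs @ [k]) = w" for cs k
      using reduced_snocD[OF that(1)] s_at[of k] that(2) by (auto simp: word_perm_snoc)
    note di = desc[OF as] and dj = desc[OF bs]
    have IH: "gens bs \<doteq> gens cs" if "length bs < length (cs' @ [k])" "length (cs' @ [k]) = length as"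
      "reduced bs" "reduced cs" "word_perm r bs = word_perm r cs" for bs cs cs' k
      using less.hyps that by simp
    have len: "length (as' @ [i]) = length as" "length (bs' @ [j]) = length as"
      using eq less.prems by (auto simp: reduced_def)
    \<comment> \<open>The two words play symmetric roles, so it suffices to treat last letters k <
      l.\<close>
    have lt: "gens (cs @ [k]) \<doteq> gens (ds @ [l])"
      if kl: "k < l" and cs: "reduced (cs @ [k])" "word_perm r (cs @ [k]) = w"
        and ds: "reduced (ds @ [l])" "word_perm r (ds @ [l]) = w"
        and len: "length (cs @ [k]) = length as" for k l cs ds
    proof -
      note dk = desc[OF cs] and dl = desc[OF ds]
      note ex = exchange_words[OF IH[OF _ len] cs ds]
      consider "k + 2 \<le> l" | "l = k + 1" "l < r" | "l = r" "k = r - 1" using kl dl by force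
      then show ?thesis
      proof cases
        case 1
        have fx: "s k l = l" "s k (l+1) = l+1" "s l k = k" "s l (k+1) = k+1"
          using 1 dk dl by (auto intro!: s_fixes)
        show ?thesis
        proof (rule ex[of "[l]" "[k]"])
          show "word_perm r [k, l] = word_perm r [l, k]"
            using s_commute[of k l] 1 dk dl by (simp add: word_perm_simps)
          show "gens (rev [k, l]) \<doteq> gens (rev [l, k])"
            using gen_commute[of k l] 1 dk dl by (auto simp: gens_simps intro: heq_sym)
        qed (use dk dl fx in auto)
      next
        case 2
        have kr: "k \<in> {1..r}" "k + 1 \<in> {1..r}" using dk dl 2 by auto
        have at: "s k k = Suc k" "s k (Suc k) = k" "s (Suc k) (Suc k) = Suc (Suc k)"
          "s (Suc k) (Suc (Suc k)) = Suc k"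
          using s_at[OF kr(1)] s_at[OF kr(2)] by auto
        have fx: "s k (Suc (Suc k)) = Suc (Suc k)" "s (Suc k) k = k"
          using 2 kr by (auto intro!: s_fixes)
        have ws: "w (Suc k) < w k" "w (Suc (Suc k)) < w (Suc k)" using dk dl 2 by auto
        have "descends w [k, k+1, k]" "descends w [k+1, k, k+1]"
          using kr at fx ws by auto
        moreover have "word_perm r [k, k+1, k] = word_perm r [k+1, k, k+1]"
          using s_braid[of k] 2 dk by (simp add: word_perm_simps comp_assoc)
        moreover have "gens (rev [k, k+1, k]) \<doteq> gens (rev [k+1, k, k+1])"
          using gen_braid[of k] 2 dk by (simp add: gens_simps mult.assoc)
        ultimately show ?thesis
          unfolding 2(1) by (intro ex[of "[k+1, k]" "[k, k+1]", unfolded 2(1)])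
      next
        case 3
        have at: "s k k = r" "s k r = k" "s r r = r + 1" "s r (r+1) = r"
          using s_at[of k] s_at[of r] dk dl 3 r2 by auto
        have fx: "s k (r+1) = r+2" "s k (r+2) = r + 1" "s r k = k" "s r (r+2) = r+2"
        proof -
          have k: "1 \<le> k" "r = k + 1" using 3 r2 by auto
          note s_k = s_split[OF k(1) order.refl k(2)]
          show "s k (r+1) = r+2" "s k (r+2) = r + 1" unfolding s_k using k(2) by simp_all
          show "s r k = k" "s r (r+2) = r+2" unfolding s_last using k by simp_all
        qed
        \<comment> \<open>The braid words of type B2 also compare the values at r + 1 and r + 2;
          this descent is the mirror image of the one at k = r - 1.\<close>
        have m: "w (r+2) < w (r+1)"
        proof -
          have "w (2*r+1-k) = 2*r+1 - w k" "w (2*r+1-r) = 2*r+1 - w r"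
            using W_mirror[OF W, of k] W_mirror[OF W, of r] dk r2 by auto
          moreover have "2*r+1-k = r+2" "2*r+1-r = r+1" using 3 r2 by auto
          moreover have "w r < w k" using dk 3 r2 by auto
          moreover have "w k \<le> 2*r" using W_in[OF W, of k] dk by auto
          ultimately show ?thesis by (simp add: diff_less_mono2)
        qed
        have kr: "k + 1 = r" "k \<in> {1..r}" using 3 r2 by auto
        have ws: "w r < w k" "w (r+1) < w r" using dk dl 3 kr by auto
        show ?thesis unfolding \<open>l = r\<close>
        proof (rule ex[of "[l, k, l]" "[k, l, k]", unfolded \<open>l = r\<close>])
          show "word_perm r [k, r, k, r] = word_perm r [r, k, r, k]"
            using s_braid_last 3 by (simp add: word_perm_simps comp_assoc)
          show "gens (rev [k, r, k, r]) \<doteq> gens (rev [r, k, r, k])"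
            using gen_braid_last 3 by (auto simp: gens_simps mult.assoc intro: heq_sym)
          show "descends w [k, r, k, r]" "descends w [r, k, r, k]"
            using kr at fx m ws r2 by auto
        qed
      qed
    qed
    consider "i = j" | "i < j" | "j < i" by linarith
    then show ?thesis
    proof cases
      case 1
      have "word_perm r as' \<circ> s i \<circ> s i = word_perm r bs' \<circ> s i \<circ> s i"
        using as(2) bs(2) 1 unfolding word_perm_snoc by simp
      then have "word_perm r as' = word_perm r bs'" using di by simp
      then have "gens as' \<doteq> gens bs'"
        using reduced_snocD(1)[OF as(1)] reduced_snocD(1)[OF bs(1)] eq
        by (intro less.hyps) auto
      then show ?thesis using di 1 by (auto simp: eq gens_simps intro: heq_multR)
    next
      case 2
      then show ?thesis unfolding eq by (rule lt[OF _ as bs len(1)])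
    next
      case 3
      then show ?thesis unfolding eq by (intro heq_sym[OF lt[OF _ bs as len(2)]])
    qed
  qed
qed


section \<open>The elements T_w and left multiplication on coefficient functions\<close>

definition Tw :: "(nat \<Rightarrow> nat) \<Rightarrow> free_elem" where
  "Tw w = gens (reduced_word r w)"

lemma Tw_FA [simp]: "w \<in> W \<Longrightarrow> Tw w \<in> FA"
  unfolding Tw_def by (rule gens_FA[OF reduced_word(1)])

lemma gens_reduced: "reduced xs \<Longrightarrow> word_perm r xs = w \<Longrightarrow> gens xs \<doteq> Tw w"
proof -
  assume xs: "reduced xs" "word_perm r xs = w"
  then have w: "w \<in> W" using word_perm_W[of xs] by (simp add: reduced_def)
  then show ?thesis unfolding Tw_def
    by (intro matsumoto xs reduced_reduced_word) (simp_all only: xs(2) reduced_word(2))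
qed

lemma Tw_id: "Tw id = 1"
proof -
  have "length (reduced_word r id) = 0"
    using reduced_word(3)[OF id_W] len2_id by linarith
  then show ?thesis by (simp add: Tw_def gens_simps)
qed

lemma Tw_snoc:
  assumes "w \<in> W" "i \<in> {1..r}" "w i < w (i+1)"
  shows "Tw (w \<circ> s i) \<doteq> Tw w * gen i"
proof -
  have rw: "reduced (reduced_word r w)" "word_perm r (reduced_word r w) = w"
    by (rule reduced_reduced_word[OF assms(1)], rule reduced_word(2)[OF assms(1)])
  then have "reduced (reduced_word r w @ [i])" using assms by (intro reduced_snocI) auto
  then have "gens (reduced_word r w @ [i]) \<doteq> Tw (w \<circ> s i)"
    by (rule gens_reduced) (simp only: word_perm_snoc rw)
  then show ?thesis by (simp add: Tw_def gens_simps heq_sym)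
qed

text \<open>Taking inverses turns left factors into right factors and preserves the length, so the
  word prolonged on the left is again reduced.\<close>

lemma Tw_cons:
  assumes "w \<in> W" "i \<in> {1..r}" "pinv w i < pinv w (i+1)"
  shows "Tw (s i \<circ> w) \<doteq> gen i * Tw w"
proof -
  have "len2 (s i \<circ> w) = len2 (pinv (s i \<circ> w))"
    using assms by (intro len2_inv[symmetric] comp_W s_W)
  also have "pinv (s i \<circ> w) = pinv w \<circ> s i"
    using assms by (simp add: W_inv_comp s_W inv_s)
  also have "len2 (pinv w \<circ> s i) = len2 (pinv w) + 2"
    using assms by (intro len2_asc inv_W)
  also have "len2 (pinv w) = len2 w" using assms by (intro len2_inv)
  finally have len: "len2 (s i \<circ> w) = len2 w + 2" .
  have eq: "word_perm r (i # reduced_word r w) = s i \<circ> w"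
    unfolding word_perm_simps reduced_word(2)[OF assms(1)] ..
  have "2 * length (i # reduced_word r w) = len2 (s i \<circ> w)"
    using len reduced_word(3)[OF assms(1)] by simp
  then have "reduced (i # reduced_word r w)"
    unfolding reduced_def eq using assms reduced_word(1)[OF assms(1)] by simp
  from gens_reduced[OF this eq] show ?thesis by (simp add: Tw_def gens_simps heq_sym)
qed

text \<open>Indexing by the inverse makes left multiplication by T_i a comparison of the values of v
  at the adjacent positions i and i + 1.\<close>

definition theta :: "((nat \<Rightarrow> nat) \<Rightarrow> int poly) \<Rightarrow> free_elem" where
  "theta \<phi> = (\<Sum>v\<in>W. const (\<phi> v) * Tw (pinv v))"

text \<open>Left multiplication by T_i on coefficient functions, see \<open>gen_theta\<close>. The
  factors \<open>qpar i\<close> and \<open>qpar i - 1\<close> come from the quadratic relation at a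
  descent.\<close>

definition tau :: "nat \<Rightarrow> ((nat \<Rightarrow> nat) \<Rightarrow> int poly) \<Rightarrow> (nat \<Rightarrow> nat) \<Rightarrow> int poly" where
  "tau i \<phi> v = (if v i < v (i+1) then qpar i * \<phi> (v \<circ> s i) else \<phi> (v \<circ> s i) + (qpar i - 1) * \<phi> v)"

lemma theta_FA [simp]: "theta \<phi> \<in> FA"
  unfolding theta_def by (intro FA_sum FA_mult FA_const Tw_FA inv_W)

lemma theta_cong: "(\<And>v. v \<in> W \<Longrightarrow> \<phi> v = \<psi> v) \<Longrightarrow> theta \<phi> = theta \<psi>"
  by (simp add: theta_def)

lemma theta_sum: "theta (\<lambda>v. \<Sum>p\<in>P. \<phi> p v) = (\<Sum>p\<in>P. theta (\<phi> p))"
  unfolding theta_def const_sum sum_distrib_right by (rule sum.swap)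

lemma theta_scale: "theta (\<lambda>v. c * \<phi> v) = const c * theta \<phi>"
  by (simp add: theta_def const_simps sum_distrib_left mult.assoc)

lemma gen_Tw_desc:
  assumes v: "v \<in> W" and i: "i \<in> {1..r}" and d: "v (i+1) < v i"
  shows "gen i * Tw (pinv v) \<doteq>
    const (qpar i - 1) * Tw (pinv v) + const (qpar i) * Tw (pinv (v \<circ> s i))"
proof -
  let ?u = "v \<circ> s i"
  have u: "?u \<in> W" using v i by (intro comp_W s_W)
  have pv: "pinv v = s i \<circ> pinv ?u"
    using v i by (simp add: W_inv_comp s_W inv_s fun_eq_iff s_invol)
  have au: "pinv (pinv ?u) i < pinv (pinv ?u) (i+1)"
    unfolding W_inv_inv[OF u] using d s_at[OF i] by simp
  have T: "Tw (pinv v) \<doteq> gen i * Tw (pinv ?u)"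
    unfolding pv by (rule Tw_cons[OF inv_W[OF u] i au])
  have "gen i * Tw (pinv v) \<doteq> gen i * (gen i * Tw (pinv ?u))"
    using i by (intro heq_multL T) simp
  also have "\<dots> = gen i * gen i * Tw (pinv ?u)" by (simp add: mult.assoc)
  also have "\<dots> \<doteq> (const (qpar i - 1) * gen i + const (qpar i)) * Tw (pinv ?u)"
    by (intro heq_multR gen_square i Tw_FA inv_W u)
  also have "\<dots> = const (qpar i - 1) * (gen i * Tw (pinv ?u)) + const (qpar i) * Tw (pinv ?u)"
    by (simp add: distrib_right mult.assoc)
  also have "\<dots> \<doteq> const (qpar i - 1) * Tw (pinv v) + const (qpar i) * Tw (pinv ?u)"
    by (intro heq_add heq_multL heq_sym[OF T] heq_refl FA_mult FA_const Tw_FA inv_W u)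
  finally show ?thesis .
qed

lemma bij_comp_s: "i \<in> {1..r} \<Longrightarrow> bij_betw (\<lambda>v. v \<circ> s i) W W"
  using comp_W[OF _ s_W[of i]]
  by (intro bij_betw_byWitness[where f' = "\<lambda>v. v \<circ> s i"]) auto

lemma gen_theta:
  assumes i: "i \<in> {1..r}"
  shows "gen i * theta \<phi> \<doteq> theta (tau i \<phi>)"
proof -
  \<comment> \<open>a v is the coefficient that v passes on to v s_i, and b v is the coefficient
    that stays at v.\<close>
  define a where "a v = (if v i < v (i+1) then \<phi> v else \<phi> v * qpar i)" for v
  define b where "b v = (if v i < v (i+1) then 0 else \<phi> v * (qpar i - 1))" for v
  have "gen i * theta \<phi> = (\<Sum>v\<in>W. const (\<phi> v) * (gen i * Tw (pinv v)))"
    by (simp add: theta_def sum_distrib_left const_left_comm)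
  also have "\<dots> \<doteq> (\<Sum>v\<in>W. const (a v) * Tw (pinv (v \<circ> s i)) + const (b v) * Tw (pinv v))"
  proof (rule heq_sum)
    fix v assume v: "v \<in> W"
    have vs: "v \<circ> s i \<in> W" using v i by (intro comp_W s_W)
    show "const (\<phi> v) * (gen i * Tw (pinv v)) \<doteq>
        const (a v) * Tw (pinv (v \<circ> s i)) + const (b v) * Tw (pinv v)"
    proof (cases "v i < v (i+1)")
      case True
      have "Tw (s i \<circ> pinv v) \<doteq> gen i * Tw (pinv v)"
        using True by (intro Tw_cons inv_W v i) (simp only: W_inv_inv[OF v])
      moreover have "pinv (v \<circ> s i) = s i \<circ> pinv v" using v i by (simp add: W_inv_comp s_W inv_s)
      ultimately have "gen i * Tw (pinv v) \<doteq> Tw (pinv (v \<circ> s i))" by (simp only: heq_sym)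
      then have "const (\<phi> v) * (gen i * Tw (pinv v)) \<doteq> const (\<phi> v) * Tw (pinv (v \<circ> s i))"
        by (intro heq_multL FA_const)
      then show ?thesis using True by (simp add: a_def b_def const_simps)
    next
      case False
      have "const (\<phi> v) * (gen i * Tw (pinv v)) \<doteq> const (\<phi> v) *
          (const (qpar i - 1) * Tw (pinv v) + const (qpar i) * Tw (pinv (v \<circ> s i)))"
        using W_asc_or_desc[OF v False] by (intro heq_multL gen_Tw_desc v i FA_const)
      also have "\<dots> = const (a v) * Tw (pinv (v \<circ> s i)) + const (b v) * Tw (pinv v)"
        using False
        by (simp only: a_def b_def if_False const_simps(2) distrib_left mult.assoc add.commute)
      finally show ?thesis .
    qed
  qed
  also have "\<dots> = (\<Sum>v\<in>W. const (a v) * Tw (pinv (v \<circ> s i))) + (\<Sum>v\<in>W. const (b v) * Tw (pinv v))"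
    by (rule sum.distrib)
  also have "(\<Sum>v\<in>W. const (a v) * Tw (pinv (v \<circ> s i))) =
      (\<Sum>v\<in>W. const (a (v \<circ> s i)) * Tw (pinv v))"
    by (subst sum.reindex_bij_betw[OF bij_comp_s[OF i], symmetric]) (simp only: comp_s_s[OF i])
  also have "\<dots> + (\<Sum>v\<in>W. const (b v) * Tw (pinv v)) =
      (\<Sum>v\<in>W. const (a (v \<circ> s i) + b v) * Tw (pinv v))"
    by (simp only: const_simps distrib_right sum.distrib)
  also have "\<dots> = theta (tau i \<phi>)"
    unfolding theta_def
  proof (rule sum.cong)
    fix v assume v: "v \<in> W"
    have "v i \<noteq> v (i+1)" using W_inj[OF v] by simp
    then have "a (v \<circ> s i) + b v = tau i \<phi> v"
      using s_at[OF i] by (auto simp: a_def b_def tau_def mult.commute)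
    then show "const (a (v \<circ> s i) + b v) * Tw (pinv v) = const (tau i \<phi> v) * Tw (pinv v)" by simp
  qed simp
  finally show ?thesis .
qed

lemma gens_theta: "set xs \<subseteq> {1..r} \<Longrightarrow> gens xs * theta \<phi> \<doteq> theta (foldr tau xs \<phi>)"
proof (induction xs)
  case (Cons x xs)
  then have "gen x * (gens xs * theta \<phi>) \<doteq> gen x * theta (foldr tau xs \<phi>)"
    by (intro heq_multL) auto
  also have "\<dots> \<doteq> theta (tau x (foldr tau xs \<phi>))" using Cons.prems by (intro gen_theta) auto
  finally show ?case by (simp add: gens_simps mult.assoc)
qed (simp add: gens_simps heq_refl)

section \<open>Sums over unions of cosets\<close>

definition tsum :: "(nat \<Rightarrow> nat) set \<Rightarrow> free_elem" where
  "tsum D = (\<Sum>w\<in>D. Tw w)"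

lemma tsum_FA [simp]: "D \<subseteq> W \<Longrightarrow> tsum D \<in> FA"
  unfolding tsum_def by (intro FA_sum Tw_FA) auto

lemma theta_indicator:
  assumes "D \<subseteq> W"
  shows "theta (\<lambda>v. if pinv v \<in> D then 1 else 0) = tsum D"
proof -
  have "bij_betw pinv W W"
    by (rule bij_betw_byWitness[where f' = pinv]) (auto simp: W_inv_inv inv_W)
  then have "theta (\<lambda>v. if pinv v \<in> D then 1 else 0) = (\<Sum>w\<in>W. const (if w \<in> D then 1 else 0) * Tw w)"
    unfolding theta_def by (rule sum.reindex_bij_betw)
  also have "\<dots> = (\<Sum>w\<in>W. if w \<in> D then Tw w else 0)"
    by (rule sum.cong) (auto simp: const_simps)
  also have "\<dots> = tsum D"
    unfolding tsum_def using assms by (simp add: sum.If_cases finite_W Int_absorb1)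
  finally show ?thesis .
qed

lemma asc_stab:
  assumes c: "sym_colouring N c" and d: "d \<in> W" "\<forall>i\<in>adj c. d i < d (i+1)"
    and u: "u \<in> stab c" and i: "i \<in> adj c" "u i < u (i+1)"
  shows "d (u i) < d (u (i+1))"
proof (rule asc_colour[OF c d _ _ i(2)])
  have ir: "i \<in> {1..2*r}" "i + 1 \<in> {1..2*r}" using i by (auto simp: adj_def)
  then show "u i \<in> {1..2*r}" "u (i+1) \<in> {1..2*r}" using W_in[OF stab_W[OF u]] by auto
  show "c (u i) = c (u (i+1))" using u i ir by (simp add: stab_def adj_def)
qed

text \<open>Since d increases on each colour class, an ascent of u in \<open>adj c\<close> is an
  ascent of d u (\<open>asc_stab\<close>); the product is built up one letter at a time.\<close>

lemma Tw_coset_right: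
  assumes c: "sym_colouring N c" and d: "d \<in> W" "\<forall>i\<in>adj c. d i < d (i+1)"
    and u: "u \<in> stab c"
  shows "Tw (d \<circ> u) \<doteq> Tw d * Tw u"
  using c u
proof (induction u rule: stab_descent_induct)
  case id
  show ?case using heq_refl[OF Tw_FA[OF d(1)]] by (simp add: Tw_id[unfolded id_def])
next
  case (desc u i)
  have ir: "i \<in> {1..r}" using desc(2) by (simp add: adj_def)
  have uW: "u \<in> W" using desc(1) by (rule stab_W)
  have "Tw (d \<circ> u \<circ> s i) \<doteq> Tw (d \<circ> u) * gen i"
    using asc_stab[OF c d desc(1-3)] by (intro Tw_snoc comp_W d uW ir) simp
  also have "\<dots> \<doteq> Tw d * Tw u * gen i" using ir by (intro heq_multR desc) simp
  also have "\<dots> = Tw d * (Tw u * gen i)" by (simp add: mult.assoc)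
  also have "\<dots> \<doteq> Tw d * Tw (u \<circ> s i)"
    by (intro heq_multL heq_sym[OF Tw_snoc] Tw_FA d uW ir desc)
  finally show ?case by (simp only: comp_assoc)
qed

lemma Tw_coset_left:
  assumes c: "sym_colouring N c" and d: "d \<in> W" "\<forall>i\<in>adj c. pinv d i < pinv d (i+1)"
    and u: "u \<in> stab c"
  shows "Tw (u \<circ> d) \<doteq> Tw u * Tw d"
proof -
  have "Tw (pinv v \<circ> d) \<doteq> Tw (pinv v) * Tw d" if v: "v \<in> stab c" for v
    using c v
  proof (induction v rule: stab_descent_induct)
    case id
    show ?case using heq_refl[OF Tw_FA[OF d(1)]]
      by (simp add: Tw_id[unfolded id_def] inv_id[unfolded id_def])
  next
    case (desc v i)
    have ir: "i \<in> {1..r}" using desc(2) by (simp add: adj_def)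
    have vW: "v \<in> W" using desc(1) by (rule stab_W)
    have pv: "pinv (v \<circ> s i) = s i \<circ> pinv v" using vW ir by (simp add: W_inv_comp s_W inv_s)
    have "Tw (s i \<circ> (pinv v \<circ> d)) \<doteq> gen i * Tw (pinv v \<circ> d)"
    proof (intro Tw_cons comp_W inv_W vW d(1) ir)
      have "pinv (pinv v \<circ> d) = pinv d \<circ> v"
        using W_inv_comp[OF inv_W[OF vW] d(1)] W_inv_inv[OF vW] by simp
      then show "pinv (pinv v \<circ> d) i < pinv (pinv v \<circ> d) (i+1)"
        using asc_stab[OF c inv_W[OF d(1)] d(2) desc(1-3)] by simp
    qed
    also have "\<dots> \<doteq> gen i * (Tw (pinv v) * Tw d)" using ir by (intro heq_multL desc) simp
    also have "\<dots> = (gen i * Tw (pinv v)) * Tw d" by (simp add: mult.assoc)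
    also have "\<dots> \<doteq> Tw (s i \<circ> pinv v) * Tw d"
      using desc(3) W_inv_inv[OF vW]
      by (intro heq_multR heq_sym[OF Tw_cons] Tw_FA d(1) inv_W vW ir) simp_all
    finally show ?case unfolding pv by (simp only: comp_assoc)
  qed
  from this[OF stab_inv[OF u]] show ?thesis by (simp only: W_inv_inv[OF stab_W[OF u]])
qed

lemma coset_min_right:
  assumes c: "sym_colouring N c" and w: "w \<in> W"
  shows "\<exists>d\<in>W. \<exists>u\<in>stab c. w = d \<circ> u \<and> (\<forall>i\<in>adj c. d i < d (i+1))"
  using w
proof (induction "len2 w" arbitrary: w rule: less_induct)
  case less
  show ?case
  proof (cases "\<forall>i\<in>adj c. w i < w (i+1)")
    case True
    then show ?thesis using less.prems stab_id[of c] by (metis comp_id)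
  next
    case False
    then obtain i where i: "i \<in> adj c" "\<not> w i < w (i+1)" by blast
    have ir: "i \<in> {1..r}" using i by (simp add: adj_def)
    have "len2 (w \<circ> s i) < len2 w"
      using len2_desc[OF less.prems ir W_asc_or_desc[OF less.prems i(2)]] by simp
    moreover have "w \<circ> s i \<in> W" by (intro comp_W less.prems s_W ir)
    ultimately obtain d u where du: "d \<in> W" "u \<in> stab c" "w \<circ> s i = d \<circ> u"
      "\<forall>i\<in>adj c. d i < d (i+1)"
      using less.hyps by blast
    have "w = w \<circ> s i \<circ> s i" using ir by (simp only: comp_s_s)
    also have "\<dots> = d \<circ> (u \<circ> s i)" unfolding du(3) by (rule comp_assoc)
    finally show ?thesis using du stab_comp[OF du(2) s_stab[OF c i(1)]] by blast
  qed
qed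

text \<open>D is a union of cosets of the stabiliser, each with a representative d that increases on
  colour classes and each summing to T_d times the stabiliser sum. The factor y later defines the
  map sending the generator of one summand to the sum over D.\<close>

lemma tsum_right_factor:
  assumes c: "sym_colouring N c" and "D \<subseteq> W"
    and "\<And>w u. w \<in> D \<Longrightarrow> u \<in> stab c \<Longrightarrow> w \<circ> u \<in> D"
  shows "\<exists>y\<in>FA. tsum D \<doteq> y * tsum (stab c)"
proof -
  have "finite D" using assms(2) finite_W by (rule finite_subset)
  then show ?thesis using assms(2,3)
  proof (induction D rule: finite_psubset_induct)
    case (psubset D)
    have SW: "stab c \<subseteq> W" by (auto simp: stab_def)
    show ?case
    proof (cases "D = {}")
      case True
      have "tsum {} = 0 * tsum (stab c)" by (simp add: tsum_def)
      then show ?thesis using True heq_refl[of 0] by (intro bexI[of _ 0]) (auto simp: tsum_def)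
    next
      case False
      then obtain w where w: "w \<in> D" by blast
      obtain d u where d: "d \<in> W" "u \<in> stab c" "w = d \<circ> u" "\<forall>i\<in>adj c. d i < d (i+1)"
        using coset_min_right[OF c, of w] w psubset.prems by blast
      \<comment> \<open>The coset of w is removed from D; what is left is again closed under right
        multiplication by the stabiliser.\<close>
      define E where "E = (\<lambda>v. d \<circ> v) ` stab c"
      have E: "d \<circ> v = w \<circ> (pinv u \<circ> v)" for v
        using W_inv_o(2)[OF stab_W[OF d(2)]] by (simp add: d(3) fun_eq_iff)
      have ED: "E \<subseteq> D"
      proof
        fix x assume "x \<in> E"
        then obtain v where v: "v \<in> stab c" "x = d \<circ> v" by (auto simp: E_def)
        show "x \<in> D"
          unfolding v(2) E by (rule psubset.prems(2)[OF w stab_comp[OF stab_inv[OF d(2)] v(1)]])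
      qed
      have "w \<in> E" using d by (auto simp: E_def)
      then have "D - E \<subset> D" using w by blast
      moreover have "v \<circ> x \<in> D - E" if v: "v \<in> D - E" and x: "x \<in> stab c" for v x
      proof -
        have "v \<circ> x \<notin> E"
        proof
          assume "v \<circ> x \<in> E"
          then obtain z where z: "z \<in> stab c" "v \<circ> x = d \<circ> z" by (auto simp: E_def)
          have "v = (v \<circ> x) \<circ> pinv x" using W_inv_o(2)[OF stab_W[OF x]] by (simp add: comp_assoc)
          also have "\<dots> = d \<circ> (z \<circ> pinv x)" unfolding z by (rule comp_assoc)
          finally have "v \<in> E" unfolding E_def using stab_comp[OF z(1) stab_inv[OF x]] by blast
          with v show False by simp
        qed
        with psubset.prems(2) v x show ?thesis by blast
      qed
      ultimately obtain y where y: "y \<in> FA" "tsum (D - E) \<doteq> y * tsum (stab c)"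
        using psubset.IH[of "D - E"] psubset.prems(1) by blast
      have inj: "inj_on (\<lambda>v. d \<circ> v) (stab c)"
        using W_inj[OF d(1)] by (auto simp: inj_on_def fun_eq_iff)
      have "tsum E = (\<Sum>v\<in>stab c. Tw (d \<circ> v))"
        unfolding E_def tsum_def by (rule sum.reindex_cong[OF inj refl refl])
      also have "\<dots> \<doteq> (\<Sum>v\<in>stab c. Tw d * Tw v)"
        by (rule heq_sum[OF Tw_coset_right[OF c d(1,4)]])
      also have "\<dots> = Tw d * tsum (stab c)" unfolding tsum_def sum_distrib_left ..
      finally have "tsum E \<doteq> Tw d * tsum (stab c)" .
      then have "tsum E + tsum (D - E) \<doteq> Tw d * tsum (stab c) + y * tsum (stab c)"
        using y by (intro heq_add)
      moreover have "tsum D = tsum E + tsum (D - E)"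
        unfolding tsum_def using sum.subset_diff[OF ED] psubset.hyps by (simp add: add.commute)
      ultimately show ?thesis using y(1) d(1)
        by (intro bexI[of _ "Tw d + y"]) (simp_all add: distrib_right)
    qed
  qed
qed

text \<open>The counterpart for cosets on the other side. It places a double coset sum in the right
  ideal generated by the stabiliser sum.\<close>

lemma tsum_left_factor:
  assumes c: "sym_colouring N c" and "D \<subseteq> W"
    and "\<And>w u. w \<in> D \<Longrightarrow> u \<in> stab c \<Longrightarrow> u \<circ> w \<in> D"
  shows "\<exists>z\<in>FA. tsum D \<doteq> tsum (stab c) * z"
proof -
  have "finite D" using assms(2) finite_W by (rule finite_subset)
  then show ?thesis using assms(2,3)
  proof (induction D rule: finite_psubset_induct)
    case (psubset D)
    have SW: "stab c \<subseteq> W" by (auto simp: stab_def)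
    show ?case
    proof (cases "D = {}")
      case True
      then show ?thesis using heq_refl[of 0] by (intro bexI[of _ 0]) (auto simp: tsum_def)
    next
      case False
      then obtain w where w: "w \<in> D" by blast
      then have wW: "w \<in> W" using psubset.prems by blast
      obtain d' u' where d': "d' \<in> W" "u' \<in> stab c" "pinv w = d' \<circ> u'" "\<forall>i\<in>adj c. d' i < d' (i+1)"
        using coset_min_right[OF c inv_W[OF wW]] by blast
      \<comment> \<open>The decomposition of the inverse of w, inverted.\<close>
      define d u where "d = pinv d'" and "u = pinv u'"
      have d: "d \<in> W" "u \<in> stab c" "\<forall>i\<in>adj c. pinv d i < pinv d (i+1)"
        using d' by (simp_all add: d_def u_def inv_W stab_inv W_inv_inv)
      have wd: "w = u \<circ> d"
        using W_inv_inv[OF wW] W_inv_comp[OF d'(1) stab_W[OF d'(2)]] unfolding d_def u_def d'(3)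
        by simp
      define E where "E = (\<lambda>v. v \<circ> d) ` stab c"
      have E: "v \<circ> d = (v \<circ> pinv u) \<circ> w" for v
        using W_inv_o(1)[OF stab_W[OF d(2)]] by (simp add: wd fun_eq_iff)
      have ED: "E \<subseteq> D"
      proof
        fix x assume "x \<in> E"
        then obtain v where v: "v \<in> stab c" "x = v \<circ> d" by (auto simp: E_def)
        show "x \<in> D"
          unfolding v(2) E by (rule psubset.prems(2)[OF w stab_comp[OF v(1) stab_inv[OF d(2)]]])
      qed
      have "w \<in> E" using d wd by (auto simp: E_def)
      then have "D - E \<subset> D" using w by blast
      moreover have "x \<circ> v \<in> D - E" if v: "v \<in> D - E" and x: "x \<in> stab c" for v x
      proof -
        have "x \<circ> v \<notin> E"
        proof
          assume "x \<circ> v \<in> E"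
          then obtain z where z: "z \<in> stab c" "x \<circ> v = z \<circ> d" by (auto simp: E_def)
          have "v = pinv x \<circ> (x \<circ> v)" using W_inv_o(1)[OF stab_W[OF x]] by (simp flip: comp_assoc)
          also have "\<dots> = (pinv x \<circ> z) \<circ> d" unfolding z by (rule comp_assoc[symmetric])
          finally have "v \<in> E" unfolding E_def using stab_comp[OF stab_inv[OF x] z(1)] by blast
          with v show False by simp
        qed
        with psubset.prems(2) v x show ?thesis by blast
      qed
      ultimately obtain z where z: "z \<in> FA" "tsum (D - E) \<doteq> tsum (stab c) * z"
        using psubset.IH[of "D - E"] psubset.prems(1) by blast
      have inj: "inj_on (\<lambda>v. v \<circ> d) (stab c)"
        using d(1) by (auto simp: inj_on_def fun_eq_iff) (metis W_inv_f(2))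
      have "tsum E = (\<Sum>v\<in>stab c. Tw (v \<circ> d))"
        unfolding E_def tsum_def by (rule sum.reindex_cong[OF inj refl refl])
      also have "\<dots> \<doteq> (\<Sum>v\<in>stab c. Tw v * Tw d)"
        by (rule heq_sum[OF Tw_coset_left[OF c d(1,3)]])
      also have "\<dots> = tsum (stab c) * Tw d" unfolding tsum_def sum_distrib_right ..
      finally have "tsum E \<doteq> tsum (stab c) * Tw d" .
      then have "tsum E + tsum (D - E) \<doteq> tsum (stab c) * Tw d + tsum (stab c) * z"
        using z by (intro heq_add)
      moreover have "tsum D = tsum E + tsum (D - E)"
        unfolding tsum_def using sum.subset_diff[OF ED] psubset.hyps by (simp add: add.commute)
      ultimately show ?thesis using z(1) d(1)
        by (intro bexI[of _ "Tw d + z"]) (simp_all add: distrib_left)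
    qed
  qed
qed

end

section \<open>Geometric sums over ranks\<close>

text \<open>The ranks in a finite ordered set are 0, ..., |S| - 1, each taken once; the factor q - 1
  gives the geometric sum a closed form without division.\<close>

lemma rank_sum:
  fixes f :: "'a \<Rightarrow> 'b::linorder" and q :: "'c::comm_ring_1"
  assumes "finite S" "inj_on f S"
  shows "(q - 1) * (\<Sum>i\<in>S. q ^ card {j\<in>S. f j < f i}) = q ^ card S - 1"
  using assms
proof (induction S rule: finite_ranking_induct[where f = f])
  case (insert x S)
  show ?case
  proof (cases "x \<in> S")
    case True
    then show ?thesis using insert by (simp add: insert_absorb)
  next
    case False
    have lt: "f y < f x" if "y \<in> S" for y
      using insert.hyps(2)[OF that] insert.prems that False by (auto simp: inj_on_def order_less_le)
    have "{j \<in> insert x S. f j < f x} = S" using lt by auto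
    moreover have "{j \<in> insert x S. f j < f i} = {j \<in> S. f j < f i}" if "i \<in> S" for i
      using lt[OF that] by auto
    ultimately have "(\<Sum>i\<in>insert x S. q ^ card {j \<in> insert x S. f j < f i}) =
        q ^ card S + (\<Sum>i\<in>S. q ^ card {j \<in> S. f j < f i})"
      using False insert.hyps(1) by simp
    then show ?thesis
      using insert.IH insert.prems False insert.hyps(1) by (simp add: algebra_simps)
  qed
qed simp

lemma card_Collect_insert:
  "finite A \<Longrightarrow> x \<notin> A \<Longrightarrow> card {j \<in> insert x A. P j} = card {j \<in> A. P j} + (if P x then 1 else 0)"
proof -
  assume a: "finite A" "x \<notin> A"
  have "{j \<in> insert x A. P j} = (if P x then insert x {j \<in> A. P j} else {j \<in> A. P j})" by auto
  then show ?thesis using a by simp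
qed

section \<open>Sums of operators along one side block\<close>

context type_B begin

lemma word_perm_rev_upt:
  assumes "1 \<le> m" "m \<le> i" "i \<le> r"
  shows "word_perm r (rev [m..<i]) m = i" "x < m \<Longrightarrow> word_perm r (rev [m..<i]) x = x"
proof -
  have "word_perm r (rev [m..<i]) m = i \<and> (x < m \<longrightarrow> word_perm r (rev [m..<i]) x = x)"
    using assms(2,3)
  proof (induction i rule: dec_induct)
    case base
    then show ?case by (simp add: word_perm_simps)
  next
    case (step i)
    then have i: "i \<in> {1..<r}" using assms(1) by auto
    have "word_perm r (rev [m..<Suc i]) = s i \<circ> word_perm r (rev [m..<i])"
      using step.hyps by (simp add: word_perm_simps)
    moreover have "s i i = Suc i" "x < m \<longrightarrow> s i x = x"
      using s_low[OF i, of i] s_low[OF i, of x] i step.hyps by auto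
    ultimately show ?case using step.IH step.prems by simp
  qed
  then show "word_perm r (rev [m..<i]) m = i" "x < m \<Longrightarrow> word_perm r (rev [m..<i]) x = x"
    by auto
qed

lemma set_upt_in: "1 \<le> m \<Longrightarrow> i \<le> r \<Longrightarrow> set [m..<i] \<subseteq> {1..r}"
  by auto

lemma invariant_word:
  assumes inv: "\<And>v i. v \<in> W \<Longrightarrow> i \<in> A \<Longrightarrow> \<phi> (v \<circ> s i) = \<phi> v" and A: "A \<subseteq> {1..r}"
    and v: "v \<in> W"
  shows "set xs \<subseteq> A \<Longrightarrow> \<phi> (v \<circ> word_perm r xs) = (\<phi> v :: 'z)"
proof (induction xs rule: rev_induct)
  case (snoc x xs)
  have x: "x \<in> A" and xs: "set xs \<subseteq> A" using snoc.prems by auto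
  have "v \<circ> word_perm r xs \<in> W" using xs A by (intro comp_W v word_perm_W) auto
  from inv[OF this x] have "\<phi> (v \<circ> word_perm r xs \<circ> s x) = \<phi> (v \<circ> word_perm r xs)" .
  then show ?case using snoc.IH[OF xs] by (simp only: word_perm_snoc comp_assoc)
qed (simp only: word_perm_simps comp_id)

text \<open>A reflection at distance at least two commutes with s_m and does not touch the compared
  positions m and m + 1.\<close>

lemma tau_invariant:
  assumes inv: "\<And>v. v \<in> W \<Longrightarrow> \<phi> (v \<circ> s i) = \<phi> v" and m: "m \<in> {1..r}" and i: "i \<in> {1..r}"
    and far: "m + 2 \<le> i \<or> i + 2 \<le> m" and v: "v \<in> W"
  shows "tau m \<phi> (v \<circ> s i) = tau m \<phi> v"
proof -
  have "s i m = m" "s i (m+1) = m+1" using far m i by (auto intro!: s_fixes)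
  moreover have "s i \<circ> s m = s m \<circ> s i" using far m i s_commute[of i m] s_commute[of m i] by auto
  then have "\<phi> (v \<circ> s i \<circ> s m) = \<phi> (v \<circ> s m)"
    using inv[of "v \<circ> s m"] comp_W[OF v s_W[OF m]] by (simp only: comp_assoc)
  ultimately show ?thesis using inv[OF v] by (simp add: tau_def)
qed

text \<open>Induction on m, splitting off the innermost operator \<open>tau m\<close>. Where v i < v
  m it leaves a term (q - 1) \<phi>(v); over all such i these terms form the geometric sum of
  \<open>rank_sum\<close> and raise the coefficient of \<phi>(v) from 1 to the required power of
  q.\<close>

lemma up_formula:
  assumes "1 \<le> m" "m \<le> b" "b \<le> r"
    and "\<And>v i. v \<in> W \<Longrightarrow> i \<in> {m<..<b} \<Longrightarrow> \<phi> (v \<circ> s i) = \<phi> v" and "v \<in> W"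
  shows "(\<Sum>k\<in>{m..b}. foldr tau (rev [m..<k]) \<phi> v) =
    (\<Sum>i\<in>{m..b}. qv ^ card {j\<in>{m..b}. v j < v i} * \<phi> (v \<circ> word_perm r (rev [m..<i])))"
  using assms(2,1,3-5)
proof (induction m arbitrary: \<phi> rule: inc_induct)
  case base
  show ?case by (simp add: word_perm_simps[unfolded id_def] Collect_conv_if)
next
  case (step m)
  have m: "m \<in> {1..<r}" "m \<in> {1..r}" using step by auto
  have v: "v \<in> W" by fact
  \<comment> \<open>At these positions \<open>tau m\<close> leaves a term with the factor q - 1;
    together they contribute q^|S| - 1 times the value at v.\<close>
  define S where "S = {i\<in>{Suc m..b}. v i < v m}"
  define c where "c i = card {j\<in>{m..b}. v j < v i}" for i
  define c' where "c' i = card {j\<in>{Suc m..b}. v j < v i}" for i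
  define g where "g i = word_perm r (rev [m..<i])" for i
  have mb: "{m..b} = insert m {Suc m..b}" using step.hyps by auto
  have br: "b \<le> r" by fact
  have inv: "\<phi> (v \<circ> s i) = \<phi> v" if "v \<in> W" "i \<in> {m<..<b}" for v i
    by (rule step.prems(3)[OF that])
  have inv': "tau m \<phi> (v \<circ> s i) = tau m \<phi> v" if "v \<in> W" "i \<in> {Suc m<..<b}" for v i
  proof -
    have i: "i \<in> {m<..<b}" "i \<in> {1..r}" "m + 2 \<le> i \<or> i + 2 \<le> m" using that br by auto
    show ?thesis by (rule tau_invariant[where \<phi> = \<phi> and i = i, OF inv[OF _ i(1)] m(2) i(2,3) that(1)])
  qed
  have "(\<Sum>k\<in>{m..b}. foldr tau (rev [m..<k]) \<phi> v) =
      \<phi> v + (\<Sum>k\<in>{Suc m..b}. foldr tau (rev [m..<k]) \<phi> v)"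
    unfolding mb by simp
  also have "(\<Sum>k\<in>{Suc m..b}. foldr tau (rev [m..<k]) \<phi> v) =
      (\<Sum>k\<in>{Suc m..b}. foldr tau (rev [Suc m..<k]) (tau m \<phi>) v)"
    by (intro sum.cong refl) (simp add: upt_conv_Cons)
  also have "\<dots> = (\<Sum>i\<in>{Suc m..b}. qv ^ c' i * tau m \<phi> (v \<circ> word_perm r (rev [Suc m..<i])))"
    unfolding c'_def using m br by (intro step.IH inv' v) simp_all
  also have "\<dots> = (\<Sum>i\<in>{Suc m..b}. qv ^ c i * \<phi> (v \<circ> g i) +
      (if i \<in> S then (qv - 1) * qv ^ c' i * \<phi> v else 0))"
  proof (rule sum.cong)
    fix i assume i: "i \<in> {Suc m..b}"
    let ?h = "word_perm r (rev [Suc m..<i])"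
    have im: "(v \<circ> ?h) m = v m" "(v \<circ> ?h) (m+1) = v i"
      using word_perm_rev_upt[of "Suc m" i] i step.prems by auto
    have "rev [m..<i] = rev [Suc m..<i] @ [m]" using i by (simp add: upt_conv_Cons)
    then have gi: "v \<circ> ?h \<circ> s m = v \<circ> g i" unfolding g_def by (simp only: word_perm_snoc comp_assoc)
    have inv: "\<phi> (v \<circ> ?h) = \<phi> v"
      by (rule invariant_word[where A = "{m<..<b}", OF inv _ v]) (use i br in auto)
    have tau: "tau m \<phi> (v \<circ> ?h) =
        (if v m < v i then qv * \<phi> (v \<circ> g i) else \<phi> (v \<circ> g i) + (qv - 1) * \<phi> v)"
      unfolding tau_def im gi inv using m by (simp add: qpar_def)
    have ci: "c i = c' i + (if v m < v i then 1 else 0)"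
      unfolding c_def c'_def mb by (rule card_Collect_insert) auto
    have iS: "i \<in> S \<longleftrightarrow> \<not> v m < v i" using i W_inj[OF v, of i m] by (auto simp: S_def)
    show "qv ^ c' i * tau m \<phi> (v \<circ> ?h) = qv ^ c i * \<phi> (v \<circ> g i) +
        (if i \<in> S then (qv - 1) * qv ^ c' i * \<phi> v else 0)"
      unfolding tau ci iS by (simp add: algebra_simps)
  qed simp
  also have "\<dots> = (\<Sum>i\<in>{Suc m..b}. qv ^ c i * \<phi> (v \<circ> g i)) + (\<Sum>i\<in>S. (qv - 1) * qv ^ c' i * \<phi> v)"
    unfolding sum.distrib S_def by (subst sum.inter_filter) simp_all
  also have "(\<Sum>i\<in>S. (qv - 1) * qv ^ c' i * \<phi> v) = ((qv - 1) * (\<Sum>i\<in>S. qv ^ c' i)) * \<phi> v"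
    by (simp add: sum_distrib_left sum_distrib_right)
  also have "(qv - 1) * (\<Sum>i\<in>S. qv ^ c' i) = qv ^ card S - 1"
  proof -
    have "c' i = card {j\<in>S. v j < v i}" if "i \<in> S" for i
      unfolding c'_def using that by (intro arg_cong[where f = card]) (auto simp: S_def)
    moreover have "inj_on v S" using W_inj[OF v] by (auto simp: inj_on_def)
    moreover have "finite S" by (simp add: S_def)
    ultimately show ?thesis using rank_sum[of S v qv] by simp
  qed
  also have "card S = c m" unfolding S_def c_def mb by (subst card_Collect_insert) auto
  finally have "(\<Sum>k\<in>{m..b}. foldr tau (rev [m..<k]) \<phi> v) =
      qv ^ c m * \<phi> v + (\<Sum>i\<in>{Suc m..b}. qv ^ c i * \<phi> (v \<circ> g i))"
    by (simp only: left_diff_distrib mult_1 diff_add_cancel add.commute add_diff_eq add.left_commute diff_diff_eq2 add_diff_cancel_left')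
  moreover have "v \<circ> g m = v" by (simp add: g_def word_perm_simps)
  moreover have "(\<Sum>i\<in>{m..b}. qv ^ c i * \<phi> (v \<circ> g i)) =
      qv ^ c m * \<phi> (v \<circ> g m) + (\<Sum>i\<in>{Suc m..b}. qv ^ c i * \<phi> (v \<circ> g i))"
    unfolding mb by (subst sum.insert) auto
  ultimately show ?case unfolding c_def g_def by (simp only:)
qed

lemma word_perm_upt:
  assumes "1 \<le> i" "i \<le> t" "t \<le> r"
  shows "word_perm r [i..<t] t = i" "x \<le> r \<Longrightarrow> t < x \<Longrightarrow> word_perm r [i..<t] x = x"
proof -
  have "word_perm r [i..<t] t = i \<and> (x \<le> r \<and> t < x \<longrightarrow> word_perm r [i..<t] x = x)"
    using assms(2,1)
  proof (induction i rule: inc_induct)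
    case base
    then show ?case by (simp add: word_perm_simps)
  next
    case (step i)
    then have i: "i \<in> {1..<r}" using assms(3) by auto
    have "word_perm r [i..<t] = s i \<circ> word_perm r [Suc i..<t]"
      using step.hyps by (simp add: upt_conv_Cons word_perm_simps)
    moreover have "s i (Suc i) = i" "x \<le> r \<and> t < x \<longrightarrow> s i x = x"
      using s_low[OF i, of "Suc i"] s_low[OF i, of x] i step.hyps by auto
    ultimately show ?case using step.IH step.prems by simp
  qed
  then show "word_perm r [i..<t] t = i" "x \<le> r \<Longrightarrow> t < x \<Longrightarrow> word_perm r [i..<t] x = x"
    by auto
qed

text \<open>The mirror version of \<open>up_formula\<close>: positions are moved to the right end t
  of the block, so larger values are counted instead of smaller ones.\<close>

lemma down_formula:
  assumes "1 \<le> l" "l \<le> t" "t \<le> r"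
    and "\<And>v i. v \<in> W \<Longrightarrow> i \<in> {l..<t - 1} \<Longrightarrow> \<phi> (v \<circ> s i) = \<phi> v" and "v \<in> W"
  shows "(\<Sum>a\<in>{l..t}. foldr tau [a..<t] \<phi> v) =
    (\<Sum>i\<in>{l..t}. qv ^ card {j\<in>{l..t}. v i < v j} * \<phi> (v \<circ> word_perm r [i..<t]))"
  using assms(2,1,3-5)
proof (induction t arbitrary: \<phi> rule: dec_induct)
  case base
  show ?case by (simp add: word_perm_simps[unfolded id_def] Collect_conv_if)
next
  case (step t)
  have m: "t \<in> {1..<r}" "t \<in> {1..r}" using step by auto
  have v: "v \<in> W" by fact
  define S where "S = {i\<in>{l..t}. v (Suc t) < v i}"
  define c where "c i = card {j\<in>{l..Suc t}. v i < v j}" for i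
  define c' where "c' i = card {j\<in>{l..t}. v i < v j}" for i
  define g where "g i = word_perm r [i..<Suc t]" for i
  have mb: "{l..Suc t} = insert (Suc t) {l..t}" using step.hyps by auto
  have tr: "Suc t \<le> r" and l1: "1 \<le> l" by fact+
  have inv: "\<phi> (v \<circ> s i) = \<phi> v" if "v \<in> W" "i \<in> {l..<Suc t - 1}" for v i
    by (rule step.prems(3)[OF that])
  have inv': "tau t \<phi> (v \<circ> s i) = tau t \<phi> v" if "v \<in> W" "i \<in> {l..<t - 1}" for v i
  proof -
    have i: "i \<in> {l..<Suc t - 1}" "i \<in> {1..r}" "t + 2 \<le> i \<or> i + 2 \<le> t" using that tr l1 by auto
    show ?thesis by (rule tau_invariant[where \<phi> = \<phi> and i = i, OF inv[OF _ i(1)] m(2) i(2,3) that(1)])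
  qed
  have "(\<Sum>k\<in>{l..Suc t}. foldr tau [k..<Suc t] \<phi> v) =
      \<phi> v + (\<Sum>k\<in>{l..t}. foldr tau [k..<Suc t] \<phi> v)"
    unfolding mb by simp
  also have "(\<Sum>k\<in>{l..t}. foldr tau [k..<Suc t] \<phi> v) =
      (\<Sum>k\<in>{l..t}. foldr tau [k..<t] (tau t \<phi>) v)"
    by (intro sum.cong refl) simp
  also have "\<dots> = (\<Sum>i\<in>{l..t}. qv ^ c' i * tau t \<phi> (v \<circ> word_perm r [i..<t]))"
    unfolding c'_def using l1 tr by (intro step.IH inv' v) simp_all
  also have "\<dots> = (\<Sum>i\<in>{l..t}. qv ^ c i * \<phi> (v \<circ> g i) +
      (if i \<in> S then (qv - 1) * qv ^ c' i * \<phi> v else 0))"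
  proof (rule sum.cong)
    fix i assume i: "i \<in> {l..t}"
    let ?h = "word_perm r [i..<t]"
    have im: "(v \<circ> ?h) t = v i" "(v \<circ> ?h) (t+1) = v (Suc t)"
      using word_perm_upt[of i t] i step.prems by auto
    have "[i..<Suc t] = [i..<t] @ [t]" using i by simp
    then have gi: "v \<circ> ?h \<circ> s t = v \<circ> g i" unfolding g_def by (simp only: word_perm_snoc comp_assoc)
    have inv: "\<phi> (v \<circ> ?h) = \<phi> v"
      by (rule invariant_word[where A = "{l..<Suc t - 1}", OF inv _ v]) (use i tr l1 in auto)
    have tau: "tau t \<phi> (v \<circ> ?h) =
        (if v i < v (Suc t) then qv * \<phi> (v \<circ> g i) else \<phi> (v \<circ> g i) + (qv - 1) * \<phi> v)"
      unfolding tau_def im gi inv using m by (simp add: qpar_def)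
    have ci: "c i = c' i + (if v i < v (Suc t) then 1 else 0)"
      unfolding c_def c'_def mb by (rule card_Collect_insert) auto
    have iS: "i \<in> S \<longleftrightarrow> \<not> v i < v (Suc t)" using i W_inj[OF v, of i "Suc t"] by (auto simp: S_def)
    show "qv ^ c' i * tau t \<phi> (v \<circ> ?h) = qv ^ c i * \<phi> (v \<circ> g i) +
        (if i \<in> S then (qv - 1) * qv ^ c' i * \<phi> v else 0)"
      unfolding tau ci iS by (simp add: algebra_simps)
  qed simp
  also have "\<dots> = (\<Sum>i\<in>{l..t}. qv ^ c i * \<phi> (v \<circ> g i)) + (\<Sum>i\<in>S. (qv - 1) * qv ^ c' i * \<phi> v)"
    unfolding sum.distrib S_def by (subst sum.inter_filter) simp_all
  also have "(\<Sum>i\<in>S. (qv - 1) * qv ^ c' i * \<phi> v) = ((qv - 1) * (\<Sum>i\<in>S. qv ^ c' i)) * \<phi> v"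
    by (simp add: sum_distrib_left sum_distrib_right)
  also have "(qv - 1) * (\<Sum>i\<in>S. qv ^ c' i) = qv ^ card S - 1"
  proof -
    \<comment> \<open>\<open>rank_sum\<close> counts smaller elements; negated integer values make
      it count larger ones.\<close>
    have "c' i = card {j\<in>S. - int (v j) < - int (v i)}" if "i \<in> S" for i
      unfolding c'_def using that by (intro arg_cong[where f = card]) (auto simp: S_def)
    moreover have "inj_on (\<lambda>x. - int (v x)) S" using W_inj[OF v] by (auto simp: inj_on_def)
    moreover have "finite S" by (simp add: S_def)
    ultimately show ?thesis using rank_sum[of S "\<lambda>x. - int (v x)" qv] by simp
  qed
  also have "card S = c (Suc t)" unfolding S_def c_def mb by (subst card_Collect_insert) auto
  finally have "(\<Sum>k\<in>{l..Suc t}. foldr tau [k..<Suc t] \<phi> v) =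
      qv ^ c (Suc t) * \<phi> v + (\<Sum>i\<in>{l..t}. qv ^ c i * \<phi> (v \<circ> g i))"
    by (simp only: left_diff_distrib mult_1 diff_add_cancel add.commute add_diff_eq add.left_commute diff_diff_eq2 add_diff_cancel_left')
  moreover have "v \<circ> g (Suc t) = v" by (simp add: g_def word_perm_simps)
  moreover have "(\<Sum>i\<in>{l..Suc t}. qv ^ c i * \<phi> (v \<circ> g i)) =
      qv ^ c (Suc t) * \<phi> (v \<circ> g (Suc t)) + (\<Sum>i\<in>{l..t}. qv ^ c i * \<phi> (v \<circ> g i))"
    unfolding mb by (subst sum.insert) auto
  ultimately show ?case unfolding c_def g_def by (simp only:)
qed

section \<open>Sums of operators across the central block\<close>

text \<open>The parabolic subgroup of type B on the positions strictly between m and 2r + 1 - m,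
  since fixing a point fixes its mirror image.\<close>

definition fixing :: "nat \<Rightarrow> (nat \<Rightarrow> nat) set" where
  "fixing m = {u \<in> W. \<forall>x\<in>{1..m}. u x = x}"

lemma fixing_comp: "u \<in> fixing m \<Longrightarrow> v \<in> fixing m \<Longrightarrow> u \<circ> v \<in> fixing m"
  by (auto simp: fixing_def comp_W)

lemma fixing_W: "u \<in> fixing m \<Longrightarrow> u \<in> W"
  by (simp add: fixing_def)

lemma id_fixing: "id \<in> fixing m"
  by (simp add: fixing_def id_W)

lemma s_fixing: "i \<in> {1..r} \<Longrightarrow> m < i \<Longrightarrow> s i \<in> fixing m"
proof -
  assume i: "i \<in> {1..r}" "m < i"
  have "s i x = x" if "x \<in> {1..m}" for x
    using that i by (intro s_fixes) auto
  then show ?thesis using s_W[OF i(1)] by (simp add: fixing_def)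
qed

lemma s_last_above: "i + 1 < r \<Longrightarrow> 1 \<le> i \<Longrightarrow> s i (r+1) = r+1" "i + 1 < r \<Longrightarrow> 1 \<le> i \<Longrightarrow> s i r = r"
  by (auto intro!: s_fixes)

lemma word_perm_fixing:
  assumes "set xs \<subseteq> {m..<r}" "1 \<le> m"
  shows "word_perm r xs \<in> fixing (m - 1)" "word_perm r xs ` {m..r} = {m..r}"
proof -
  have "word_perm r xs \<in> fixing (m - 1) \<and> word_perm r xs ` {m..r} \<subseteq> {m..r}"
    using assms(1)
  proof (induction xs)
    case Nil
    show ?case unfolding word_perm_simps by (rule conjI[OF id_fixing]) simp
  next
    case (Cons x xs)
    then have x: "x \<in> {1..<r}" "x \<in> {1..r}" "m \<le> x" and xs: "set xs \<subseteq> {m..<r}" using assms(2) by auto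
    have "s x ` {m..r} \<subseteq> {m..r}" using s_low[OF x(1)] x by auto
    moreover have "s x \<in> fixing (m - 1)" using x assms(2) by (intro s_fixing) auto
    ultimately show ?case
      using Cons.IH[OF xs] unfolding word_perm_simps image_comp[symmetric]
      by (blast intro: fixing_comp)
  qed
  then have fx: "word_perm r xs \<in> fixing (m - 1)" and sub: "word_perm r xs ` {m..r} \<subseteq> {m..r}"
    by blast+
  show "word_perm r xs \<in> fixing (m - 1)" by (rule fx)
  have "inj_on (word_perm r xs) {m..r}" using W_inj[OF fixing_W[OF fx]] by (simp add: inj_on_def)
  then show "word_perm r xs ` {m..r} = {m..r}" by (intro endo_inj_surj sub) simp
qed

text \<open>The value of \<open>(\<tau>\<^bsub>r-1\<^esub> \<dots> \<tau>\<^sub>m \<phi>)(v u)\<close> when \<open>P\<close> and \<open>x\<close> are the images of \<open>{m..<r}\<close>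
  and \<open>r\<close> under \<open>u\<close>, and \<open>F v i\<close> is the value of \<open>\<phi>\<close> after moving \<open>i\<close> to position \<open>m\<close>.\<close>

definition last_term ::
  "((nat \<Rightarrow> nat) \<Rightarrow> nat \<Rightarrow> int poly) \<Rightarrow> (nat \<Rightarrow> nat) \<Rightarrow> nat set \<Rightarrow> nat \<Rightarrow> int poly" where
  "last_term F v P x = qv ^ card {j\<in>P. v j < v x} * F v x +
     (qv - 1) * (\<Sum>i | i \<in> P \<and> v x < v i. qv ^ card {j\<in>P. v j < v i} * F v i)"

text \<open>The central block is the interval from m to 2r + 1 - m. In the application F comes from
  \<open>phi_move_down\<close>, where only the colour of the value at u m matters.\<close>

context
  fixes m :: nat and \<phi> :: "(nat \<Rightarrow> nat) \<Rightarrow> int poly" and F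
  assumes m: "1 \<le> m" "m \<le> r"
    and F: "\<And>v u. v \<in> W \<Longrightarrow> u \<in> fixing (m - 1) \<Longrightarrow> \<phi> (v \<circ> u) = F v (u m)"
begin

lemma F_equivariant:
  assumes "v \<in> W" "u \<in> fixing (m - 1)" "i \<in> {m..r}"
  shows "F (v \<circ> u) i = F v (u i)"
proof -
  let ?g = "word_perm r (rev [m..<i])"
  have g: "?g \<in> fixing (m - 1)" "?g m = i"
    using word_perm_fixing[of "rev [m..<i]" m] word_perm_rev_upt[of m i] assms(3) m by auto
  have "F (v \<circ> u) i = \<phi> (v \<circ> u \<circ> ?g)"
    using F[OF comp_W[OF assms(1) fixing_W[OF assms(2)]] g(1)] g(2) by simp
  also have "\<dots> = F v ((u \<circ> ?g) m)"
    using F[OF assms(1) fixing_comp[OF assms(2) g(1)]] by (simp only: comp_assoc)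
  finally show ?thesis using g(2) by simp
qed

lemma phi_invariant: "v \<in> W \<Longrightarrow> i \<in> {m<..r} \<Longrightarrow> \<phi> (v \<circ> s i) = \<phi> v"
proof -
  assume v: "v \<in> W" and i: "i \<in> {m<..r}"
  then have ir: "i \<in> {1..r}" by auto
  have "s i m = m" using s_fixing[OF ir, of m] i m by (auto simp: fixing_def)
  moreover have "s i \<in> fixing (m - 1)" using i by (intro s_fixing ir) auto
  ultimately show ?thesis
    using F[OF v, of "s i"] F[OF v id_fixing] by simp
qed

lemma up_F:
  assumes "b \<le> r" "m \<le> b" "v \<in> W"
  shows "(\<Sum>k\<in>{m..b}. foldr tau (rev [m..<k]) \<phi> v) =
    (\<Sum>i\<in>{m..b}. qv ^ card {j\<in>{m..b}. v j < v i} * F v i)"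
proof -
  have "(\<Sum>k\<in>{m..b}. foldr tau (rev [m..<k]) \<phi> v) =
    (\<Sum>i\<in>{m..b}. qv ^ card {j\<in>{m..b}. v j < v i} * \<phi> (v \<circ> word_perm r (rev [m..<i])))"
    using assms by (intro up_formula m phi_invariant) auto
  moreover have "\<phi> (v \<circ> word_perm r (rev [m..<i])) = F v i" if "i \<in> {m..b}" for i
    using F[OF assms(3) word_perm_fixing(1)[of "rev [m..<i]" m]] word_perm_rev_upt[of m i]
      that assms m by simp
  ultimately show ?thesis by simp
qed

text \<open>The word reaching r is isolated as the difference of the sums in \<open>up_F\<close> for
  the blocks ending at r and at r - 1.\<close>

lemma last_term_phi:
  assumes v: "v \<in> W"
  shows "foldr tau (rev [m..<r]) \<phi> v = last_term F v {m..<r} r"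
proof (cases "m = r")
  case True
  then show ?thesis using F[OF v id_fixing] by (simp add: last_term_def)
next
  case False
  define c where "c i = card {j\<in>{m..<r}. v j < v i}" for i
  have P: "{m..r} = insert r {m..<r}" "{m..r-1} = {m..<r}" using m False by auto
  have a: "(\<Sum>k\<in>{m..<r}. foldr tau (rev [m..<k]) \<phi> v) = (\<Sum>i\<in>{m..<r}. qv ^ c i * F v i)"
    using up_F[of "r-1" v] v m False unfolding P(2) c_def by simp
  have card: "card {j\<in>{m..r}. v j < v i} = c i + (if v r < v i then 1 else 0)" for i
    unfolding P(1) c_def by (rule card_Collect_insert) auto
  have "foldr tau (rev [m..<r]) \<phi> v + (\<Sum>k\<in>{m..<r}. foldr tau (rev [m..<k]) \<phi> v) =
      (\<Sum>k\<in>{m..r}. foldr tau (rev [m..<k]) \<phi> v)"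
    unfolding P(1) by (subst sum.insert) auto
  also have "\<dots> = (\<Sum>i\<in>{m..r}. qv ^ (c i + (if v r < v i then 1 else 0)) * F v i)"
    using up_F[of r v] v m unfolding card by simp
  also have "\<dots> = qv ^ c r * F v r +
      (\<Sum>i\<in>{m..<r}. qv ^ (c i + (if v r < v i then 1 else 0)) * F v i)"
    unfolding P(1) by (subst sum.insert) auto
  also have "(\<Sum>i\<in>{m..<r}. qv ^ (c i + (if v r < v i then 1 else 0)) * F v i) =
      (\<Sum>i\<in>{m..<r}. qv ^ c i * F v i + (if v r < v i then (qv - 1) * (qv ^ c i * F v i) else 0))"
    by (rule sum.cong) (auto simp: algebra_simps)
  also have "\<dots> = (\<Sum>i\<in>{m..<r}. qv ^ c i * F v i) +
      (\<Sum>i | i \<in> {m..<r} \<and> v r < v i. (qv - 1) * (qv ^ c i * F v i))"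
    unfolding sum.distrib by (subst sum.inter_filter) simp_all
  finally show ?thesis
    unfolding a last_term_def sum_distrib_left c_def[symmetric] by (simp add: algebra_simps)
qed

text \<open>Replacing v by v u merely relabels positions by u, because F is equivariant.\<close>

lemma last_term_comp:
  assumes v: "v \<in> W" and u: "u \<in> fixing (m - 1)"
  shows "foldr tau (rev [m..<r]) \<phi> (v \<circ> u) = last_term F v (u ` {m..<r}) (u r)"
proof -
  have inj: "inj_on u A" for A using W_inj[OF fixing_W[OF u]] by (auto simp: inj_on_def)
  have card: "card {j\<in>{m..<r}. (v \<circ> u) j < y} = card {j \<in> u ` {m..<r}. v j < y}" for y
    by (subst card_image[OF inj, symmetric]) (auto intro: arg_cong[where f = card])
  have sum: "(\<Sum>i | i \<in> u ` {m..<r} \<and> v (u r) < v i. G i) =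
      (\<Sum>i | i \<in> {m..<r} \<and> v (u r) < (v \<circ> u) i. G (u i))" for G :: "nat \<Rightarrow> int poly"
    by (rule sum.reindex_cong[OF inj]) auto
  have FF: "F (v \<circ> u) i = F v (u i)" if "i \<in> {m..r}" for i
    using F_equivariant[OF v u that] .
  have "foldr tau (rev [m..<r]) \<phi> (v \<circ> u) = last_term F (v \<circ> u) {m..<r} r"
    by (rule last_term_phi[OF comp_W[OF v fixing_W[OF u]]])
  also have "\<dots> = qv ^ card {j \<in> u ` {m..<r}. v j < (v \<circ> u) r} * F v (u r) +
     (qv - 1) * (\<Sum>i | i \<in> {m..<r} \<and> (v \<circ> u) r < (v \<circ> u) i.
        qv ^ card {j \<in> u ` {m..<r}. v j < (v \<circ> u) i} * F v (u i))"
    unfolding last_term_def card using FF m by simp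
  also have "\<dots> = last_term F v (u ` {m..<r}) (u r)"
    unfolding last_term_def sum by simp
  finally show ?thesis .
qed

text \<open>The right factor shared by all words that cross the middle.\<close>

definition second_half :: "(nat \<Rightarrow> nat) \<Rightarrow> int poly" where
  "second_half = tau r (foldr tau (rev [m..<r]) \<phi>)"

text \<open>The parameter of s_r is 1, so \<open>tau r\<close> is plain translation by s_r; it
  leaves m, ..., r - 1 alone and exchanges r with r + 1.\<close>

lemma second_half_eq:
  assumes v: "v \<in> W" and u: "u \<in> fixing (m - 1)"
  shows "second_half (v \<circ> u) = last_term F v (u ` {m..<r}) (u (r+1))"
proof -
  have r: "r \<in> {1..r}" using r2 by auto
  have sr: "s r \<in> fixing (m - 1)" using m by (intro s_fixing r) auto
  have "second_half (v \<circ> u) = foldr tau (rev [m..<r]) \<phi> (v \<circ> (u \<circ> s r))"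
    by (simp add: second_half_def tau_def qpar_def comp_assoc)
  also have "\<dots> = last_term F v ((u \<circ> s r) ` {m..<r}) ((u \<circ> s r) r)"
    by (rule last_term_comp[OF v fixing_comp[OF u sr]])
  also have "(u \<circ> s r) ` {m..<r} = u ` {m..<r}"
    by (intro image_cong) (auto simp: s_last)
  also have "(u \<circ> s r) r = u (r+1)" by (simp add: s_last)
  finally show ?thesis .
qed

text \<open>These reflections permute the positions m, ..., r - 1 and fix r + 1, and
  \<open>second_half_eq\<close> depends on nothing else. This is the invariance that
  \<open>down_formula\<close> asks for.\<close>

lemma second_half_invariant:
  assumes v: "v \<in> W" and i: "i \<in> {m..<r - 1}"
  shows "second_half (v \<circ> s i) = second_half v"
proof -
  have ir: "i \<in> {1..r}" "i \<in> {1..<r}" "i + 1 < r" "1 \<le> i" using i m by auto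
  have si: "s i \<in> fixing (m - 1)" using i m by (intro s_fixing ir) auto
  have "s i ` {m..<r} \<subseteq> {m..<r}" using s_low[OF ir(2)] i by auto
  then have "s i ` {m..<r} = {m..<r}"
    using W_inj[OF s_W[OF ir(1)]] by (intro endo_inj_surj) (auto simp: inj_on_def)
  then have "second_half (v \<circ> s i) = last_term F v {m..<r} (r+1)"
    using second_half_eq[OF v si] s_last_above(1)[OF ir(3,4)] by simp
  also have "\<dots> = second_half (v \<circ> id)"
    using second_half_eq[OF v id_fixing] by simp
  finally show ?thesis by simp
qed

lemma card_center:
  "card {j\<in>{m..2*r+1-m}. R j} = card {j\<in>{m..r}. R j} + card {a\<in>{m..r}. R (2*r+1-a)}"
proof -
  have "{j\<in>{m..2*r+1-m}. R j} = {j\<in>{m..r}. R j} \<union> (\<lambda>a. 2*r+1-a) ` {a\<in>{m..r}. R (2*r+1-a)}"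
  proof (intro Set.set_eqI iffI)
    fix j assume j: "j \<in> {j\<in>{m..2*r+1-m}. R j}"
    show "j \<in> {j\<in>{m..r}. R j} \<union> (\<lambda>a. 2*r+1-a) ` {a\<in>{m..r}. R (2*r+1-a)}"
    proof (cases "j \<le> r")
      case False
      then have "2*r+1-j \<in> {a\<in>{m..r}. R (2*r+1-a)}" using j by auto
      moreover have "j = 2*r+1-(2*r+1-j)" using j by auto
      ultimately show ?thesis by blast
    qed (use j in auto)
  qed (use m in auto)
  moreover have "card ((\<lambda>a. 2*r+1-a) ` {a\<in>{m..r}. R (2*r+1-a)}) = card {a\<in>{m..r}. R (2*r+1-a)}"
    by (intro card_image) (auto simp: inj_on_def)
  moreover have "card ({j\<in>{m..r}. R j} \<union> (\<lambda>a. 2*r+1-a) ` {a\<in>{m..r}. R (2*r+1-a)}) =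
      card {j\<in>{m..r}. R j} + card ((\<lambda>a. 2*r+1-a) ` {a\<in>{m..r}. R (2*r+1-a)})"
    by (rule card_Un_disjoint) auto
  ultimately show ?thesis by simp
qed

lemma sum_center:
  fixes G :: "nat \<Rightarrow> int poly"
  shows "(\<Sum>i\<in>{m..2*r+1-m}. G i) = (\<Sum>i\<in>{m..r}. G i) + (\<Sum>a\<in>{m..r}. G (2*r+1-a))"
proof -
  have "{m..2*r+1-m} = {m..r} \<union> {r+1..2*r+1-m}" using m by auto
  then have "(\<Sum>i\<in>{m..2*r+1-m}. G i) = (\<Sum>i\<in>{m..r}. G i) + (\<Sum>i\<in>{r+1..2*r+1-m}. G i)"
    by (simp add: sum.union_disjoint)
  moreover have "(\<Sum>i\<in>{r+1..2*r+1-m}. G i) = (\<Sum>a\<in>{m..r}. G (2*r+1-a))"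
    by (rule sum.reindex_bij_witness[of _ "\<lambda>a. 2*r+1-a" "\<lambda>a. 2*r+1-a"]) auto
  ultimately show ?thesis by simp
qed

text \<open>The words carry m to the positions m, ..., r and to their mirror images. Words inside
  the left half are summed by \<open>up_F\<close>. For words crossing the middle,
  \<open>down_formula\<close> sums the left factors and \<open>last_term\<close> evaluates the rest;
  its terms with a factor q - 1 are regrouped by the position i they involve and summed by
  \<open>rank_sum\<close>. A position is not compared with its mirror image because s_r has
  parameter 1.\<close>

lemma center_formula:
  assumes v: "v \<in> W"
  shows "(\<Sum>k\<in>{m..r}. foldr tau (rev [m..<k]) \<phi> v) +
      (\<Sum>a\<in>{m..r}. foldr tau ([a..<r] @ [r] @ rev [m..<r]) \<phi> v) =
    (\<Sum>i\<in>{m..2*r+1-m}. qv ^ card {j\<in>{m..2*r+1-m}. j \<noteq> 2*r+1-i \<and> v j < v i} * F v i)"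
proof -
  let ?P = "{m..r}" and ?M = "2*r+1"
  define c where "c i = card {j\<in>?P. v j < v i}" for i
  define d where "d a = card {j\<in>?P. v a < v j}" for a
  define c' where "c' a i = card {j\<in>?P - {a}. v j < v i}" for a i
  \<comment> \<open>The indices a whose crossing word leaves a term with the factor q - 1 at the
    position i.\<close>
  define S where "S i = {a\<in>?P. i \<noteq> a \<and> v (?M - a) < v i}" for i
  have bar: "v (?M - a) = ?M - v a" "v a \<in> {1..2*r}" if "a \<in> ?P" for a
    using W_mirror[OF v, of a] W_in[OF v, of a] that m by auto
  have "(\<Sum>a\<in>?P. foldr tau ([a..<r] @ [r] @ rev [m..<r]) \<phi> v) =
      (\<Sum>a\<in>?P. foldr tau [a..<r] second_half v)"
    by (simp add: second_half_def)
  also have "\<dots> = (\<Sum>a\<in>?P. qv ^ d a * second_half (v \<circ> word_perm r [a..<r]))"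
    unfolding d_def using m second_half_invariant v by (intro down_formula) auto
  also have "\<dots> = (\<Sum>a\<in>?P. qv ^ d a * last_term F v (?P - {a}) (?M - a))"
  proof (intro sum.cong refl)
    fix a assume a: "a \<in> ?P"
    let ?g = "word_perm r [a..<r]"
    have g: "?g \<in> fixing (m - 1)" "?g ` ?P = ?P"
      using word_perm_fixing[of "[a..<r]" m] a m by auto
    have gr: "?g r = a" using word_perm_upt[of a r] a m by auto
    \<comment> \<open>The position r + 1 is the mirror image of r, so it is carried to the mirror
      image of a.\<close>
    have "?g (?M - r) = ?M - ?g r"
      using r2 by (intro W_mirror[OF fixing_W[OF g(1)]]) auto
    then have gr1: "?g (r+1) = ?M - a" using gr by (simp add: Suc_diff_le)
    have "?P = insert r {m..<r}" using m by auto
    then have "?P = insert a (?g ` {m..<r})" using g(2) gr by (metis image_insert)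
    moreover have "a \<notin> ?g ` {m..<r}"
    proof
      assume "a \<in> ?g ` {m..<r}"
      then obtain x where "x < r" "?g x = ?g r" using gr by auto
      then show False using W_inj[OF fixing_W[OF g(1)]] by simp
    qed
    ultimately have "?g ` {m..<r} = ?P - {a}" by auto
    then show "qv ^ d a * second_half (v \<circ> ?g) = qv ^ d a * last_term F v (?P - {a}) (?M - a)"
      using second_half_eq[OF v g(1)] gr1 by simp
  qed
  also have "\<dots> = (\<Sum>a\<in>?P. qv ^ (d a + c' a (?M - a)) * F v (?M - a)) +
      (\<Sum>a\<in>?P. \<Sum>i | i \<in> ?P \<and> (i \<noteq> a \<and> v (?M - a) < v i). (qv - 1) * qv ^ (d a + c' a i) * F v i)"
    unfolding sum.distrib[symmetric]
    by (intro sum.cong refl)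
      (simp add: last_term_def c'_def sum_distrib_left power_add algebra_simps)
  \<comment> \<open>Summing over a first, with i fixed, turns the terms with a factor q - 1 into a
    geometric sum.\<close>
  also have "(\<Sum>a\<in>?P. \<Sum>i | i \<in> ?P \<and> (i \<noteq> a \<and> v (?M - a) < v i). (qv - 1) * qv ^ (d a + c' a i) * F v i)
      = (\<Sum>i\<in>?P. \<Sum>a\<in>S i. (qv - 1) * qv ^ (d a + c' a i) * F v i)"
    unfolding S_def by (rule sum.swap_restrict) auto
  also have "\<dots> = (\<Sum>i\<in>?P. (qv ^ (c i + card (S i)) - qv ^ c i) * F v i)"
  proof (intro sum.cong refl)
    fix i assume i: "i \<in> ?P"
    have e: "d a + c' a i = c i + card {j\<in>S i. v a < v j}" if a: "a \<in> S i" for a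
    proof -
      have aP: "a \<in> ?P" "i \<noteq> a" using a by (auto simp: S_def)
      have "?P = insert a (?P - {a})" using aP by auto
      then have "c i = c' a i + (if v a < v i then 1 else 0)"
        unfolding c_def c'_def using card_Collect_insert[of "?P - {a}" a "\<lambda>j. v j < v i"] by simp
      moreover have "?P = insert i (?P - {i})" using i by auto
      then have "d a = card {j\<in>?P - {i}. v a < v j} + (if v a < v i then 1 else 0)"
        unfolding d_def using card_Collect_insert[of "?P - {i}" i "\<lambda>j. v a < v j"] by simp
      \<comment> \<open>If v a < v j, the value at the mirror image of j lies below the value at the
        mirror image of a, hence below v i.\<close>
      moreover have "{j\<in>?P - {i}. v a < v j} = {j\<in>S i. v a < v j}"
      proof -
        have "v (?M - j) < v i" if "j \<in> ?P" "v a < v j" for j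
          using bar[OF that(1)] bar[OF aP(1)] a that(2) by (auto simp: S_def)
        then show ?thesis by (auto simp: S_def)
      qed
      ultimately show ?thesis by simp
    qed
    have "(\<Sum>a\<in>S i. (qv - 1) * qv ^ (d a + c' a i) * F v i) =
        qv ^ c i * ((qv - 1) * (\<Sum>a\<in>S i. qv ^ card {j\<in>S i. v a < v j})) * F v i"
      using e by (simp add: sum_distrib_left sum_distrib_right power_add algebra_simps)
    also have "(qv - 1) * (\<Sum>a\<in>S i. qv ^ card {j\<in>S i. v a < v j}) = qv ^ card (S i) - 1"
    proof -
      have "inj_on (\<lambda>x. - int (v x)) (S i)" using W_inj[OF v] by (auto simp: inj_on_def)
      moreover have "finite (S i)" by (simp add: S_def)
      ultimately show ?thesis using rank_sum[of "S i" "\<lambda>x. - int (v x)" qv] by simp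
    qed
    finally show "(\<Sum>a\<in>S i. (qv - 1) * qv ^ (d a + c' a i) * F v i) =
        (qv ^ (c i + card (S i)) - qv ^ c i) * F v i"
      by (simp add: power_add algebra_simps)
  qed
  finally have "(\<Sum>a\<in>?P. foldr tau ([a..<r] @ [r] @ rev [m..<r]) \<phi> v) =
      (\<Sum>a\<in>?P. qv ^ (d a + c' a (?M - a)) * F v (?M - a)) +
      (\<Sum>i\<in>?P. (qv ^ (c i + card (S i)) - qv ^ c i) * F v i)" .
  moreover have "(\<Sum>k\<in>?P. foldr tau (rev [m..<k]) \<phi> v) = (\<Sum>i\<in>?P. qv ^ c i * F v i)"
    unfolding c_def using m v by (intro up_F) auto
  \<comment> \<open>The subtracted powers of q cancel the contribution of the words inside the left
    half.\<close>
  ultimately have lhs: "(\<Sum>k\<in>?P. foldr tau (rev [m..<k]) \<phi> v) +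
      (\<Sum>a\<in>?P. foldr tau ([a..<r] @ [r] @ rev [m..<r]) \<phi> v) =
      (\<Sum>i\<in>?P. qv ^ (c i + card (S i)) * F v i) +
      (\<Sum>a\<in>?P. qv ^ (d a + c' a (?M - a)) * F v (?M - a))"
    by (simp add: left_diff_distrib sum_subtractf)
  have low: "card {j\<in>{m..?M-m}. j \<noteq> ?M-i \<and> v j < v i} = c i + card (S i)" if i: "i \<in> ?P" for i
  proof -
    have "{j\<in>?P. j \<noteq> ?M-i \<and> v j < v i} = {j\<in>?P. v j < v i}" using i by auto
    moreover have "{a\<in>?P. ?M-a \<noteq> ?M-i \<and> v (?M-a) < v i} = S i" using i by (auto simp: S_def)
    ultimately show ?thesis unfolding card_center c_def by simp
  qed
  have high: "card {j\<in>{m..?M-m}. j \<noteq> ?M-(?M-a) \<and> v j < v (?M-a)} = d a + c' a (?M-a)"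
    if a: "a \<in> ?P" for a
  proof -
    have "?M-(?M-a) = a" using a by auto
    then have "{j\<in>?P. j \<noteq> ?M-(?M-a) \<and> v j < v (?M-a)} = {j\<in>?P - {a}. v j < v (?M-a)}" by auto
    moreover have "{b\<in>?P. ?M-b \<noteq> ?M-(?M-a) \<and> v (?M-b) < v (?M-a)} = {j\<in>?P. v a < v j}"
      using bar a by force
    ultimately show ?thesis unfolding card_center d_def c'_def by simp
  qed
  show ?thesis unfolding lhs sum_center using low high by simp
qed

end

end

section \<open>Arithmetic of q-numbers\<close>

text \<open>The integer polynomials have no zero divisors, so the quotient in \<open>qnum\<close> is
  determined by multiplying back.\<close>

lemma qnum_eq: "(qv - 1) * x = qv ^ k - 1 \<Longrightarrow> x = qnum k"
proof -
  assume x: "(qv - 1) * x = qv ^ k - 1"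
  have "qv - 1 \<noteq> 0" by (simp add: qv_def one_pCons)
  then have "x = (qv - 1) * x div (qv - 1)" by simp
  then show ?thesis by (simp add: x qnum_def)
qed

lemma qnum_mult: "(qv - 1) * qnum k = qv ^ k - 1"
proof -
  have "(qv - 1) * (\<Sum>i<k. qv ^ i) = qv ^ k - 1"
    by (induction k) (simp_all add: algebra_simps)
  with qnum_eq[OF this] show ?thesis by simp
qed

lemma qnum_1: "qnum 1 = 1"
  using qnum_eq[of 1 1] by simp

lemma qnum_add: "qnum (a + b) = qnum a + qv ^ a * qnum b"
proof (rule qnum_eq[symmetric])
  have "(qv - 1) * (qnum a + qv ^ a * qnum b) = (qv - 1) * qnum a + qv ^ a * ((qv - 1) * qnum b)"
    by (simp only: distrib_left mult.left_commute)
  also have "\<dots> = qv ^ (a + b) - 1"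
    unfolding qnum_mult by (simp add: power_add algebra_simps)
  finally show "(qv - 1) * (qnum a + qv ^ a * qnum b) = qv ^ (a + b) - 1" .
qed

lemma rank_qnum:
  fixes f :: "'a \<Rightarrow> 'b::linorder"
  assumes "finite S" "inj_on f S"
  shows "(\<Sum>i\<in>S. qv ^ card {j\<in>S. f j < f i}) = qnum (card S)"
  by (rule qnum_eq[OF rank_sum[OF assms]])

text \<open>When the element of rank \<open>i\<close> and its mirror image do not see each other, the ranks
  \<open>0, \<dots>, 2H - 1\<close> become \<open>0, \<dots>, H - 1, H - 1, \<dots>, 2H - 2\<close>.\<close>

lemma qnum_double: "qnum (Suc k) + qv ^ k * qnum (Suc k) = qnum (2 * k + 1) + qv ^ k"
proof -
  have "qnum (2 * k + 1) = qnum (Suc k) + qv ^ Suc k * qnum k"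
    using qnum_add[of "Suc k" k] by (simp add: mult_2)
  moreover have "qnum (Suc k) = 1 + qv * qnum k"
    using qnum_add[of 1 k] qnum_1 by simp
  ultimately show ?thesis by (simp add: algebra_simps)
qed

section \<open>Colour-count matrices and their shifts\<close>

context type_B begin

text \<open>For v the inverse of d these numbers are the block intersections in
  \<open>triple_mat\<close>, see \<open>triple_mat_cnt\<close>.\<close>

definition cnt :: "(nat \<Rightarrow> nat) \<Rightarrow> (nat \<Rightarrow> nat) \<Rightarrow> (nat \<Rightarrow> nat) \<Rightarrow> mat" where
  "cnt c c' v i j = card {k\<in>{1..2*r}. c k = i \<and> c' (v k) = j}"

text \<open>The coefficient function of a double coset sum, see
  \<open>tsum_count_class\<close>.\<close>

definition phi :: "(nat \<Rightarrow> nat) \<Rightarrow> (nat \<Rightarrow> nat) \<Rightarrow> mat \<Rightarrow> (nat \<Rightarrow> nat) \<Rightarrow> int poly" where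
  "phi c c' A v = (if cnt c c' v = A then 1 else 0)"

lemma cnt_stab:
  assumes "u \<in> stab c" "v \<in> W"
  shows "cnt c c' (v \<circ> u) = cnt c c' v"
proof (intro ext)
  fix i j
  have stab: "w x \<in> {1..2*r} \<and> c (w x) = c x" if "w \<in> stab c" "x \<in> {1..2*r}" for w x
    using that W_in[OF stab_W[OF that(1)], of x] by (simp add: stab_def)
  note u = stab[OF assms(1)] and pu = stab[OF stab_inv[OF assms(1)]]
  note [simp] = W_inv_f[OF stab_W[OF assms(1)]]
  have "bij_betw u {k\<in>{1..2*r}. c k = i \<and> c' (v (u k)) = j} {k\<in>{1..2*r}. c k = i \<and> c' (v k) = j}"
  proof (rule bij_betw_byWitness[where f' = "pinv u"])
    show "u ` {k\<in>{1..2*r}. c k = i \<and> c' (v (u k)) = j} \<subseteq> {k\<in>{1..2*r}. c k = i \<and> c' (v k) = j}"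
      using u by blast
    show "pinv u ` {k\<in>{1..2*r}. c k = i \<and> c' (v k) = j} \<subseteq> {k\<in>{1..2*r}. c k = i \<and> c' (v (u k)) = j}"
      using pu by fastforce
  qed simp_all
  from bij_betw_same_card[OF this] show "cnt c c' (v \<circ> u) i j = cnt c c' v i j"
    by (simp add: cnt_def)
qed

lemma cnt_as_sum: "cnt c c' v i j = (\<Sum>k\<in>{1..2*r}. unit_mat (c k) (c' (v k)) i j)"
proof -
  have "cnt c c' v i j = (\<Sum>k | k \<in> {1..2*r} \<and> (c k = i \<and> c' (v k) = j). 1)"
    unfolding cnt_def by simp
  also have "\<dots> = (\<Sum>k\<in>{1..2*r}. if c k = i \<and> c' (v k) = j then 1 else 0)"
    by (rule sum.inter_filter) simp
  also have "\<dots> = (\<Sum>k\<in>{1..2*r}. unit_mat (c k) (c' (v k)) i j)"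
    by (rule sum.cong) (auto simp: unit_mat_def)
  finally show ?thesis .
qed

lemma sym_colouring_bar:
  "sym_colouring N c \<Longrightarrow> x \<in> {1..2*r} \<Longrightarrow> c (2*r+1-x) = N + 1 - c x"
  unfolding sym_colouring_def by (metis add_diff_cancel_left')

text \<open>Recolouring t also recolours its mirror image and no other position. Both sides are kept
  additive to avoid truncated subtraction.\<close>

lemma cnt_move:
  assumes c: "sym_colouring N c" "sym_colouring N c1" "sym_colouring N c'"
    and t: "t \<in> {1..r}" "c t = h" "c1 t = h'"
    and eq: "\<And>x. x \<in> {1..r} \<Longrightarrow> x \<noteq> t \<Longrightarrow> c1 x = c x" and v: "v \<in> W"
  shows "cnt c c' v a b + E_theta N h' (c' (v t)) a b = cnt c1 c' v a b + E_theta N h (c' (v t)) a b"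
proof -
  let ?M = "2*r+1"
  let ?R = "({1..2*r} - {t}) - {?M - t}"
  have t2: "t \<in> {1..2*r}" using t by auto
  have split: "cnt d c' v a b = E_theta N (d t) (c' (v t)) a b +
      (\<Sum>k\<in>?R. unit_mat (d k) (c' (v k)) a b)"
    if d: "sym_colouring N d" for d :: "nat \<Rightarrow> nat"
  proof -
    have "c' (v (?M - t)) = N + 1 - c' (v t)" "d (?M - t) = N + 1 - d t"
      using sym_colouring_bar[OF c(3), of "v t"] sym_colouring_bar[OF d t2]
        W_mirror[OF v t2] W_in[OF v, of t] t2 by auto
    moreover have "?M - t \<in> {1..2*r} - {t}" using t by auto
    ultimately show ?thesis
      unfolding cnt_as_sum E_theta_def using t2
      by (simp only: sum.remove[OF finite_atLeastAtMost t2]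
          sum.remove[OF finite_Diff[OF finite_atLeastAtMost]] add.assoc)
  qed
  have "c k = c1 k" if k: "k \<in> ?R" for k
  proof (cases "k \<le> r")
    case False
    have "?M - k \<in> {1..r}" "?M - k \<noteq> t" using k False by auto
    then have "c1 (?M - k) = c (?M - k)" by (rule eq)
    then show ?thesis
      using c(1,2) k unfolding sym_colouring_def by (metis DiffD1 add_right_cancel)
  qed (use eq k in auto)
  then have "(\<Sum>k\<in>?R. unit_mat (c k) (c' (v k)) a b) =
      (\<Sum>k\<in>?R. unit_mat (c1 k) (c' (v k)) a b)"
    by (intro sum.cong) auto
  with split[OF c(1)] split[OF c(2)] t(2,3) show ?thesis by simp
qed

text \<open>At (i, j) only Q is positive, so B = A forces a positive entry of A there; conversely
  this positivity excludes truncation in A + P - Q.\<close>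

lemma shifted_eq_iff:
  fixes B Y A P Q :: mat
  assumes eq: "\<forall>a b. B a b + P a b = Y a b + Q a b"
    and pq: "P i j = 0" "Q i j > 0" and le: "A i j > 0 \<longrightarrow> (\<forall>a b. Q a b \<le> A a b + P a b)"
  shows "B = A \<longleftrightarrow> A i j > 0 \<and> Y = (\<lambda>a b. A a b + P a b - Q a b)"
proof
  assume "B = A"
  then have *: "\<forall>a b. A a b + P a b = Y a b + Q a b" using eq by (rule subst[where P = "\<lambda>Z. \<forall>a b. Z a b + P a b = Y a b + Q a b"])
  have "A i j > 0" using *[rule_format, of i j] pq by linarith
  moreover have "Y a b = A a b + P a b - Q a b" for a b
    using *[rule_format, of a b] by linarith
  then have "Y = (\<lambda>a b. A a b + P a b - Q a b)" by (intro ext)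
  ultimately show "A i j > 0 \<and> Y = (\<lambda>a b. A a b + P a b - Q a b)" by (rule conjI)
next
  assume *: "A i j > 0 \<and> Y = (\<lambda>a b. A a b + P a b - Q a b)"
  show "B = A"
  proof (intro ext)
    fix a b
    have "Y a b = A a b + P a b - Q a b" by (rule fun_cong[OF fun_cong[OF conjunct2[OF *]]])
    moreover have "\<forall>a b. Q a b \<le> A a b + P a b" by (rule mp[OF le conjunct1[OF *]])
    then have "Q a b \<le> A a b + P a b" by (elim allE)
    ultimately show "B a b = A a b" using eq[rule_format, of a b] by linarith
  qed
qed

end

lemma Xi_mirror: "A \<in> Xi N t \<Longrightarrow> i \<in> {1..N} \<Longrightarrow> j \<in> {1..N} \<Longrightarrow> A (N+1-i) (N+1-j) = A i j"
proof -
  assume A: "A \<in> Xi N t" and ij: "i \<in> {1..N}" "j \<in> {1..N}"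
  have "\<forall>i\<in>{1..N}. \<forall>j\<in>{1..N}. A i j = A (N+1-i) (N+1-j)" using A unfolding Xi_def by blast
  then show ?thesis by (rule sym[OF bspec[OF bspec[OF _ ij(1)] ij(2)]])
qed

text \<open>All rows but the middle one come in mirror pairs with equal sums, so the middle row has
  an even sum; in that row all entries but the central one come in equal pairs.\<close>

lemma Xi_center_even:
  assumes A: "A \<in> Xi (2*n+1) (2*r)"
  shows "even (A (n+1) (n+1))"
proof -
  let ?N = "2*n+1" and ?S = "\<lambda>R. \<Sum>i\<in>R. \<Sum>j\<in>{1..2*n+1}. A i j"
  have sum: "?S {1..?N} = 2*r" using A unfolding Xi_def by blast
  have split: "(\<Sum>i\<in>{1..?N}. f i) = f (n+1) + (\<Sum>i\<in>{1..n}. f i) + (\<Sum>i\<in>{1..n}. f (?N+1-i))"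
    for f :: "nat \<Rightarrow> nat"
  proof -
    have "{1..?N} = insert (n+1) ({1..n} \<union> {n+2..?N})" by auto
    then have "(\<Sum>i\<in>{1..?N}. f i) = f (n+1) + ((\<Sum>i\<in>{1..n}. f i) + (\<Sum>i\<in>{n+2..?N}. f i))"
      by (simp add: sum.union_disjoint)
    moreover have "(\<Sum>i\<in>{n+2..?N}. f i) = (\<Sum>i\<in>{1..n}. f (?N+1-i))"
      by (rule sum.reindex_bij_witness[of _ "\<lambda>a. ?N+1-a" "\<lambda>a. ?N+1-a"]) auto
    ultimately show ?thesis by simp
  qed
  have rows: "(\<Sum>j\<in>{1..?N}. A (?N+1-i) j) = (\<Sum>j\<in>{1..?N}. A i j)" if i: "i \<in> {1..?N}" for i
  proof -
    have "(\<Sum>j\<in>{1..?N}. A (?N+1-i) j) = (\<Sum>j\<in>{1..?N}. A (?N+1-i) (?N+1-j))"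
      by (rule sum.reindex_bij_witness[of _ "\<lambda>a. ?N+1-a" "\<lambda>a. ?N+1-a"]) auto
    also have "\<dots> = (\<Sum>j\<in>{1..?N}. A i j)" using Xi_mirror[OF A i] by (intro sum.cong) auto
    finally show ?thesis .
  qed
  have "?S {1..?N} = (\<Sum>j\<in>{1..?N}. A (n+1) j) + 2 * ?S {1..n}"
    unfolding split[of "\<lambda>i. \<Sum>j\<in>{1..?N}. A i j"] using rows by simp
  then have "even (\<Sum>j\<in>{1..?N}. A (n+1) j)" unfolding sum by (metis dvd_triv_left even_add)
  moreover have "A (n+1) (?N+1-j) = A (n+1) j" if "j \<in> {1..n}" for j
    using Xi_mirror[OF A, of "n+1" j] that by simp
  then have "(\<Sum>j\<in>{1..?N}. A (n+1) j) = A (n+1) (n+1) + 2 * (\<Sum>j\<in>{1..n}. A (n+1) j)"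
    unfolding split[of "\<lambda>j. A (n+1) j"] by simp
  ultimately have "even (A (n+1) (n+1) + 2 * (\<Sum>j\<in>{1..n}. A (n+1) j))" by (simp only:)
  then show ?thesis by simp
qed

lemma E_theta_le:
  assumes "D i j > 0" "D (N+1-i) (N+1-j) > 0"
    and "i = N+1-i \<Longrightarrow> j = N+1-j \<Longrightarrow> D i j \<ge> 2"
  shows "E_theta N i j a b \<le> D a b"
proof -
  define i' j' where "i' = N+1-i" and "j' = N+1-j"
  have "D i j > 0" "D i' j' > 0" "i = i' \<Longrightarrow> j = j' \<Longrightarrow> D i j \<ge> 2"
    using assms by (simp_all only: i'_def j'_def)
  then show ?thesis
    unfolding E_theta_def unit_mat_def i'_def[symmetric] j'_def[symmetric]
    by (cases "a = i \<and> b = j"; cases "a = i' \<and> b = j'") auto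
qed

lemma mat_down_le:
  assumes A: "A \<in> Xi (2*n+1) (2*r)" and h: "h \<in> {1..n}" and p: "p \<in> {1..2*n+1}" and "A h p > 0"
  shows "E_theta (2*n+1) h p a b \<le> A a b + E_theta (2*n+1) (h+1) p a b"
proof -
  have "A (2*n+1+1-h) (2*n+1+1-p) > 0" using Xi_mirror[OF A, of h p] assms by simp
  then have "E_theta (2*n+1) h p a b \<le> A a b"
    using assms(4) h by (intro E_theta_le) auto
  then show ?thesis by simp
qed

text \<open>For h = n and p = n + 1 the shift subtracts 2 at the centre; there
  \<open>Xi_center_even\<close> turns a positive entry into one that is at least 2.\<close>

lemma mat_up_le:
  assumes A: "A \<in> Xi (2*n+1) (2*r)" and h: "h \<in> {1..n}" and p: "p \<in> {1..2*n+1}" and "A (h+1) p > 0"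
  shows "E_theta (2*n+1) (h+1) p a b \<le> A a b + E_theta (2*n+1) h p a b"
proof -
  have "A (2*n+1+1-(h+1)) (2*n+1+1-p) > 0" using Xi_mirror[OF A, of "h+1" p] assms by simp
  moreover have "A (h+1) p \<ge> 2" if "h + 1 = 2*n+1+1-(h+1)" "p = 2*n+1+1-p"
  proof -
    have "h = n" "p = n + 1" using that h p by auto
    then show ?thesis using Xi_center_even[OF A] assms(4) by (auto elim!: evenE)
  qed
  ultimately have "E_theta (2*n+1) (h+1) p a b \<le> A a b"
    using assms(4) by (intro E_theta_le) blast+
  then show ?thesis by simp
qed

context type_B begin

text \<open>Recolouring t turns c into c1, and u does not affect count matrices with respect to c1.
  The two count matrices thus differ by one shift, in the column given by the colour of the value at
  u t.\<close>

lemma phi_move_down: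
  assumes c: "sym_colouring (2*n+1) c" "sym_colouring (2*n+1) c1" "sym_colouring (2*n+1) c'"
    and range: "c' ` {1..2*r} \<subseteq> {1..2*n+1}" and h: "h \<in> {1..n}"
    and t: "t \<in> {1..r}" "c t = h" "c1 t = h+1"
    and eq: "\<And>x. x \<in> {1..r} \<Longrightarrow> x \<noteq> t \<Longrightarrow> c1 x = c x" and v: "v \<in> W" and u: "u \<in> stab c1"
    and A: "A \<in> Xi (2*n+1) (2*r)"
  shows "phi c c' A (v \<circ> u) = (if A h (c' (v (u t))) > 0
    then phi c1 c' (mat_down (2*n+1) A h (c' (v (u t)))) v else 0)"
proof -
  let ?N = "2*n+1" and ?p = "c' (v (u t))"
  have vu: "v \<circ> u \<in> W" using v stab_W[OF u] by (rule comp_W)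
  have "v (u t) \<in> {1..2*r}" using W_in[OF vu, of t] t by auto
  then have p: "?p \<in> {1..?N}" by (rule subsetD[OF range imageI])
  have "\<forall>a b. cnt c c' (v \<circ> u) a b + E_theta ?N (h+1) ?p a b = cnt c1 c' v a b + E_theta ?N h ?p a b"
    using cnt_move[OF c t eq vu] unfolding cnt_stab[OF u v] by simp
  then have "cnt c c' (v \<circ> u) = A \<longleftrightarrow> A h ?p > 0 \<and>
      cnt c1 c' v = (\<lambda>a b. A a b + E_theta ?N (h+1) ?p a b - E_theta ?N h ?p a b)"
  proof (rule shifted_eq_iff)
    show "E_theta ?N (h+1) ?p h ?p = 0" "E_theta ?N h ?p h ?p > 0"
      using h by (auto simp: E_theta_def unit_mat_def)
    show "0 < A h ?p \<longrightarrow> (\<forall>a b. E_theta ?N h ?p a b \<le> A a b + E_theta ?N (h+1) ?p a b)"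
      using mat_down_le[OF A h p] by blast
  qed
  then show ?thesis by (simp add: phi_def mat_down_def)
qed

lemma phi_move_up:
  assumes c: "sym_colouring (2*n+1) c" "sym_colouring (2*n+1) c1" "sym_colouring (2*n+1) c'"
    and range: "c' ` {1..2*r} \<subseteq> {1..2*n+1}" and h: "h \<in> {1..n}"
    and t: "t \<in> {1..r}" "c t = h+1" "c1 t = h"
    and eq: "\<And>x. x \<in> {1..r} \<Longrightarrow> x \<noteq> t \<Longrightarrow> c1 x = c x" and v: "v \<in> W" and u: "u \<in> stab c1"
    and A: "A \<in> Xi (2*n+1) (2*r)"
  shows "phi c c' A (v \<circ> u) = (if A (h+1) (c' (v (u t))) > 0
    then phi c1 c' (mat_up (2*n+1) A h (c' (v (u t)))) v else 0)"
proof -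
  let ?N = "2*n+1" and ?p = "c' (v (u t))"
  have vu: "v \<circ> u \<in> W" using v stab_W[OF u] by (rule comp_W)
  have "v (u t) \<in> {1..2*r}" using W_in[OF vu, of t] t by auto
  then have p: "?p \<in> {1..?N}" by (rule subsetD[OF range imageI])
  have "\<forall>a b. cnt c c' (v \<circ> u) a b + E_theta ?N h ?p a b = cnt c1 c' v a b + E_theta ?N (h+1) ?p a b"
    using cnt_move[OF c t eq vu] unfolding cnt_stab[OF u v] by simp
  then have "cnt c c' (v \<circ> u) = A \<longleftrightarrow> A (h+1) ?p > 0 \<and>
      cnt c1 c' v = (\<lambda>a b. A a b + E_theta ?N h ?p a b - E_theta ?N (h+1) ?p a b)"
  proof (rule shifted_eq_iff)
    show "E_theta ?N h ?p (h+1) ?p = 0" "E_theta ?N (h+1) ?p (h+1) ?p > 0"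
      using h by (auto simp: E_theta_def unit_mat_def)
    show "0 < A (h+1) ?p \<longrightarrow> (\<forall>a b. E_theta ?N (h+1) ?p a b \<le> A a b + E_theta ?N h ?p a b)"
      using mat_up_le[OF A h p] by blast
  qed
  then show ?thesis by (simp add: phi_def mat_up_def)
qed

section \<open>Rank sums over the positions of one colour\<close>

lemma card_colour_less:
  fixes v c' :: "nat \<Rightarrow> nat"
  assumes "finite B" "v ` B \<subseteq> {1..2*r}" "c' ` {1..2*r} \<subseteq> {1..N}"
  shows "card {j\<in>B. c' (v j) < p} = (\<Sum>k\<in>{1..<p}. card {j\<in>B. c' (v j) = k})"
    and "card {j\<in>B. p < c' (v j)} = (\<Sum>k\<in>{p<..N}. card {j\<in>B. c' (v j) = k})"
proof -
  have c: "1 \<le> c' (v j) \<and> c' (v j) \<le> N" if "j \<in> B" for j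
  proof -
    have "v j \<in> {1..2*r}" by (rule subsetD[OF assms(2) imageI[OF that]])
    then have "c' (v j) \<in> {1..N}" by (rule subsetD[OF assms(3) imageI])
    then show ?thesis by simp
  qed
  have "{j\<in>B. c' (v j) < p} = (\<Union>k\<in>{1..<p}. {j\<in>B. c' (v j) = k})" using c by auto
  moreover have "card (\<Union>k\<in>{1..<p}. {j\<in>B. c' (v j) = k}) = (\<Sum>k\<in>{1..<p}. card {j\<in>B. c' (v j) = k})"
    by (rule card_UN_disjoint) (use assms(1) in auto)
  ultimately show "card {j\<in>B. c' (v j) < p} = (\<Sum>k\<in>{1..<p}. card {j\<in>B. c' (v j) = k})"
    by (simp only:)
  have "{j\<in>B. p < c' (v j)} = (\<Union>k\<in>{p<..N}. {j\<in>B. c' (v j) = k})" using c by auto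
  moreover have "card (\<Union>k\<in>{p<..N}. {j\<in>B. c' (v j) = k}) = (\<Sum>k\<in>{p<..N}. card {j\<in>B. c' (v j) = k})"
    by (rule card_UN_disjoint) (use assms(1) in auto)
  ultimately show "card {j\<in>B. p < c' (v j)} = (\<Sum>k\<in>{p<..N}. card {j\<in>B. c' (v j) = k})"
    by (simp only:)
qed

text \<open>Since c' is monotone, elements of smaller colour have smaller values, and only elements
  of the colour of i need a direct comparison. The predicate Q serves to leave out a mirror
  image.\<close>

lemma card_split_colour:
  fixes v c' :: "nat \<Rightarrow> nat"
  assumes c': "mono_on {1..2*r} c'" and B: "finite B" "v ` B \<subseteq> {1..2*r}" and i: "i \<in> B"
  shows "card {j\<in>B. Q j \<and> v j < v i} =
      card {j\<in>B. Q j \<and> c' (v j) < c' (v i)} + card {j\<in>{j\<in>B. c' (v j) = c' (v i)}. Q j \<and> v j < v i}"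
    and "card {j\<in>B. Q j \<and> v i < v j} =
      card {j\<in>B. Q j \<and> c' (v i) < c' (v j)} + card {j\<in>{j\<in>B. c' (v j) = c' (v i)}. Q j \<and> v i < v j}"
proof -
  have le: "c' (v j) \<le> c' (v k)" if "j \<in> B" "k \<in> B" "v j \<le> v k" for j k
  proof (rule mono_onD[OF c' _ _ that(3)])
    show "v j \<in> {1..2*r}" "v k \<in> {1..2*r}"
      by (rule subsetD[OF B(2) imageI[OF that(1)]], rule subsetD[OF B(2) imageI[OF that(2)]])
  qed
  have lt: "v j < v k" if "j \<in> B" "k \<in> B" "c' (v j) < c' (v k)" for j k
    using le[OF that(2,1)] that(3) by linarith
  have iff1: "v j < v i \<longleftrightarrow> c' (v j) < c' (v i) \<or> (c' (v j) = c' (v i) \<and> v j < v i)" if "j \<in> B" for j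
  proof (cases "v j < v i")
    case True
    then have "c' (v j) \<le> c' (v i)" by (intro le that i) simp
    with True show ?thesis by (simp add: le_less)
  next
    case False
    then show ?thesis using lt[OF that i] by blast
  qed
  have iff2: "v i < v j \<longleftrightarrow> c' (v i) < c' (v j) \<or> (c' (v j) = c' (v i) \<and> v i < v j)" if "j \<in> B" for j
  proof (cases "v i < v j")
    case True
    then have "c' (v i) \<le> c' (v j)" by (intro le that i) simp
    with True show ?thesis by (auto simp: le_less)
  next
    case False
    then show ?thesis using lt[OF i that] by blast
  qed
  let ?E = "{j\<in>B. c' (v j) = c' (v i)}"
  have "{j\<in>B. Q j \<and> v j < v i} = {j\<in>B. Q j \<and> c' (v j) < c' (v i)} \<union> {j\<in>?E. Q j \<and> v j < v i}" (is "?L1 = ?R1")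
  proof (rule Set.set_eqI)
    fix j
    show "j \<in> ?L1 \<longleftrightarrow> j \<in> ?R1"
      unfolding Un_iff mem_Collect_eq using iff1[of j] by argo
  qed
  moreover have "card ({j\<in>B. Q j \<and> c' (v j) < c' (v i)} \<union> {j\<in>?E. Q j \<and> v j < v i}) =
      card {j\<in>B. Q j \<and> c' (v j) < c' (v i)} + card {j\<in>?E. Q j \<and> v j < v i}"
    by (rule card_Un_disjoint)
      (use B(1) in simp, use B(1) in simp, unfold disjoint_iff mem_Collect_eq, metis less_irrefl)
  ultimately show "card {j\<in>B. Q j \<and> v j < v i} =
      card {j\<in>B. Q j \<and> c' (v j) < c' (v i)} + card {j\<in>?E. Q j \<and> v j < v i}"
    by (simp only:)
  have "{j\<in>B. Q j \<and> v i < v j} = {j\<in>B. Q j \<and> c' (v i) < c' (v j)} \<union> {j\<in>?E. Q j \<and> v i < v j}" (is "?L2 = ?R2")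
  proof (rule Set.set_eqI)
    fix j
    show "j \<in> ?L2 \<longleftrightarrow> j \<in> ?R2"
      unfolding Un_iff mem_Collect_eq using iff2[of j] by argo
  qed
  moreover have "card ({j\<in>B. Q j \<and> c' (v i) < c' (v j)} \<union> {j\<in>?E. Q j \<and> v i < v j}) =
      card {j\<in>B. Q j \<and> c' (v i) < c' (v j)} + card {j\<in>?E. Q j \<and> v i < v j}"
    by (rule card_Un_disjoint)
      (use B(1) in simp, use B(1) in simp, unfold disjoint_iff mem_Collect_eq, metis less_irrefl)
  ultimately show "card {j\<in>B. Q j \<and> v i < v j} =
      card {j\<in>B. Q j \<and> c' (v i) < c' (v j)} + card {j\<in>?E. Q j \<and> v i < v j}"
    by (simp only:)
qed

text \<open>Elements of colour below p give a common power of q, and the ranks inside colour p give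
  the q-number.\<close>

lemma colour_sum_up:
  fixes v c' :: "nat \<Rightarrow> nat"
  assumes c': "mono_on {1..2*r} c'" "c' ` {1..2*r} \<subseteq> {1..N}" and v: "v \<in> W" and B: "B \<subseteq> {1..2*r}"
  shows "(\<Sum>i | i \<in> B \<and> c' (v i) = p. qv ^ card {j\<in>B. v j < v i}) =
    qv ^ (\<Sum>k\<in>{1..<p}. card {j\<in>B. c' (v j) = k}) * qnum (card {j\<in>B. c' (v j) = p})"
proof -
  have fin: "finite B" using B by (rule finite_subset) simp
  have vB: "v ` B \<subseteq> {1..2*r}" using B W_in[OF v] by auto
  let ?Bp = "{j\<in>B. c' (v j) = p}"
  have "card {j\<in>B. v j < v i} = card {j\<in>B. c' (v j) < p} + card {j\<in>?Bp. v j < v i}" if "i \<in> ?Bp" for i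
    using card_split_colour(1)[OF c'(1) fin vB, of i "\<lambda>_. True"] that by simp
  then have "(\<Sum>i\<in>?Bp. qv ^ card {j\<in>B. v j < v i}) =
      qv ^ card {j\<in>B. c' (v j) < p} * (\<Sum>i\<in>?Bp. qv ^ card {j\<in>?Bp. v j < v i})"
    by (simp add: power_add sum_distrib_left)
  also have "(\<Sum>i\<in>?Bp. qv ^ card {j\<in>?Bp. v j < v i}) = qnum (card ?Bp)"
    using W_inj[OF v] fin by (intro rank_qnum) (auto simp: inj_on_def)
  finally show ?thesis unfolding card_colour_less(1)[OF fin vB c'(2)] .
qed

lemma colour_sum_down:
  fixes v c' :: "nat \<Rightarrow> nat"
  assumes c': "mono_on {1..2*r} c'" "c' ` {1..2*r} \<subseteq> {1..N}" and v: "v \<in> W" and B: "B \<subseteq> {1..2*r}"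
  shows "(\<Sum>i | i \<in> B \<and> c' (v i) = p. qv ^ card {j\<in>B. v i < v j}) =
    qv ^ (\<Sum>k\<in>{p<..N}. card {j\<in>B. c' (v j) = k}) * qnum (card {j\<in>B. c' (v j) = p})"
proof -
  have fin: "finite B" using B by (rule finite_subset) simp
  have vB: "v ` B \<subseteq> {1..2*r}" using B W_in[OF v] by auto
  let ?Bp = "{j\<in>B. c' (v j) = p}"
  have "card {j\<in>B. v i < v j} = card {j\<in>B. p < c' (v j)} + card {j\<in>?Bp. - int (v j) < - int (v i)}"
    if "i \<in> ?Bp" for i
    using card_split_colour(2)[OF c'(1) fin vB, of i "\<lambda>_. True"] that by simp
  then have "(\<Sum>i\<in>?Bp. qv ^ card {j\<in>B. v i < v j}) =
      qv ^ card {j\<in>B. p < c' (v j)} * (\<Sum>i\<in>?Bp. qv ^ card {j\<in>?Bp. - int (v j) < - int (v i)})"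
    by (simp add: power_add sum_distrib_left)
  also have "(\<Sum>i\<in>?Bp. qv ^ card {j\<in>?Bp. - int (v j) < - int (v i)}) = qnum (card ?Bp)"
    using W_inj[OF v] fin by (intro rank_qnum) (auto simp: inj_on_def)
  finally show ?thesis unfolding card_colour_less(2)[OF fin vB c'(2)] .
qed

lemma card_remove_one:
  assumes "finite B" "x \<in> B"
  shows "card {j\<in>B. P j} = card {j\<in>B. j \<noteq> x \<and> P j} + (if P x then 1 else 0)"
proof -
  have "insert x (B - {x}) = B" using assms(2) by blast
  moreover have "{j\<in>B - {x}. P j} = {j\<in>B. j \<noteq> x \<and> P j}" by blast
  ultimately show ?thesis
    using card_Collect_insert[of "B - {x}" x P] assms(1) by simp
qed

text \<open>The numbers a count the colours in B without one element of colour p and one of the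
  mirror colour; omitting the mirror image of i accounts for the latter. For p other than n + 1 the
  mirror image has another colour and the ranks inside colour p are undisturbed. For p = n + 1 it
  has the same colour, and the lower and upper half have ranks 0, ..., k and k, ..., 2k, summed by
  \<open>qnum_double\<close>.\<close>

lemma colour_sum_center:
  fixes v c' :: "nat \<Rightarrow> nat" and a :: "nat \<Rightarrow> nat"
  assumes c': "sym_colouring (2*n+1) c'" "c' ` {1..2*r} \<subseteq> {1..2*n+1}" and v: "v \<in> W"
    and B: "B \<subseteq> {1..2*r}" "\<And>x. x \<in> B \<Longrightarrow> 2*r+1-x \<in> B" and p: "p \<in> {1..2*n+1}"
    and a: "\<And>k. k \<in> {1..2*n+1} \<Longrightarrow> card {i\<in>B. c' (v i) = k} =
      a k + (if k = p then 1 else 0) + (if k = 2*n+2-p then 1 else 0)"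
  shows "(\<Sum>i | i \<in> B \<and> c' (v i) = p. qv ^ card {j\<in>B. j \<noteq> 2*r+1-i \<and> v j < v i}) =
    (if p = n + 1 then qv ^ (\<Sum>k\<in>{1..<p}. a k) * (qnum (a p + 1) + qv ^ (a p div 2))
     else qv ^ (\<Sum>k\<in>{1..<p}. a k) * qnum (a p + 1))"
proof -
  have fin: "finite B" using B(1) by (rule finite_subset) simp
  have mono: "mono_on {1..2*r} c'" using c'(1) by (simp add: sym_colouring_def)
  have vB: "v ` B \<subseteq> {1..2*r}" using B W_in[OF v] by auto
  let ?Bp = "{i\<in>B. c' (v i) = p}"
  have finp: "finite ?Bp" using fin by simp
  have vbar: "v (2*r+1-i) = 2*r+1 - v i" "v i \<in> {1..2*r}" if "i \<in> B" for i
    using W_mirror[OF v, of i] subsetD[OF vB imageI[OF that]] subsetD[OF B(1) that] by auto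
  have cbar: "c' (v (2*r+1-i)) = 2*n+2-p" if "i \<in> ?Bp" for i
    using sym_colouring_bar[OF c'(1), of "v i"] vbar[of i] that by simp
  \<comment> \<open>The mirror image of i has colour 2n + 2 - p, so leaving it out cancels the
    correction in a exactly when that colour lies below p.\<close>
  have less: "card {j\<in>B. j \<noteq> 2*r+1-i \<and> c' (v j) < p} = (\<Sum>k\<in>{1..<p}. a k)" if i: "i \<in> ?Bp" for i
  proof -
    have "card {j\<in>B. c' (v j) < p} = (\<Sum>k\<in>{1..<p}. card {j\<in>B. c' (v j) = k})"
      by (rule card_colour_less(1)[OF fin vB c'(2)])
    also have "\<dots> = (\<Sum>k\<in>{1..<p}. a k + (if k = 2*n+2-p then 1 else 0))"
      using p a by (intro sum.cong) auto
    also have "\<dots> = (\<Sum>k\<in>{1..<p}. a k) + (if 2*n+2-p < p then 1 else 0)"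
      using p by (auto simp: sum.distrib)
    finally show ?thesis
      using card_remove_one[OF fin B(2), of i "\<lambda>j. c' (v j) < p"] i unfolding cbar[OF i] by simp
  qed
  have exp: "card {j\<in>B. j \<noteq> 2*r+1-i \<and> v j < v i} =
      (\<Sum>k\<in>{1..<p}. a k) + card {j\<in>?Bp. j \<noteq> 2*r+1-i \<and> v j < v i}" if i: "i \<in> ?Bp" for i
    using card_split_colour(1)[OF mono fin vB, of i "\<lambda>j. j \<noteq> 2*r+1-i"] less[OF i] i by simp
  have "(\<Sum>i\<in>?Bp. qv ^ card {j\<in>B. j \<noteq> 2*r+1-i \<and> v j < v i}) =
      qv ^ (\<Sum>k\<in>{1..<p}. a k) * (\<Sum>i\<in>?Bp. qv ^ card {j\<in>?Bp. j \<noteq> 2*r+1-i \<and> v j < v i})"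
    unfolding sum_distrib_left
  proof (intro sum.cong refl)
    fix i assume "i \<in> ?Bp"
    from exp[OF this] show "qv ^ card {j\<in>B. j \<noteq> 2*r+1-i \<and> v j < v i} =
        qv ^ (\<Sum>k\<in>{1..<p}. a k) * qv ^ card {j\<in>?Bp. j \<noteq> 2*r+1-i \<and> v j < v i}"
      by (simp only: power_add)
  qed
  also have "(\<Sum>i\<in>?Bp. qv ^ card {j\<in>?Bp. j \<noteq> 2*r+1-i \<and> v j < v i}) =
      (if p = n + 1 then qnum (a p + 1) + qv ^ (a p div 2) else qnum (a p + 1))"
  proof (cases "p = n + 1")
    case False
    have "{j\<in>?Bp. j \<noteq> 2*r+1-i \<and> v j < v i} = {j\<in>?Bp. v j < v i}" if i: "i \<in> ?Bp" for i
    proof -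
      have "2*n+2-p \<noteq> p" using False p by auto
      then have "2*r+1-i \<notin> ?Bp" using cbar[OF i] by simp
      then show ?thesis by blast
    qed
    then have "(\<Sum>i\<in>?Bp. qv ^ card {j\<in>?Bp. j \<noteq> 2*r+1-i \<and> v j < v i}) =
        (\<Sum>i\<in>?Bp. qv ^ card {j\<in>?Bp. v j < v i})"
      by (intro sum.cong refl) (simp only:)
    also have "\<dots> = qnum (card ?Bp)"
      by (rule rank_qnum[OF finp]) (simp add: inj_on_def W_inj[OF v])
    also have "card ?Bp = a p + 1" using a[OF p] False p by auto
    finally show ?thesis using False by simp
  next
    case True
    \<comment> \<open>Lower and upper half of the values of middle colour, exchanged by the
      mirror.\<close>
    define S1 where "S1 = {i\<in>?Bp. v i \<le> r}"
    define S2 where "S2 = {i\<in>?Bp. r < v i}"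
    have fin12: "finite S1" "finite S2" unfolding S1_def S2_def using fin by simp_all
    have barp: "2*r+1-i \<in> ?Bp" if "i \<in> ?Bp" for i
      using cbar[OF that] B(2) that True by simp
    have bar12: "2*r+1-i \<in> S2" if "i \<in> S1" for i
    proof -
      have i: "i \<in> ?Bp" "v i \<le> r" using that by (simp_all add: S1_def)
      show ?thesis using barp[OF i(1)] vbar[of i] i unfolding S2_def by simp
    qed
    have bar21: "2*r+1-i \<in> S1" if "i \<in> S2" for i
    proof -
      have i: "i \<in> ?Bp" "r < v i" using that by (simp_all add: S2_def)
      show ?thesis using barp[OF i(1)] vbar[of i] i unfolding S1_def by simp
    qed
    have barbar: "2*r+1-(2*r+1-i) = i" if "i \<in> ?Bp" for i
      using subsetD[OF B(1), of i] that by auto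
    have "bij_betw (\<lambda>i. 2*r+1-i) S1 S2"
    proof (rule bij_betw_byWitness[where f' = "\<lambda>i. 2*r+1-i"])
      show "\<forall>i\<in>S1. 2*r+1-(2*r+1-i) = i" using barbar unfolding S1_def by blast
      show "\<forall>i\<in>S2. 2*r+1-(2*r+1-i) = i" using barbar unfolding S2_def by blast
    qed (use bar12 bar21 in blast)+
    then have card12: "card S2 = card S1" by (simp add: bij_betw_same_card)
    have un: "?Bp = S1 \<union> S2" "S1 \<inter> S2 = {}" unfolding S1_def S2_def by auto
    have "card ?Bp = a p + 2" using a[OF p] True by simp
    then have "2 * card S1 = a p + 2"
      using card_Un_disjoint[OF fin12 un(2)] un(1) card12 by simp
    \<comment> \<open>The two extra elements make S1 nonempty; with |S1| = k + 1 the count a p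
      equals 2k.\<close>
    moreover from this obtain k where "card S1 = Suc k" by (cases "card S1") simp_all
    ultimately have k: "card S1 = Suc k" "a p = 2 * k" by simp_all
    have "(\<Sum>i\<in>?Bp. qv ^ card {j\<in>?Bp. j \<noteq> 2*r+1-i \<and> v j < v i}) =
        (\<Sum>i\<in>S1. qv ^ card {j\<in>?Bp. j \<noteq> 2*r+1-i \<and> v j < v i}) +
        (\<Sum>i\<in>S2. qv ^ card {j\<in>?Bp. j \<noteq> 2*r+1-i \<and> v j < v i})"
      by (subst un(1)) (rule sum.union_disjoint[OF fin12 un(2)])
    also have "(\<Sum>i\<in>S1. qv ^ card {j\<in>?Bp. j \<noteq> 2*r+1-i \<and> v j < v i}) =
        (\<Sum>i\<in>S1. qv ^ card {j\<in>S1. v j < v i})"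
    proof (intro sum.cong refl)
      fix i assume i: "i \<in> S1"
      have "r < v (2*r+1-i)" using bar12[OF i] by (simp add: S2_def)
      moreover have "v i \<le> r" using i by (simp add: S1_def)
      ultimately have "{j\<in>?Bp. j \<noteq> 2*r+1-i \<and> v j < v i} = {j\<in>S1. v j < v i}"
        unfolding S1_def by fastforce
      then show "qv ^ card {j\<in>?Bp. j \<noteq> 2*r+1-i \<and> v j < v i} = qv ^ card {j\<in>S1. v j < v i}"
        by (simp only:)
    qed
    also have "\<dots> = qnum (card S1)"
      by (rule rank_qnum[OF fin12(1)]) (simp add: inj_on_def W_inj[OF v])
    also have "(\<Sum>i\<in>S2. qv ^ card {j\<in>?Bp. j \<noteq> 2*r+1-i \<and> v j < v i}) =
        (\<Sum>i\<in>S2. qv ^ k * qv ^ card {j\<in>S2. v j < v i})"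
    proof (intro sum.cong refl)
      fix i assume i: "i \<in> S2"
      have b: "2*r+1-i \<in> S1" "v (2*r+1-i) \<le> r" "r < v i"
        using bar21[OF i] i by (simp_all add: S1_def S2_def)
      \<comment> \<open>An element of the upper half lies above the whole lower half, from which
        only its own mirror image is left out.\<close>
      have "{j\<in>?Bp. j \<noteq> 2*r+1-i \<and> v j < v i} = (S1 - {2*r+1-i}) \<union> {j\<in>S2. v j < v i}"
        using b unfolding S1_def S2_def by fastforce
      moreover have "card ((S1 - {2*r+1-i}) \<union> {j\<in>S2. v j < v i}) =
          card (S1 - {2*r+1-i}) + card {j\<in>S2. v j < v i}"
        by (rule card_Un_disjoint) (use fin12 un(2) in auto)
      moreover have "card (S1 - {2*r+1-i}) = k" using b(1) k(1) fin12 by simp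
      ultimately show "qv ^ card {j\<in>?Bp. j \<noteq> 2*r+1-i \<and> v j < v i} =
          qv ^ k * qv ^ card {j\<in>S2. v j < v i}"
        by (simp only: power_add)
    qed
    also have "\<dots> = qv ^ k * (\<Sum>i\<in>S2. qv ^ card {j\<in>S2. v j < v i})"
      by (rule sum_distrib_left[symmetric])
    also have "(\<Sum>i\<in>S2. qv ^ card {j\<in>S2. v j < v i}) = qnum (card S2)"
      by (rule rank_qnum[OF fin12(2)]) (simp add: inj_on_def W_inj[OF v])
    also have "qnum (card S1) + qv ^ k * qnum (card S2) = qnum (a p + 1) + qv ^ (a p div 2)"
      using qnum_double[of k] by (simp add: card12 k)
    finally show ?thesis using True by simp
  qed
  finally show ?thesis by simp
qed

lemma regroup:
  fixes c' v :: "nat \<Rightarrow> nat" and R \<Psi> :: "nat \<Rightarrow> int poly"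
  assumes B: "finite B" "\<And>i. i \<in> B \<Longrightarrow> c' (v i) \<in> {1..N}"
  shows "(\<Sum>i\<in>B. R i * (if Q (c' (v i)) then \<Psi> (c' (v i)) else 0)) =
    (\<Sum>p | p \<in> {1..N} \<and> Q p. (\<Sum>i | i \<in> B \<and> c' (v i) = p. R i) * \<Psi> p)"
proof -
  have "(\<Sum>i\<in>B. R i * (if Q (c' (v i)) then \<Psi> (c' (v i)) else 0)) =
      (\<Sum>p\<in>{1..N}. \<Sum>i | i \<in> B \<and> c' (v i) = p. R i * (if Q (c' (v i)) then \<Psi> (c' (v i)) else 0))"
    using B by (intro sum.group[symmetric]) auto
  also have "\<dots> = (\<Sum>p\<in>{1..N}. if Q p then (\<Sum>i | i \<in> B \<and> c' (v i) = p. R i) * \<Psi> p else 0)"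
  proof (intro sum.cong refl)
    fix p
    have "(\<Sum>i | i \<in> B \<and> c' (v i) = p. R i * (if Q (c' (v i)) then \<Psi> (c' (v i)) else 0)) =
        (\<Sum>i | i \<in> B \<and> c' (v i) = p. R i * (if Q p then \<Psi> p else 0))"
      by (intro sum.cong) auto
    then show "(\<Sum>i | i \<in> B \<and> c' (v i) = p. R i * (if Q (c' (v i)) then \<Psi> (c' (v i)) else 0)) =
        (if Q p then (\<Sum>i | i \<in> B \<and> c' (v i) = p. R i) * \<Psi> p else 0)"
      by (simp add: sum_distrib_right)
  qed
  also have "\<dots> = (\<Sum>p | p \<in> {1..N} \<and> Q p. (\<Sum>i | i \<in> B \<and> c' (v i) = p. R i) * \<Psi> p)"
    by (rule sum.inter_filter[symmetric]) simp
  finally show ?thesis .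
qed

section \<open>Moving one position between neighbouring blocks\<close>

lemma word_perm_stab:
  "sym_colouring N c \<Longrightarrow> set xs \<subseteq> adj c \<Longrightarrow> word_perm r xs \<in> stab c"
proof (induction xs)
  case Nil
  show ?case unfolding word_perm_simps by (rule stab_id)
next
  case (Cons x xs)
  then have "s x \<in> stab c" "word_perm r xs \<in> stab c" using s_stab[of N c x] by simp_all
  then show ?case unfolding word_perm_simps by (rule stab_comp)
qed

lemma phi_stab: "u \<in> stab c \<Longrightarrow> v \<in> W \<Longrightarrow> phi c c' A (v \<circ> u) = phi c c' A v"
  unfolding phi_def cnt_stab ..

definition colouring :: "nat \<Rightarrow> (nat \<Rightarrow> nat) \<Rightarrow> bool" where
  "colouring n c \<longleftrightarrow> sym_colouring (2*n+1) c \<and> c ` {1..2*r} \<subseteq> {1..2*n+1}"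

lemma colouringD:
  "colouring n c \<Longrightarrow> sym_colouring (2*n+1) c" "colouring n c \<Longrightarrow> c ` {1..2*r} \<subseteq> {1..2*n+1}"
  "colouring n c \<Longrightarrow> mono_on {1..2*r} c"
  by (simp_all add: colouring_def sym_colouring_def)

lemma cnt_row: "cnt c c' v i j = card {k \<in> {x\<in>{1..2*r}. c x = i}. c' (v k) = j}"
  unfolding cnt_def by (intro arg_cong[where f = card]) blast

end

lemma E_theta_row:
  "i \<noteq> N + 1 - i \<Longrightarrow> E_theta N i p i k = (if k = p then 1 else 0)"
  "i = N + 1 - i \<Longrightarrow> E_theta N i p i k = (if k = p then 1 else 0) + (if k = N + 1 - p then 1 else 0)"
  "a \<noteq> i \<Longrightarrow> a \<noteq> N + 1 - i \<Longrightarrow> E_theta N i p a k = 0"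
  by (simp_all only: E_theta_def unit_mat_def if_False simp_thms refl)

context type_B begin

text \<open>The words carry t, the left end of block h + 1 of c1, to each position of that block.
  \<open>up_formula\<close> and \<open>phi_move_down\<close> express the result by shifted matrices;
  grouped by the colour of the value, the coefficients are evaluated by
  \<open>colour_sum_up\<close>.\<close>

lemma multiply_down:
  assumes c: "colouring n c" "colouring n c1" "colouring n c'" and h: "h \<in> {1..<n}"
    and t: "t \<in> {1..r}" "c t = h" "c1 t = h+1"
    and eq: "\<And>x. x \<in> {1..r} \<Longrightarrow> x \<noteq> t \<Longrightarrow> c1 x = c x"
    and b: "t \<le> b" "b \<le> r" "{x\<in>{1..2*r}. c1 x = h+1} = {t..b}"
    and A: "A \<in> Xi (2*n+1) (2*r)" and v: "v \<in> W"
  shows "(\<Sum>k\<in>{t..b}. foldr tau (rev [t..<k]) (phi c c' A) v) =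
    (\<Sum>p | p \<in> {1..2*n+1} \<and> A h p > 0.
      (qv ^ (\<Sum>j\<in>{1..<p}. A (h+1) j) * qnum (A (h+1) p + 1)) * phi c1 c' (mat_down (2*n+1) A h p) v)"
proof -
  let ?N = "2*n+1"
  have block: "c1 x = h+1" if "x \<in> {t..b}" for x using that b(3) by blast
  have adj1: "i \<in> adj c1" if "i \<in> {t..<b}" for i
    using block[of i] block[of "i+1"] that t(1) b(2) by (auto simp: adj_def)
  have inv: "phi c c' A (v \<circ> s i) = phi c c' A v" if "v \<in> W" "i \<in> {t<..<b}" for v i
  proof (rule phi_stab[OF s_stab[OF colouringD(1)[OF c(1)]] that(1)])
    have "i \<in> {1..r}" "i + 1 \<in> {1..r}" "i \<noteq> t" "i + 1 \<noteq> t" using that(2) b(2) by auto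
    moreover have adj: "i \<in> adj c1" by (rule adj1) (use that(2) in auto)
    ultimately show "i \<in> adj c"
      using eq[of i] eq[of "i+1"] adj by (simp add: adj_def)
  qed
  have move: "phi c c' A (v \<circ> word_perm r (rev [t..<i])) =
      (if A h (c' (v i)) > 0 then phi c1 c' (mat_down ?N A h (c' (v i))) v else 0)" if i: "i \<in> {t..b}" for i
  proof -
    have u: "word_perm r (rev [t..<i]) \<in> stab c1"
      using adj1 i by (intro word_perm_stab[OF colouringD(1)[OF c(2)]]) auto
    have ut: "word_perm r (rev [t..<i]) t = i" using word_perm_rev_upt(1)[of t i] i t b by simp
    have hn: "h \<in> {1..n}" using h by simp
    show ?thesis
      using phi_move_down[OF colouringD(1)[OF c(1)] colouringD(1)[OF c(2)] colouringD(1)[OF c(3)]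
          colouringD(2)[OF c(3)] hn t eq v u A] unfolding ut .
  qed
  have cv: "c' (v i) \<in> {1..?N}" if "i \<in> {t..b}" for i
  proof -
    have "v i \<in> {1..2*r}" using that t b W_in[OF v, of i] by simp
    then show ?thesis by (rule subsetD[OF colouringD(2)[OF c(3)] imageI])
  qed
  have tb: "{t..b} \<subseteq> {1..2*r}" using t b by auto
  have "(\<Sum>k\<in>{t..b}. foldr tau (rev [t..<k]) (phi c c' A) v) =
    (\<Sum>i\<in>{t..b}. qv ^ card {j\<in>{t..b}. v j < v i} * phi c c' A (v \<circ> word_perm r (rev [t..<i])))"
    using t b by (intro up_formula inv v) simp_all
  also have "\<dots> = (\<Sum>i\<in>{t..b}. qv ^ card {j\<in>{t..b}. v j < v i} *
      (if A h (c' (v i)) > 0 then phi c1 c' (mat_down ?N A h (c' (v i))) v else 0))"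
    by (intro sum.cong refl) (simp only: move)
  also have "\<dots> = (\<Sum>p | p \<in> {1..?N} \<and> A h p > 0.
      (\<Sum>i | i \<in> {t..b} \<and> c' (v i) = p. qv ^ card {j\<in>{t..b}. v j < v i}) *
        phi c1 c' (mat_down ?N A h p) v)"
    by (rule regroup[where c' = c' and v = v, OF finite_atLeastAtMost cv])
  also have "\<dots> = (\<Sum>p | p \<in> {1..?N} \<and> A h p > 0.
      (qv ^ (\<Sum>j\<in>{1..<p}. A (h+1) j) * qnum (A (h+1) p + 1)) * phi c1 c' (mat_down ?N A h p) v)"
  proof (intro sum.cong refl)
    fix p assume "p \<in> {p. p \<in> {1..?N} \<and> A h p > 0}"
    then have p: "p \<in> {1..?N}" by simp
    show "(\<Sum>i | i \<in> {t..b} \<and> c' (v i) = p. qv ^ card {j\<in>{t..b}. v j < v i}) *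
        phi c1 c' (mat_down ?N A h p) v =
      (qv ^ (\<Sum>j\<in>{1..<p}. A (h+1) j) * qnum (A (h+1) p + 1)) * phi c1 c' (mat_down ?N A h p) v"
    \<comment> \<open>If v does not have the shifted matrix, both sides vanish; if it does, the
      colour counts in the block are a row of that matrix.\<close>
    proof (cases "cnt c1 c' v = mat_down ?N A h p")
      case True
      have cnt: "card {j\<in>{t..b}. c' (v j) = k} = A (h+1) k + (if k = p then 1 else 0)" for k
      proof -
        have "card {j\<in>{t..b}. c' (v j) = k} = mat_down ?N A h p (h+1) k"
          unfolding True[symmetric] cnt_row b(3) ..
        \<comment> \<open>Because h < n, row h + 1 is not its own mirror image, and only column p of
          it is shifted.\<close>
        moreover have ne: "h + 1 \<noteq> ?N + 1 - (h+1)" "h + 1 \<noteq> h" "h + 1 \<noteq> ?N + 1 - h" using h by auto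
        ultimately show ?thesis
          unfolding mat_down_def E_theta_row(1)[OF ne(1)] E_theta_row(3)[OF ne(2,3)] diff_zero by (simp only:)
      qed
      show ?thesis
        unfolding colour_sum_up[OF colouringD(3,2)[OF c(3)] v tb] cnt by simp
    next
      case False
      then show ?thesis by (simp add: phi_def)
    qed
  qed
  finally show ?thesis .
qed

text \<open>Here t is the right end of block h of c1. Larger values are counted, so the exponent
  collects the entries to the right of p.\<close>

lemma multiply_up:
  assumes c: "colouring n c" "colouring n c1" "colouring n c'" and h: "h \<in> {1..n}"
    and t: "t \<in> {1..r}" "c t = h+1" "c1 t = h"
    and eq: "\<And>x. x \<in> {1..r} \<Longrightarrow> x \<noteq> t \<Longrightarrow> c1 x = c x"
    and b: "1 \<le> l" "l \<le> t" "{x\<in>{1..2*r}. c1 x = h} = {l..t}"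
    and A: "A \<in> Xi (2*n+1) (2*r)" and v: "v \<in> W"
  shows "(\<Sum>k\<in>{l..t}. foldr tau [k..<t] (phi c c' A) v) =
    (\<Sum>p | p \<in> {1..2*n+1} \<and> A (h+1) p > 0.
      (qv ^ (\<Sum>j\<in>{p<..2*n+1}. A h j) * qnum (A h p + 1)) * phi c1 c' (mat_up (2*n+1) A h p) v)"
proof -
  let ?N = "2*n+1"
  have block: "c1 x = h" if "x \<in> {l..t}" for x using that b(3) by blast
  have adj1: "i \<in> adj c1" if "i \<in> {l..<t}" for i
    using block[of i] block[of "i+1"] that t(1) b(1) by (auto simp: adj_def)
  have inv: "phi c c' A (v \<circ> s i) = phi c c' A v" if "v \<in> W" "i \<in> {l..<t - 1}" for v i
  proof (rule phi_stab[OF s_stab[OF colouringD(1)[OF c(1)]] that(1)])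
    have "i \<in> {1..r}" "i + 1 \<in> {1..r}" "i \<noteq> t" "i + 1 \<noteq> t" using that(2) b(1) t(1) by auto
    moreover have adj: "i \<in> adj c1" by (rule adj1) (use that(2) in auto)
    ultimately show "i \<in> adj c"
      using eq[of i] eq[of "i+1"] adj by (simp add: adj_def)
  qed
  have move: "phi c c' A (v \<circ> word_perm r [i..<t]) =
      (if A (h+1) (c' (v i)) > 0 then phi c1 c' (mat_up ?N A h (c' (v i))) v else 0)" if i: "i \<in> {l..t}" for i
  proof -
    have u: "word_perm r [i..<t] \<in> stab c1"
      using adj1 i by (intro word_perm_stab[OF colouringD(1)[OF c(2)]]) auto
    have ut: "word_perm r [i..<t] t = i" using word_perm_upt(1)[of i t] i t b by simp
    show ?thesis
      using phi_move_up[OF colouringD(1)[OF c(1)] colouringD(1)[OF c(2)] colouringD(1)[OF c(3)]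
          colouringD(2)[OF c(3)] h t eq v u A] unfolding ut .
  qed
  have cv: "c' (v i) \<in> {1..?N}" if "i \<in> {l..t}" for i
  proof -
    have "v i \<in> {1..2*r}" using that t b W_in[OF v, of i] by simp
    then show ?thesis by (rule subsetD[OF colouringD(2)[OF c(3)] imageI])
  qed
  have tb: "{l..t} \<subseteq> {1..2*r}" using t b by auto
  have "(\<Sum>k\<in>{l..t}. foldr tau [k..<t] (phi c c' A) v) =
    (\<Sum>i\<in>{l..t}. qv ^ card {j\<in>{l..t}. v i < v j} * phi c c' A (v \<circ> word_perm r [i..<t]))"
    using t b by (intro down_formula inv v) simp_all
  also have "\<dots> = (\<Sum>i\<in>{l..t}. qv ^ card {j\<in>{l..t}. v i < v j} *
      (if A (h+1) (c' (v i)) > 0 then phi c1 c' (mat_up ?N A h (c' (v i))) v else 0))"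
    by (intro sum.cong refl) (simp only: move)
  also have "\<dots> = (\<Sum>p | p \<in> {1..?N} \<and> A (h+1) p > 0.
      (\<Sum>i | i \<in> {l..t} \<and> c' (v i) = p. qv ^ card {j\<in>{l..t}. v i < v j}) *
        phi c1 c' (mat_up ?N A h p) v)"
    by (rule regroup[where c' = c' and v = v, OF finite_atLeastAtMost cv])
  also have "\<dots> = (\<Sum>p | p \<in> {1..?N} \<and> A (h+1) p > 0.
      (qv ^ (\<Sum>j\<in>{p<..?N}. A h j) * qnum (A h p + 1)) * phi c1 c' (mat_up ?N A h p) v)"
  proof (intro sum.cong refl)
    fix p assume "p \<in> {p. p \<in> {1..?N} \<and> A (h+1) p > 0}"
    then have p: "p \<in> {1..?N}" by simp
    show "(\<Sum>i | i \<in> {l..t} \<and> c' (v i) = p. qv ^ card {j\<in>{l..t}. v i < v j}) *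
        phi c1 c' (mat_up ?N A h p) v =
      (qv ^ (\<Sum>j\<in>{p<..?N}. A h j) * qnum (A h p + 1)) * phi c1 c' (mat_up ?N A h p) v"
    proof (cases "cnt c1 c' v = mat_up ?N A h p")
      case True
      have cnt: "card {j\<in>{l..t}. c' (v j) = k} = A h k + (if k = p then 1 else 0)" for k
      proof -
        have "card {j\<in>{l..t}. c' (v j) = k} = mat_up ?N A h p h k"
          unfolding True[symmetric] cnt_row b(3) ..
        moreover have ne: "h \<noteq> ?N + 1 - h" "h \<noteq> h + 1" "h \<noteq> ?N + 1 - (h+1)" using h by auto
        ultimately show ?thesis
          unfolding mat_up_def E_theta_row(1)[OF ne(1)] E_theta_row(3)[OF ne(2,3)] diff_zero by (simp only:)
      qed
      show ?thesis
        unfolding colour_sum_down[OF colouringD(3,2)[OF c(3)] v tb] cnt by simp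
    next
      case False
      then show ?thesis by (simp add: phi_def)
    qed
  qed
  finally show ?thesis .
qed

text \<open>An element that fixes the positions before t also fixes their mirror images, so it
  preserves the central block.\<close>

lemma fixing_stab:
  assumes c: "sym_colouring (2*n+1) c" and t: "1 \<le> t" "{x\<in>{1..2*r}. c x = n+1} = {t..2*r+1-t}"
    and u: "u \<in> fixing (t - 1)"
  shows "u \<in> stab c"
proof -
  have uW: "u \<in> W" using u by (rule fixing_W)
  have low: "u x = x" if "x \<in> {1..<t}" for x
  proof -
    have "x \<in> {1..t - 1}" using that by auto
    then show ?thesis using u unfolding fixing_def by blast
  qed
  have high: "u x = x" if "x \<in> {1..2*r}" "2*r+1-t < x" for x
  proof -
    have y: "2*r+1-x \<in> {1..<t}" "2*r+1-x \<in> {1..2*r}" "2*r+1-(2*r+1-x) = x" using that t(1) by auto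
    show ?thesis using W_mirror[OF uW y(2)] unfolding low[OF y(1)] y(3) .
  qed
  have "c (u x) = c x" if x: "x \<in> {1..2*r}" for x
  proof (cases "x \<in> {t..2*r+1-t}")
    case True
    have ux: "u x \<in> {1..2*r}" using W_in[OF uW, of x] x by simp
    have "u x \<in> {t..2*r+1-t}"
    proof (rule ccontr)
      assume "u x \<notin> {t..2*r+1-t}"
      then have "u x \<in> {1..<t} \<or> 2*r+1-t < u x" using ux by auto
      then have "u (u x) = u x" using low[of "u x"] high[OF ux] by blast
      then have "u x = x" unfolding W_inj[OF uW] .
      with True \<open>u x \<notin> _\<close> show False by simp
    qed
    then have "u x \<in> {x\<in>{1..2*r}. c x = n+1}" "x \<in> {x\<in>{1..2*r}. c x = n+1}"
      using True unfolding t(2) by blast+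
    then show ?thesis by simp
  next
    case False
    then have "x \<in> {1..<t} \<or> 2*r+1-t < x" using x by auto
    then have "u x = x" using low[of x] high[OF x] by blast
    then show ?thesis by simp
  qed
  with uW show ?thesis by (simp add: stab_def)
qed

text \<open>For h = n the enlarged block is symmetric about the middle, so
  \<open>center_formula\<close> takes the place of \<open>up_formula\<close>, and the middle colour
  becomes exceptional.\<close>

lemma multiply_center:
  assumes c: "colouring n c" "colouring n c1" "colouring n c'" and n: "1 \<le> n"
    and t: "t \<in> {1..r}" "c t = n" "c1 t = n+1"
    and eq: "\<And>x. x \<in> {1..r} \<Longrightarrow> x \<noteq> t \<Longrightarrow> c1 x = c x"
    and b: "{x\<in>{1..2*r}. c1 x = n+1} = {t..2*r+1-t}"
    and A: "A \<in> Xi (2*n+1) (2*r)" and v: "v \<in> W"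
  shows "(\<Sum>k\<in>{t..r}. foldr tau (rev [t..<k]) (phi c c' A) v) +
      (\<Sum>k\<in>{t..r}. foldr tau ([k..<r] @ [r] @ rev [t..<r]) (phi c c' A) v) =
    (\<Sum>p | p \<in> {1..2*n+1} \<and> A n p > 0.
      (if p = n + 1
       then qv ^ (\<Sum>j\<in>{1..<p}. A (n+1) j) * (qnum (A (n+1) p + 1) + qv ^ (A (n+1) p div 2))
       else qv ^ (\<Sum>j\<in>{1..<p}. A (n+1) j) * qnum (A (n+1) p + 1)) *
        phi c1 c' (mat_down (2*n+1) A n p) v)"
proof -
  let ?N = "2*n+1" and ?B = "{t..2*r+1-t}"
  define F where "F v i = (if A n (c' (v i)) > 0
      then phi c1 c' (mat_down ?N A n (c' (v i))) v else 0)" for v :: "nat \<Rightarrow> nat" and i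
  have nn: "n \<in> {1..n}" using n by simp
  have F: "phi c c' A (v \<circ> u) = F v (u t)" if "v \<in> W" "u \<in> fixing (t - 1)" for v u
    unfolding F_def using t(1)
    by (intro phi_move_down[OF colouringD(1)[OF c(1)] colouringD(1)[OF c(2)] colouringD(1)[OF c(3)]
          colouringD(2)[OF c(3)] nn t eq that(1) _ A]
        fixing_stab[OF colouringD(1)[OF c(2)] _ b that(2)]) simp_all
  have tb: "?B \<subseteq> {1..2*r}" using t by auto
  have cv: "c' (v i) \<in> {1..?N}" if "i \<in> ?B" for i
  proof -
    have "v i \<in> {1..2*r}" using subsetD[OF tb that] W_in[OF v, of i] by simp
    then show ?thesis by (rule subsetD[OF colouringD(2)[OF c(3)] imageI])
  qed
  have "(\<Sum>k\<in>{t..r}. foldr tau (rev [t..<k]) (phi c c' A) v) +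
      (\<Sum>k\<in>{t..r}. foldr tau ([k..<r] @ [r] @ rev [t..<r]) (phi c c' A) v) =
    (\<Sum>i\<in>?B. qv ^ card {j\<in>?B. j \<noteq> 2*r+1-i \<and> v j < v i} * F v i)"
    using t(1) by (intro center_formula F v) simp_all
  also have "\<dots> = (\<Sum>p | p \<in> {1..?N} \<and> A n p > 0.
      (\<Sum>i | i \<in> ?B \<and> c' (v i) = p. qv ^ card {j\<in>?B. j \<noteq> 2*r+1-i \<and> v j < v i}) *
        phi c1 c' (mat_down ?N A n p) v)"
    unfolding F_def by (rule regroup[where c' = c' and v = v, OF finite_atLeastAtMost cv])
  also have "\<dots> = (\<Sum>p | p \<in> {1..?N} \<and> A n p > 0.
      (if p = n + 1
       then qv ^ (\<Sum>j\<in>{1..<p}. A (n+1) j) * (qnum (A (n+1) p + 1) + qv ^ (A (n+1) p div 2))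
       else qv ^ (\<Sum>j\<in>{1..<p}. A (n+1) j) * qnum (A (n+1) p + 1)) *
        phi c1 c' (mat_down ?N A n p) v)"
  proof (intro sum.cong refl)
    fix p assume "p \<in> {p. p \<in> {1..?N} \<and> A n p > 0}"
    then have p: "p \<in> {1..?N}" by simp
    show "(\<Sum>i | i \<in> ?B \<and> c' (v i) = p. qv ^ card {j\<in>?B. j \<noteq> 2*r+1-i \<and> v j < v i}) *
        phi c1 c' (mat_down ?N A n p) v =
      (if p = n + 1
       then qv ^ (\<Sum>j\<in>{1..<p}. A (n+1) j) * (qnum (A (n+1) p + 1) + qv ^ (A (n+1) p div 2))
       else qv ^ (\<Sum>j\<in>{1..<p}. A (n+1) j) * qnum (A (n+1) p + 1)) *
        phi c1 c' (mat_down ?N A n p) v"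
    proof (cases "cnt c1 c' v = mat_down ?N A n p")
      case True
      have cnt: "card {j\<in>?B. c' (v j) = k} =
          A (n+1) k + (if k = p then 1 else 0) + (if k = 2*n+2-p then 1 else 0)" for k
      proof -
        have "card {j\<in>?B. c' (v j) = k} = mat_down ?N A n p (n+1) k"
          unfolding True[symmetric] cnt_row b ..
        \<comment> \<open>Row n + 1 is its own mirror image, so the shift adds entries to it in the
          columns p and 2n + 2 - p.\<close>
        moreover have ne: "n + 1 = ?N + 1 - (n+1)" "n + 1 \<noteq> n" "n + 1 \<noteq> ?N + 1 - n"
          using n by auto
        moreover have "?N + 1 = 2*n+2" by simp
        ultimately show ?thesis
          unfolding mat_down_def E_theta_row(2)[OF ne(1)] E_theta_row(3)[OF ne(2,3)] diff_zero
          by (simp only: add.assoc)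
      qed
      have "(\<Sum>i | i \<in> ?B \<and> c' (v i) = p. qv ^ card {j\<in>?B. j \<noteq> 2*r+1-i \<and> v j < v i}) =
        (if p = n + 1
         then qv ^ (\<Sum>j\<in>{1..<p}. A (n+1) j) * (qnum (A (n+1) p + 1) + qv ^ (A (n+1) p div 2))
         else qv ^ (\<Sum>j\<in>{1..<p}. A (n+1) j) * qnum (A (n+1) p + 1))"
      proof (rule colour_sum_center[OF colouringD(1,2)[OF c(3)] v tb _ p])
        show "2*r+1-x \<in> ?B" if "x \<in> ?B" for x using that by auto
      qed (rule cnt)
      then show ?thesis by (simp only:)
    next
      case False
      then show ?thesis by (simp add: phi_def)
    qed
  qed
  finally show ?thesis .
qed

end

section \<open>Compositions as colourings\<close>

lemma sum_mirror_split:
  fixes f :: "nat \<Rightarrow> nat"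
  shows "(\<Sum>i\<in>{1..2*n+1}. f i) = f (n+1) + (\<Sum>i\<in>{1..n}. f i) + (\<Sum>i\<in>{1..n}. f (2*n+2-i))"
proof -
  have "{1..2*n+1} = insert (n+1) ({1..n} \<union> {n+2..2*n+1})" by auto
  then have "(\<Sum>i\<in>{1..2*n+1}. f i) = f (n+1) + ((\<Sum>i\<in>{1..n}. f i) + (\<Sum>i\<in>{n+2..2*n+1}. f i))"
    by (simp add: sum.union_disjoint)
  moreover have "(\<Sum>i\<in>{n+2..2*n+1}. f i) = (\<Sum>i\<in>{1..n}. f (2*n+2-i))"
    by (rule sum.reindex_bij_witness[of _ "\<lambda>a. 2*n+2-a" "\<lambda>a. 2*n+2-a"]) auto
  ultimately show ?thesis by simp
qed

definition bnd :: "nat \<Rightarrow> (nat \<Rightarrow> nat) \<Rightarrow> nat \<Rightarrow> nat" where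
  "bnd n l i = (\<Sum>k\<in>{1..i}. hat n l k)"

text \<open>The least index picks the block containing x and skips empty blocks.\<close>

definition col :: "nat \<Rightarrow> (nat \<Rightarrow> nat) \<Rightarrow> nat \<Rightarrow> nat" where
  "col n l x = (LEAST i. x \<le> bnd n l i)"

lemma hat_mirror: "k \<in> {1..2*n+1} \<Longrightarrow> hat n l (2*n+2-k) = hat n l k"
  unfolding hat_def by (cases "k \<le> n"; cases "k = n+1") auto

lemma bnd_0: "bnd n l 0 = 0"
  by (simp add: bnd_def)

lemma bnd_Suc: "bnd n l (Suc i) = bnd n l i + hat n l (Suc i)"
  by (simp add: bnd_def)

lemma bnd_mono: "i \<le> j \<Longrightarrow> bnd n l i \<le> bnd n l j"
  unfolding bnd_def by (rule sum_mono2) auto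

lemma bnd_low: "i \<le> n \<Longrightarrow> bnd n l i = (\<Sum>k\<in>{1..i}. l k)"
  unfolding bnd_def by (rule sum.cong) (auto simp: hat_def)

lemma bnd_total: "l \<in> Comp (n+1) r \<Longrightarrow> bnd n l (2*n+1) = 2*r"
proof -
  assume "l \<in> Comp (n+1) r"
  then have "(\<Sum>i\<in>{1..n}. l i) + l (n+1) = r" unfolding Comp_def by simp
  moreover have "(\<Sum>i\<in>{1..n}. hat n l i) = (\<Sum>i\<in>{1..n}. l i)"
    by (rule sum.cong) (auto simp: hat_def)
  moreover have "(\<Sum>i\<in>{1..n}. hat n l (2*n+2-i)) = (\<Sum>i\<in>{1..n}. hat n l i)"
    by (intro sum.cong refl hat_mirror) auto
  moreover have "hat n l (n+1) = 2 * l (n+1)" by (simp add: hat_def)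
  ultimately show ?thesis unfolding bnd_def sum_mirror_split by simp
qed

lemma bnd_mirror:
  assumes "l \<in> Comp (n+1) r" "i \<le> 2*n+1"
  shows "bnd n l i + bnd n l (2*n+1-i) = 2*r"
proof -
  have "{1..2*n+1} = {1..i} \<union> {i+1..2*n+1}" using assms(2) by auto
  then have "bnd n l (2*n+1) = bnd n l i + (\<Sum>k\<in>{i+1..2*n+1}. hat n l k)"
    unfolding bnd_def by (simp add: sum.union_disjoint)
  also have "(\<Sum>k\<in>{i+1..2*n+1}. hat n l k) = (\<Sum>k\<in>{1..2*n+1-i}. hat n l (2*n+2-k))"
    by (rule sum.reindex_bij_witness[of _ "\<lambda>a. 2*n+2-a" "\<lambda>a. 2*n+2-a"]) (use assms(2) in auto)
  also have "\<dots> = bnd n l (2*n+1-i)"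
    unfolding bnd_def by (intro sum.cong refl hat_mirror) auto
  finally show ?thesis using bnd_total[OF assms(1)] by simp
qed

lemma col_le:
  assumes "l \<in> Comp (n+1) r" "x \<le> 2*r"
  shows "col n l x \<le> i \<longleftrightarrow> x \<le> bnd n l i"
proof
  have "x \<le> bnd n l (2*n+1)" using bnd_total[OF assms(1)] assms(2) by simp
  then have "x \<le> bnd n l (col n l x)" unfolding col_def by (rule LeastI)
  then show "x \<le> bnd n l i" if "col n l x \<le> i" using bnd_mono[OF that] by (rule order_trans)
  show "col n l x \<le> i" if "x \<le> bnd n l i" unfolding col_def using that by (rule Least_le)
qed

lemma col_range: "l \<in> Comp (n+1) r \<Longrightarrow> x \<in> {1..2*r} \<Longrightarrow> col n l x \<in> {1..2*n+1}"
  using col_le[of l n r x "2*n+1"] col_le[of l n r x 0] bnd_total[of l n r] by (simp add: bnd_0)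

lemma col_eq_iff:
  assumes "l \<in> Comp (n+1) r" "x \<in> {1..2*r}" "i \<ge> 1"
  shows "col n l x = i \<longleftrightarrow> bnd n l (i-1) < x \<and> x \<le> bnd n l i"
proof -
  have "col n l x = i \<longleftrightarrow> col n l x \<le> i \<and> \<not> col n l x \<le> i - 1" using assms(3) by linarith
  moreover have "x \<le> 2*r" using assms(2) by simp
  ultimately show ?thesis
    using col_le[OF assms(1), of x i] col_le[OF assms(1), of x "i-1"] by (simp only: not_le) blast
qed

lemma col_mono: "l \<in> Comp (n+1) r \<Longrightarrow> y \<le> 2*r \<Longrightarrow> x \<le> y \<Longrightarrow> col n l x \<le> col n l y"
  using col_le[of l n r x "col n l y"] col_le[of l n r y "col n l y"] by simp

lemma mem_block:
  assumes "l \<in> Comp (n+1) r" "i \<in> {1..2*n+1}"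
  shows "x \<in> block n l i \<longleftrightarrow> x \<in> {1..2*r} \<and> col n l x = i"
proof -
  have "{1..<i} = {1..i-1}" by auto
  then have "x \<in> block n l i \<longleftrightarrow> bnd n l (i-1) < x \<and> x \<le> bnd n l i"
    by (simp add: block_def bnd_def)
  moreover have "bnd n l i \<le> 2*r"
    using bnd_mono[of i "2*n+1" n l] bnd_total[OF assms(1)] assms(2) by simp
  ultimately show ?thesis using col_eq_iff[OF assms(1), of x i] assms(2) by auto
qed

text \<open>Initial segments of a linearly ordered set are nested, so equal size makes them
  equal.\<close>

lemma card_nested_eq:
  fixes R :: "nat set"
  assumes "finite R" "card {x\<in>R. P x} = card {x\<in>R. Q x}"
    and P: "\<And>x y. x \<in> R \<Longrightarrow> y \<in> R \<Longrightarrow> x < y \<Longrightarrow> P y \<Longrightarrow> P x"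
    and Q: "\<And>x y. x \<in> R \<Longrightarrow> y \<in> R \<Longrightarrow> x < y \<Longrightarrow> Q y \<Longrightarrow> Q x"
  shows "{x\<in>R. P x} = {x\<in>R. Q x}"
proof -
  have "{x\<in>R. P x} \<subseteq> {x\<in>R. Q x} \<or> {x\<in>R. Q x} \<subseteq> {x\<in>R. P x}"
  proof (rule ccontr)
    assume "\<not> ?thesis"
    then obtain x y where x: "x \<in> R" "P x" "\<not> Q x" and y: "y \<in> R" "Q y" "\<not> P y" by blast
    consider "x < y" | "x = y" | "y < x" by linarith
    then show False
    proof cases
      case 1
      from Q[OF x(1) y(1) 1 y(2)] x(3) show False by contradiction
    next
      case 2
      with x y show False by simp
    next
      case 3
      from P[OF y(1) x(1) 3 x(2)] y(3) show False by contradiction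
    qed
  qed
  moreover have fin: "finite {x\<in>R. P x}" "finite {x\<in>R. Q x}" using assms(1) by simp_all
  ultimately show ?thesis
    using card_subset_eq[OF fin(2) _ assms(2)] card_subset_eq[OF fin(1) _ assms(2)[symmetric]] by argo
qed

context type_B begin

lemma colouring_col: "l \<in> Comp (n+1) r \<Longrightarrow> colouring n (col n l)"
proof -
  assume l: "l \<in> Comp (n+1) r"
  have "mono_on {1..2*r} (col n l)" using col_mono[OF l] by (auto intro!: mono_onI)
  moreover have "col n l x + col n l (2*r+1-x) = 2*n+1+1" if x: "x \<in> {1..2*r}" for x
  proof -
    let ?i = "col n l x"
    have i: "?i \<in> {1..2*n+1}" by (rule col_range[OF l x])
    then have ix: "bnd n l (?i-1) < x" "x \<le> bnd n l ?i" using col_eq_iff[OF l x, of ?i] by auto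
    have "bnd n l (?i-1) + bnd n l (2*n+1-(?i-1)) = 2*r" "bnd n l ?i + bnd n l (2*n+1-?i) = 2*r"
    proof -
      have "?i - 1 \<le> 2*n+1" "?i \<le> 2*n+1" using i by auto
      from bnd_mirror[OF l this(1)] bnd_mirror[OF l this(2)]
      show "bnd n l (?i-1) + bnd n l (2*n+1-(?i-1)) = 2*r" "bnd n l ?i + bnd n l (2*n+1-?i) = 2*r" .
    qed
    moreover have "2*n+1-(?i-1) = 2*n+2-?i" "2*n+2-?i-1 = 2*n+1-?i" using i by auto
    ultimately have "bnd n l (2*n+2-?i-1) < 2*r+1-x" "2*r+1-x \<le> bnd n l (2*n+2-?i)"
      using ix x by auto
    then have "col n l (2*r+1-x) = 2*n+2-?i"
      using col_eq_iff[OF l, of "2*r+1-x" "2*n+2-?i"] x i by auto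
    then show ?thesis using i by auto
  qed
  ultimately show ?thesis
    unfolding colouring_def sym_colouring_def using col_range[OF l] by blast
qed

text \<open>Matches the generators in \<open>parabolic\<close> with the simple reflections in the
  colour stabiliser.\<close>

lemma adj_col:
  assumes l: "l \<in> Comp (n+1) r" and n: "n \<ge> 1"
  shows "adj (col n l) = {1..r} - {(\<Sum>k\<in>{1..i}. l k) | i. i \<in> {1..n}}"
proof -
  have "col n l i \<noteq> col n l (i+1) \<longleftrightarrow> (\<exists>j\<in>{1..n}. i = (\<Sum>k\<in>{1..j}. l k))" if i: "i \<in> {1..r}" for i
  proof
    have ir: "i \<in> {1..2*r}" "i \<le> 2*r" "i + 1 \<le> 2*r" using i r2 by auto
    assume ne: "col n l i \<noteq> col n l (i+1)"
    let ?j = "col n l i"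
    have j: "?j \<in> {1..2*n+1}" by (rule col_range[OF l ir(1)])
    have "?j \<le> col n l (i+1)" by (rule col_mono[OF l ir(3)]) simp
    then have "\<not> col n l (i+1) \<le> ?j" using ne by simp
    then have "\<not> i + 1 \<le> bnd n l ?j" using col_le[OF l ir(3)] by simp
    moreover have "i \<le> bnd n l ?j" using col_le[OF l ir(2), of ?j] by simp
    ultimately have ij: "i = bnd n l ?j" by simp
    show "\<exists>j\<in>{1..n}. i = (\<Sum>k\<in>{1..j}. l k)"
    proof (cases "?j \<le> n")
      case True
      then show ?thesis using ij bnd_low[OF True, of l] j by auto
    next
      case False
      \<comment> \<open>A position i up to r that ends a block of number beyond n can only be i = r
        with an empty central block; then r is the n-th partial sum.\<close>
      have "bnd n l n + bnd n l (2*n+1-n) = 2*r" by (rule bnd_mirror[OF l]) simp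
      moreover have "2*n+1-n = n+1" by simp
      moreover have "bnd n l n \<le> bnd n l (n+1)" "bnd n l (n+1) \<le> bnd n l ?j"
        using False by (auto intro: bnd_mono)
      ultimately have "i = bnd n l n" using ij i by simp
      then show ?thesis using bnd_low[of n n l] n by auto
    qed
  next
    have ir: "i \<le> 2*r" "i + 1 \<le> 2*r" using i r2 by auto
    assume "\<exists>j\<in>{1..n}. i = (\<Sum>k\<in>{1..j}. l k)"
    then obtain j where j: "j \<in> {1..n}" "i = (\<Sum>k\<in>{1..j}. l k)" by blast
    then have "i = bnd n l j" using bnd_low[of j n l] by simp
    then have "col n l i \<le> j" "\<not> col n l (i+1) \<le> j" using col_le[OF l ir(1)] col_le[OF l ir(2)] by simp_all
    then show "col n l i \<noteq> col n l (i+1)" by auto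
  qed
  then show ?thesis unfolding adj_def by blast
qed

lemma parabolic_eq: "l \<in> Comp (n+1) r \<Longrightarrow> n \<ge> 1 \<Longrightarrow> parabolic n r l = stab (col n l)"
  using parabolic_eq_stab[OF colouringD(1)[OF colouring_col, of l n]]
  unfolding parabolic_def by (simp only: adj_col)

section \<open>Double cosets as classes of equal count matrix\<close>

text \<open>The nonempty classes are the double cosets (\<open>count_class_double_coset\<close>);
  the inverse agrees with the indexing of \<open>theta\<close>.\<close>

definition count_class :: "(nat \<Rightarrow> nat) \<Rightarrow> (nat \<Rightarrow> nat) \<Rightarrow> mat \<Rightarrow> (nat \<Rightarrow> nat) set" where
  "count_class c c' A = {w \<in> W. cnt c c' (pinv w) = A}"

lemma cnt_stab_left:
  assumes "u \<in> stab c'" "v \<in> W"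
  shows "cnt c c' (u \<circ> v) = cnt c c' v"
proof (intro ext)
  fix i j
  have "c' (u (v k)) = c' (v k)" if "k \<in> {1..2*r}" for k
    using assms W_in[OF assms(2), of k] that unfolding stab_def by blast
  then have "{k\<in>{1..2*r}. c k = i \<and> c' ((u \<circ> v) k) = j} = {k\<in>{1..2*r}. c k = i \<and> c' (v k) = j}"
    by (intro Collect_cong) auto
  then show "cnt c c' (u \<circ> v) i j = cnt c c' v i j" by (simp only: cnt_def)
qed

lemma cnt_double_coset:
  assumes "u \<in> stab c" "w \<in> W" "u' \<in> stab c'"
  shows "cnt c c' (pinv (u \<circ> w \<circ> u')) = cnt c c' (pinv w)"
proof -
  note uW = stab_W[OF assms(1)] and u'W = stab_W[OF assms(3)]
  have "pinv (u \<circ> w \<circ> u') = pinv u' \<circ> (pinv w \<circ> pinv u)"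
    using W_inv_comp[OF comp_W[OF uW assms(2)] u'W] W_inv_comp[OF uW assms(2)] by simp
  then show ?thesis
    using cnt_stab_left[OF stab_inv[OF assms(3)] comp_W[OF inv_W[OF assms(2)] inv_W[OF uW]]]
      cnt_stab[OF stab_inv[OF assms(1)] inv_W[OF assms(2)]] by simp
qed

text \<open>Descents on either side are removed by generators of the two stabilisers, and each
  removal shortens w.\<close>

lemma double_coset_min:
  assumes c: "sym_colouring N c" "sym_colouring N' c'" and w: "w \<in> W"
  shows "\<exists>u\<in>stab c. \<exists>u'\<in>stab c'. (\<forall>i\<in>adj c'. (u \<circ> w \<circ> u') i < (u \<circ> w \<circ> u') (i+1)) \<and>
    (\<forall>i\<in>adj c. pinv (u \<circ> w \<circ> u') i < pinv (u \<circ> w \<circ> u') (i+1))"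
  using w
proof (induction "len2 w" arbitrary: w rule: less_induct)
  case less
  consider (min) "(\<forall>i\<in>adj c'. w i < w (i+1)) \<and> (\<forall>i\<in>adj c. pinv w i < pinv w (i+1))"
    | (right) i where "i \<in> adj c'" "\<not> w i < w (i+1)"
    | (left) i where "i \<in> adj c" "\<not> pinv w i < pinv w (i+1)" by blast
  then show ?case
  proof cases
    case min
    have "id \<circ> w \<circ> id = w" by simp
    then show ?thesis using min stab_id by metis
  next
    case (right i)
    have ir: "i \<in> {1..r}" using right by (simp add: adj_def)
    have ws: "w \<circ> s i \<in> W" by (intro comp_W less.prems s_W ir)
    have "len2 (w \<circ> s i) < len2 w"
      using len2_desc[OF less.prems ir W_asc_or_desc[OF less.prems right(2)]] by simp
    from less.hyps[OF this ws] obtain u u' where u: "u \<in> stab c" "u' \<in> stab c'"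
      "(\<forall>i'\<in>adj c'. (u \<circ> (w \<circ> s i) \<circ> u') i' < (u \<circ> (w \<circ> s i) \<circ> u') (i'+1)) \<and>
       (\<forall>i'\<in>adj c. pinv (u \<circ> (w \<circ> s i) \<circ> u') i' < pinv (u \<circ> (w \<circ> s i) \<circ> u') (i'+1))" by blast
    have "u \<circ> (w \<circ> s i) \<circ> u' = u \<circ> w \<circ> (s i \<circ> u')" by (simp only: comp_assoc)
    with u stab_comp[OF s_stab[OF c(2) right(1)] u(2)] show ?thesis by metis
  next
    case (left i)
    have ir: "i \<in> {1..r}" using left by (simp add: adj_def)
    have ws: "s i \<circ> w \<in> W" by (intro comp_W less.prems s_W ir)
    have "len2 (s i \<circ> w) = len2 (pinv (s i \<circ> w))" by (rule len2_inv[OF ws, symmetric])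
    also have "pinv (s i \<circ> w) = pinv w \<circ> s i"
      using W_inv_comp[OF s_W[OF ir] less.prems] inv_s[OF ir] by simp
    also have "len2 (pinv w \<circ> s i) < len2 (pinv w)"
      using len2_desc[OF inv_W[OF less.prems] ir W_asc_or_desc[OF inv_W[OF less.prems] left(2)]] by simp
    also have "len2 (pinv w) = len2 w" by (rule len2_inv[OF less.prems])
    finally have "len2 (s i \<circ> w) < len2 w" .
    from less.hyps[OF this ws] obtain u u' where u: "u \<in> stab c" "u' \<in> stab c'"
      "(\<forall>i'\<in>adj c'. (u \<circ> (s i \<circ> w) \<circ> u') i' < (u \<circ> (s i \<circ> w) \<circ> u') (i'+1)) \<and>
       (\<forall>i'\<in>adj c. pinv (u \<circ> (s i \<circ> w) \<circ> u') i' < pinv (u \<circ> (s i \<circ> w) \<circ> u') (i'+1))" by blast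
    have "u \<circ> (s i \<circ> w) \<circ> u' = (u \<circ> s i) \<circ> w \<circ> u'" by (simp only: comp_assoc)
    with u stab_comp[OF u(1) s_stab[OF c(1) left(1)]] show ?thesis by metis
  qed
qed

text \<open>On a colour class of c the values of v increase, so their colours increase weakly and
  are determined by how often each occurs.\<close>

lemma cnt_determines_colours:
  assumes c: "sym_colouring N c" "sym_colouring N' c'" and v: "v \<in> W" "v' \<in> W"
    and asc: "\<forall>i\<in>adj c. v i < v (i+1)" "\<forall>i\<in>adj c. v' i < v' (i+1)"
    and eq: "cnt c c' v = cnt c c' v'" and y: "y \<in> {1..2*r}"
  shows "c' (v y) = c' (v' y)"
proof -
  let ?R = "{x\<in>{1..2*r}. c x = c y}"
  have mono: "mono_on {1..2*r} c'" using c(2) by (simp add: sym_colouring_def)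
  have card: "card {x\<in>?R. c' (z x) \<le> j} = (\<Sum>k\<in>{..j}. cnt c c' z (c y) k)" for z j
  proof -
    have "{x\<in>?R. c' (z x) \<le> j} = (\<Union>k\<in>{..j}. {x\<in>?R. c' (z x) = k})" by auto
    moreover have "card (\<Union>k\<in>{..j}. {x\<in>?R. c' (z x) = k}) = (\<Sum>k\<in>{..j}. card {x\<in>?R. c' (z x) = k})"
      by (rule card_UN_disjoint) auto
    ultimately show ?thesis by (simp only: cnt_row)
  qed
  have down: "c' (z x) \<le> j"
    if z: "z \<in> W" "\<forall>i\<in>adj c. z i < z (i+1)" and x: "x \<in> ?R" "x' \<in> ?R" "x < x'" "c' (z x') \<le> j" for z x x' j
  proof -
    have xr: "x \<in> {1..2*r}" "x' \<in> {1..2*r}" "c x = c x'" using x by auto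
    have "z x < z x'" by (rule asc_colour[OF c(1) z xr(1,2) x(3) xr(3)])
    then have "c' (z x) \<le> c' (z x')"
      using W_in[OF z(1)] xr by (intro mono_onD[OF mono]) auto
    with x(4) show ?thesis by (rule order_trans[rotated])
  qed
  have "{x\<in>?R. c' (v x) \<le> j} = {x\<in>?R. c' (v' x) \<le> j}" for j
  proof (rule card_nested_eq)
    show "finite ?R" by simp
    show "card {x\<in>?R. c' (v x) \<le> j} = card {x\<in>?R. c' (v' x) \<le> j}" unfolding card eq ..
  qed (fact down[OF v(1) asc(1)], fact down[OF v(2) asc(2)])
  moreover have "y \<in> ?R" using y by simp
  ultimately have "c' (v y) \<le> j \<longleftrightarrow> c' (v' y) \<le> j" for j by blast
  then show ?thesis by (meson order.refl order.antisym)
qed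

text \<open>The inverses of d and d' produce the same colours, so g = d'^-1 d preserves c'. It has
  no descent at i in \<open>adj c'\<close>: if d i and d (i+1) have equal colour, d'^-1 increases
  there; otherwise a descent of g, with d' increasing on colour classes of c', would give d (i+1) <
  d i. Hence g is the identity by \<open>stab_asc_id\<close>.\<close>

lemma cnt_determines_min:
  assumes c: "sym_colouring N c" "sym_colouring N' c'" and d: "d \<in> W" "d' \<in> W"
    and d_asc: "\<forall>i\<in>adj c'. d i < d (i+1)" "\<forall>i\<in>adj c. pinv d i < pinv d (i+1)"
    and d'_asc: "\<forall>i\<in>adj c'. d' i < d' (i+1)" "\<forall>i\<in>adj c. pinv d' i < pinv d' (i+1)"
    and eq: "cnt c c' (pinv d) = cnt c c' (pinv d')"
  shows "d = d'"
proof -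
  let ?g = "pinv d' \<circ> d"
  have mono: "mono_on {1..2*r} c" using c(1) by (simp add: sym_colouring_def)
  have gW: "?g \<in> W" by (intro comp_W inv_W d)
  have colour: "c' (pinv d y) = c' (pinv d' y)" if "y \<in> {1..2*r}" for y
    by (rule cnt_determines_colours[OF c inv_W[OF d(1)] inv_W[OF d(2)] d_asc(2) d'_asc(2) eq that])
  have gc: "c' (?g x) = c' x" if x: "x \<in> {1..2*r}" for x
  proof -
    have "d x \<in> {1..2*r}" using W_in[OF d(1)] x by simp
    from colour[OF this] show ?thesis using W_inv_f(1)[OF d(1), of x] by simp
  qed
  then have "?g \<in> stab c'" using gW by (simp add: stab_def)
  moreover have "?g i < ?g (i+1)" if i: "i \<in> adj c'" for i
  proof -
    have ir: "i \<in> {1..2*r}" "i+1 \<in> {1..2*r}" "c' i = c' (i+1)" using i by (auto simp: adj_def)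
    have dr: "d i \<in> {1..2*r}" "d (i+1) \<in> {1..2*r}" using W_in[OF d(1)] ir by auto
    have gr: "?g i \<in> {1..2*r}" "?g (i+1) \<in> {1..2*r}" using W_in[OF gW] ir by auto
    have lt: "d i < d (i+1)" using d_asc(1) i by blast
    show ?thesis
    proof (cases "c (d i) = c (d (i+1))")
      case True
      then show ?thesis using asc_colour[OF c(1) inv_W[OF d(2)] d'_asc(2) dr lt] by simp
    next
      case False
      have "c (d i) \<le> c (d (i+1))" using lt by (intro mono_onD[OF mono dr]) simp
      with False have clt: "c (d i) < c (d (i+1))" by simp
      have d'g: "d' (?g x) = d x" for x using W_inv_f(2)[OF d(2)] by simp
      show ?thesis
      proof (rule ccontr)
        assume n: "\<not> ?g i < ?g (i+1)"
        have "?g (i+1) \<noteq> ?g i" using W_inj[OF gW] by simp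
        with n have gt: "?g (i+1) < ?g i" by linarith
        have "c' (?g (i+1)) = c' (?g i)" using gc[OF ir(1)] gc[OF ir(2)] ir(3) by simp
        from asc_colour[OF c(2) d(2) d'_asc(1) gr(2,1) gt this] show False
          unfolding d'g using lt by simp
      qed
    qed
  qed
  ultimately have "?g = id" using stab_asc_id[OF c(2)] by blast
  then have "d' (?g x) = d' x" for x by simp
  then show ?thesis using W_inv_f(2)[OF d(2)] by (intro ext) simp
qed

text \<open>Two elements with the same matrix are moved by the stabilisers to doubly minimal
  elements, which coincide by \<open>cnt_determines_min\<close>.\<close>

lemma count_class_double_coset:
  assumes c: "sym_colouring N c" "sym_colouring N' c'" and w: "w \<in> W"
  shows "count_class c c' (cnt c c' (pinv w)) = {u \<circ> w \<circ> u' | u u'. u \<in> stab c \<and> u' \<in> stab c'}"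
proof (intro Set.set_eqI iffI)
  fix z assume "z \<in> {u \<circ> w \<circ> u' | u u'. u \<in> stab c \<and> u' \<in> stab c'}"
  then obtain u u' where z: "z = u \<circ> w \<circ> u'" "u \<in> stab c" "u' \<in> stab c'" by blast
  then show "z \<in> count_class c c' (cnt c c' (pinv w))"
    using cnt_double_coset[OF z(2) w z(3)] comp_W[OF comp_W[OF stab_W[OF z(2)] w] stab_W[OF z(3)]]
    unfolding count_class_def z(1) by blast
next
  fix z assume "z \<in> count_class c c' (cnt c c' (pinv w))"
  then have z: "z \<in> W" "cnt c c' (pinv z) = cnt c c' (pinv w)" by (simp_all add: count_class_def)
  obtain u u' where u: "u \<in> stab c" "u' \<in> stab c'"
    "(\<forall>i\<in>adj c'. (u \<circ> w \<circ> u') i < (u \<circ> w \<circ> u') (i+1)) \<and>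
     (\<forall>i\<in>adj c. pinv (u \<circ> w \<circ> u') i < pinv (u \<circ> w \<circ> u') (i+1))"
    using double_coset_min[OF c w] by blast
  obtain x x' where x: "x \<in> stab c" "x' \<in> stab c'"
    "(\<forall>i\<in>adj c'. (x \<circ> z \<circ> x') i < (x \<circ> z \<circ> x') (i+1)) \<and>
     (\<forall>i\<in>adj c. pinv (x \<circ> z \<circ> x') i < pinv (x \<circ> z \<circ> x') (i+1))"
    using double_coset_min[OF c z(1)] by blast
  have "x \<circ> z \<circ> x' = u \<circ> w \<circ> u'"
  proof (rule cnt_determines_min[OF c])
    show "cnt c c' (pinv (x \<circ> z \<circ> x')) = cnt c c' (pinv (u \<circ> w \<circ> u'))"
      unfolding cnt_double_coset[OF x(1) z(1) x(2)] cnt_double_coset[OF u(1) w u(2)] by (rule z(2))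
    show "x \<circ> z \<circ> x' \<in> W" "u \<circ> w \<circ> u' \<in> W"
      by (intro comp_W stab_W[OF x(1)] stab_W[OF x(2)] z(1))
        (intro comp_W stab_W[OF u(1)] stab_W[OF u(2)] w)
  qed (use u(3) x(3) in blast)+
  then have "pinv x \<circ> (x \<circ> z \<circ> x') \<circ> pinv x' = pinv x \<circ> (u \<circ> w \<circ> u') \<circ> pinv x'" by simp
  moreover have "pinv x \<circ> (x \<circ> z \<circ> x') \<circ> pinv x' = z"
    using W_inv_f(1)[OF stab_W[OF x(1)]] W_inv_f(2)[OF stab_W[OF x(2)]] by (simp add: fun_eq_iff)
  ultimately have "z = (pinv x \<circ> u) \<circ> w \<circ> (u' \<circ> pinv x')" by (simp only: comp_assoc)
  then show "z \<in> {u \<circ> w \<circ> u' | u u'. u \<in> stab c \<and> u' \<in> stab c'}"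
    using stab_comp[OF stab_inv[OF x(1)] u(1)] stab_comp[OF u(2) stab_inv[OF x(2)]] by blast
qed

lemma double_coset_eq:
  assumes "l \<in> Comp (n+1) r" "m \<in> Comp (n+1) r" "n \<ge> 1" "d \<in> W"
  shows "double_coset n r l d m = count_class (col n l) (col n m) (cnt (col n l) (col n m) (pinv d))"
  unfolding count_class_double_coset[OF colouringD(1)[OF colouring_col[OF assms(1)]]
      colouringD(1)[OF colouring_col[OF assms(2)]] assms(4)] double_coset_def
    parabolic_eq[OF assms(1,3)] parabolic_eq[OF assms(2,3)] r_coset_def set_mult_def weyl_mult
  by blast

end

section \<open>Every admissible matrix is a count matrix\<close>

lemma rank_bij:
  fixes f :: "'a \<Rightarrow> 'b::linorder"
  assumes P: "finite P" "inj_on f P"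
  shows "bij_betw (\<lambda>x. card {y\<in>P. f y \<le> f x}) P {1..card P}"
proof -
  let ?rk = "\<lambda>x. card {y\<in>P. f y \<le> f x}"
  have less: "?rk x < ?rk y" if "x \<in> P" "y \<in> P" "f x < f y" for x y
  proof (rule psubset_card_mono)
    show "{z\<in>P. f z \<le> f x} \<subset> {z\<in>P. f z \<le> f y}" using that by force
  qed (use P(1) in simp)
  have inj: "inj_on ?rk P"
  proof (rule inj_onI)
    fix x y assume xy: "x \<in> P" "y \<in> P" "?rk x = ?rk y"
    have "f x = f y"
    proof (rule ccontr)
      assume "f x \<noteq> f y"
      then show False
      proof (rule linorder_neqE)
        assume "f x < f y"
        from less[OF xy(1,2) this] xy(3) show False by linarith
      next
        assume "f y < f x"
        from less[OF xy(2,1) this] xy(3) show False by linarith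
      qed
    qed
    then show "x = y" using P(2) xy by (simp add: inj_on_def)
  qed
  have sub: "?rk ` P \<subseteq> {1..card P}"
  proof
    fix k assume "k \<in> ?rk ` P"
    then obtain x where x: "x \<in> P" "k = ?rk x" by blast
    have "{y\<in>P. f y \<le> f x} \<noteq> {}" using x(1) by blast
    moreover have "finite {y\<in>P. f y \<le> f x}" using P(1) by simp
    ultimately have "?rk x > 0" unfolding card_gt_0_iff by blast
    moreover have "?rk x \<le> card P" using P(1) by (intro card_mono) auto
    ultimately show "k \<in> {1..card P}" using x by simp
  qed
  have "card (?rk ` P) = card {1..card P}" unfolding card_image[OF inj] by simp
  then have "?rk ` P = {1..card P}" by (rule card_subset_eq[OF finite_atLeastAtMost sub])
  then show ?thesis unfolding bij_betw_def by (intro conjI inj)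
qed

lemma rank_le_iff:
  fixes f :: "'a \<Rightarrow> 'b::linorder"
  assumes P: "finite P" "x \<in> P" and Q: "\<And>y z. y \<in> P \<Longrightarrow> z \<in> P \<Longrightarrow> f y \<le> f z \<Longrightarrow> Q z \<Longrightarrow> Q y"
  shows "card {y\<in>P. f y \<le> f x} \<le> card {y\<in>P. Q y} \<longleftrightarrow> Q x"
proof
  assume "Q x"
  then show "card {y\<in>P. f y \<le> f x} \<le> card {y\<in>P. Q y}"
    using P Q[OF _ P(2)] by (intro card_mono) auto
next
  assume le: "card {y\<in>P. f y \<le> f x} \<le> card {y\<in>P. Q y}"
  show "Q x"
  proof (rule ccontr)
    assume n: "\<not> Q x"
    have "f y \<le> f x" if "y \<in> P" "Q y" for y using Q[OF P(2) that(1) _ that(2)] n by (meson linear)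
    then have "{y\<in>P. Q y} \<subset> {y\<in>P. f y \<le> f x}" using n P(2) by blast
    then have "card {y\<in>P. Q y} < card {y\<in>P. f y \<le> f x}" using P(1) by (intro psubset_card_mono) simp_all
    with le show False by simp
  qed
qed

text \<open>\<iota> reverses the order, so the elements up to \<iota> x correspond to those from x
  onwards; the elements up to x and those from x onwards cover P and share only x.\<close>

lemma rank_reverse:
  fixes f :: "'a \<Rightarrow> 'b::linorder"
  assumes P: "finite P" "inj_on f P" and i: "\<And>x. x \<in> P \<Longrightarrow> \<iota> x \<in> P \<and> \<iota> (\<iota> x) = x"
    and rev: "\<And>x y. x \<in> P \<Longrightarrow> y \<in> P \<Longrightarrow> f x < f y \<Longrightarrow> f (\<iota> y) < f (\<iota> x)" and x: "x \<in> P"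
  shows "card {y\<in>P. f y \<le> f x} + card {y\<in>P. f y \<le> f (\<iota> x)} = card P + 1"
proof -
  have le: "f (\<iota> y) \<le> f (\<iota> z)" if "y \<in> P" "z \<in> P" "f z \<le> f y" for y z
  proof (cases "f z = f y")
    case True
    then have "z = y" by (rule inj_onD[OF P(2) _ that(2,1)])
    then show ?thesis by simp
  next
    case False
    then have "f z < f y" using that(3) by simp
    then show ?thesis using rev[OF that(2,1)] by simp
  qed
  have "bij_betw \<iota> {y\<in>P. f x \<le> f y} {y\<in>P. f y \<le> f (\<iota> x)}"
  proof (rule bij_betw_byWitness[where f' = \<iota>])
    show "\<iota> ` {y\<in>P. f x \<le> f y} \<subseteq> {y\<in>P. f y \<le> f (\<iota> x)}" using i le[OF _ x] by auto
    show "\<iota> ` {y\<in>P. f y \<le> f (\<iota> x)} \<subseteq> {y\<in>P. f x \<le> f y}"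
    proof
      fix z assume "z \<in> \<iota> ` {y\<in>P. f y \<le> f (\<iota> x)}"
      then obtain y where y: "y \<in> P" "f y \<le> f (\<iota> x)" "z = \<iota> y" by blast
      have "f (\<iota> (\<iota> x)) \<le> f (\<iota> y)" using i x by (intro le y) blast
      then show "z \<in> {y\<in>P. f x \<le> f y}" using i[OF x] i[OF y(1)] y(3) by simp
    qed
  qed (use i in auto)
  then have "card {y\<in>P. f y \<le> f (\<iota> x)} = card {y\<in>P. f x \<le> f y}" by (simp add: bij_betw_same_card)
  moreover have "{y\<in>P. f y \<le> f x} \<union> {y\<in>P. f x \<le> f y} = P" by auto
  moreover have "{y\<in>P. f y \<le> f x} \<inter> {y\<in>P. f x \<le> f y} = {x}"
    using x P(2) by (auto simp: inj_on_def)
  ultimately show ?thesis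
    using card_Un_Int[of "{y\<in>P. f y \<le> f x}" "{y\<in>P. f x \<le> f y}"] P(1) by simp
qed

text \<open>Inverse of \<open>hat n\<close> on palindromic vectors of even total, where the middle
  entry is even and the division exact.\<close>

definition comp_of :: "nat \<Rightarrow> (nat \<Rightarrow> nat) \<Rightarrow> nat \<Rightarrow> nat" where
  "comp_of n f i = (if i \<in> {1..n} then f i else if i = n+1 then f (n+1) div 2 else 0)"

lemma comp_of:
  assumes f: "\<And>i. i \<in> {1..2*n+1} \<Longrightarrow> f (2*n+2-i) = f i" and sum: "(\<Sum>i\<in>{1..2*n+1}. f i) = 2*r"
  shows "comp_of n f \<in> Comp (n+1) r" "\<And>i. i \<in> {1..2*n+1} \<Longrightarrow> hat n (comp_of n f) i = f i"
proof -
  have "(\<Sum>i\<in>{1..n}. f (2*n+2-i)) = (\<Sum>i\<in>{1..n}. f i)" by (intro sum.cong refl f) auto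
  then have total: "f (n+1) + 2 * (\<Sum>i\<in>{1..n}. f i) = 2*r" using sum unfolding sum_mirror_split by simp
  then have even: "even (f (n+1))" by presburger
  have "(\<Sum>i\<in>{1..n}. comp_of n f i) = (\<Sum>i\<in>{1..n}. f i)" by (intro sum.cong) (auto simp: comp_of_def)
  moreover have "comp_of n f (n+1) = f (n+1) div 2" by (simp add: comp_of_def)
  ultimately have "(\<Sum>i\<in>{1..n+1}. comp_of n f i) = r" using total even by simp
  then show "comp_of n f \<in> Comp (n+1) r" unfolding Comp_def by (auto simp: comp_of_def)
  show "hat n (comp_of n f) i = f i" if i: "i \<in> {1..2*n+1}" for i
  proof -
    consider "i \<le> n" | "i = n+1" | "n+1 < i" by linarith
    then show ?thesis
    proof cases
      case 3
      then have "2*n+2-i \<in> {1..n}" using i by auto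
      then show ?thesis using 3 i f[OF i] by (simp add: hat_def comp_of_def)
    qed (use i even in \<open>simp_all add: hat_def comp_of_def\<close>)
  qed
qed

lemma ro_mirror:
  assumes A: "A \<in> Xi (2*n+1) t" and i: "i \<in> {1..2*n+1}"
  shows "ro (2*n+1) A (2*n+2-i) = ro (2*n+1) A i" "co (2*n+1) A (2*n+2-i) = co (2*n+1) A i"
proof -
  have m: "A (2*n+2-a) (2*n+2-b) = A a b" if "a \<in> {1..2*n+1}" "b \<in> {1..2*n+1}" for a b
    using Xi_mirror[OF A that] by simp
  have "ro (2*n+1) A (2*n+2-i) = (\<Sum>j\<in>{1..2*n+1}. A (2*n+2-i) (2*n+2-j))"
    unfolding ro_def by (rule sum.reindex_bij_witness[of _ "\<lambda>a. 2*n+2-a" "\<lambda>a. 2*n+2-a"]) auto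
  also have "\<dots> = ro (2*n+1) A i" unfolding ro_def by (rule sum.cong[OF refl m[OF i]])
  finally show "ro (2*n+1) A (2*n+2-i) = ro (2*n+1) A i" .
  have "co (2*n+1) A (2*n+2-i) = (\<Sum>j\<in>{1..2*n+1}. A (2*n+2-j) (2*n+2-i))"
    unfolding co_def by (rule sum.reindex_bij_witness[of _ "\<lambda>a. 2*n+2-a" "\<lambda>a. 2*n+2-a"]) auto
  also have "\<dots> = co (2*n+1) A i" unfolding co_def by (rule sum.cong[OF refl m[OF _ i]])
  finally show "co (2*n+1) A (2*n+2-i) = co (2*n+1) A i" .
qed

lemma ro_total:
  assumes A: "A \<in> Xi (2*n+1) t"
  shows "(\<Sum>i\<in>{1..2*n+1}. ro (2*n+1) A i) = t" "(\<Sum>i\<in>{1..2*n+1}. co (2*n+1) A i) = t"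
proof -
  show "(\<Sum>i\<in>{1..2*n+1}. ro (2*n+1) A i) = t" using A unfolding Xi_def ro_def by blast
  then show "(\<Sum>i\<in>{1..2*n+1}. co (2*n+1) A i) = t"
    unfolding co_def ro_def by (subst sum.swap)
qed

context type_B begin

text \<open>The triples \<open>(i, j, k)\<close> with \<open>1 \<le> k \<le> A i j\<close>, listed in the lexicographic order of
  \<open>(i, j, k)\<close> and in that of \<open>(j, i, k)\<close>, give the two sides of a permutation with block counts \<open>A\<close>.\<close>

lemma exists_count:
  assumes A: "A \<in> Xi (2*n+1) (2*r)" and l: "l \<in> Comp (n+1) r" and m: "m \<in> Comp (n+1) r"
    and ro: "\<And>i. i \<in> {1..2*n+1} \<Longrightarrow> hat n l i = ro (2*n+1) A i"
    and co: "\<And>i. i \<in> {1..2*n+1} \<Longrightarrow> hat n m i = co (2*n+1) A i"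
  shows "\<exists>v\<in>W. cnt (col n l) (col n m) v = A"
proof -
  let ?N = "2*n+1"
  define P where "P = (SIGMA i:{1..?N}. SIGMA j:{1..?N}. {1..A i j})"
  \<comment> \<open>Comparing g-values is the lexicographic order of (j, i, k).\<close>
  define g :: "nat \<times> nat \<times> nat \<Rightarrow> nat \<times> nat \<times> nat" where "g x = (fst (snd x), fst x, snd (snd x))" for x
  \<comment> \<open>The mirror image of a triple; it reverses both orders.\<close>
  define \<iota> where "\<iota> x = (?N+1 - fst x, ?N+1 - fst (snd x), A (fst x) (fst (snd x)) + 1 - snd (snd x))"
    for x :: "nat \<times> nat \<times> nat"
  define \<alpha> where "\<alpha> x = card {y\<in>P. id y \<le> id x}" for x
  define \<beta> where "\<beta> x = card {y\<in>P. g y \<le> g x}" for x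
  have fin: "finite P" unfolding P_def by (intro finite_SigmaI) simp_all
  have P: "(i, j, k) \<in> P \<longleftrightarrow> i \<in> {1..?N} \<and> j \<in> {1..?N} \<and> k \<in> {1..A i j}" for i j k
    by (simp add: P_def)
  have rows: "card {y\<in>P. fst y \<le> i} = bnd n l i" if i: "i \<le> ?N" for i
  proof -
    have "{y\<in>P. fst y \<le> i} = (SIGMA i:{1..i}. SIGMA j:{1..?N}. {1..A i j})"
      unfolding P_def using i by auto
    then have "card {y\<in>P. fst y \<le> i} = (\<Sum>i\<in>{1..i}. \<Sum>j\<in>{1..?N}. A i j)" by simp
    also have "\<dots> = bnd n l i" unfolding bnd_def
      by (intro sum.cong refl) (use ro i in \<open>simp add: ro_def\<close>)
    finally show ?thesis .
  qed
  have cols: "card {y\<in>P. fst (snd y) \<le> j} = bnd n m j" if j: "j \<le> ?N" for j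
  proof -
    have "{y\<in>P. fst (snd y) \<le> j} = (SIGMA i:{1..?N}. SIGMA j:{1..j}. {1..A i j})"
      unfolding P_def using j by auto
    then have "card {y\<in>P. fst (snd y) \<le> j} = (\<Sum>i\<in>{1..?N}. \<Sum>j\<in>{1..j}. A i j)" by simp
    also have "\<dots> = (\<Sum>j\<in>{1..j}. \<Sum>i\<in>{1..?N}. A i j)" by (rule sum.swap)
    also have "\<dots> = bnd n m j" unfolding bnd_def
      by (intro sum.cong refl) (use co j in \<open>simp add: co_def\<close>)
    finally show ?thesis .
  qed
  have cardP: "card P = 2*r"
  proof -
    have "{y\<in>P. fst y \<le> ?N} = P" unfolding P_def by auto
    then show ?thesis using rows[of ?N] bnd_total[OF l] by simp
  qed
  have \<alpha>: "bij_betw \<alpha> P {1..2*r}"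
    using rank_bij[OF fin, of id] unfolding \<alpha>_def cardP by simp
  have ginj: "inj_on g P" by (auto simp: inj_on_def g_def prod_eq_iff)
  have \<beta>: "bij_betw \<beta> P {1..2*r}"
    using rank_bij[OF fin ginj] unfolding \<beta>_def cardP .
  have \<iota>: "\<iota> x \<in> P \<and> \<iota> (\<iota> x) = x" if "x \<in> P" for x
  proof -
    obtain i j k where x: "x = (i, j, k)" by (cases x)
    have ij: "i \<in> {1..?N}" "j \<in> {1..?N}" "k \<in> {1..A i j}" using that unfolding x P by blast+
    have m: "A (?N+1-i) (?N+1-j) = A i j" by (rule Xi_mirror[OF A ij(1,2)])
    have "?N+1-i \<in> {1..?N}" "?N+1-j \<in> {1..?N}" "A i j + 1 - k \<in> {1..A i j}"
      "?N+1-(?N+1-i) = i" "?N+1-(?N+1-j) = j" "A i j + 1 - (A i j + 1 - k) = k" using ij by auto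
    then show ?thesis unfolding x \<iota>_def fst_conv snd_conv P m by simp
  qed
  have rev: "\<iota> y < \<iota> x" if "x \<in> P" "y \<in> P" "x < y" for x y
  proof -
    obtain i j k i' j' k' where xy: "x = (i, j, k)" "y = (i', j', k')" by (cases x; cases y)
    have r: "i \<le> ?N" "j \<le> ?N" "k \<le> A i j" "i' \<le> ?N" "j' \<le> ?N" "k' \<le> A i' j'"
      using that(1,2) unfolding xy P by auto
    have "i < i' \<or> (i = i' \<and> (j < j' \<or> (j = j' \<and> k < k')))"
      using that(3) unfolding xy less_prod_simp by arith
    then consider "i < i'" | "i = i'" "j < j'" | "i = i'" "j = j'" "k < k'" by blast
    then show ?thesis
    proof cases
      case 1
      then have "?N+1-i' < ?N+1-i" using r by linarith
      then show ?thesis unfolding xy \<iota>_def fst_conv snd_conv less_prod_simp by simp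
    next
      case 2
      then have "?N+1-j' < ?N+1-j" using r by linarith
      then show ?thesis using 2 unfolding xy \<iota>_def fst_conv snd_conv less_prod_simp by simp
    next
      case 3
      then have "A i j + 1 - k' < A i j + 1 - k" using r by linarith
      then show ?thesis using 3 unfolding xy \<iota>_def fst_conv snd_conv less_prod_simp by simp
    qed
  qed
  have revg: "g (\<iota> y) < g (\<iota> x)" if "x \<in> P" "y \<in> P" "g x < g y" for x y
  proof -
    obtain i j k i' j' k' where xy: "x = (i, j, k)" "y = (i', j', k')" by (cases x; cases y)
    have r: "i \<le> ?N" "j \<le> ?N" "k \<le> A i j" "i' \<le> ?N" "j' \<le> ?N" "k' \<le> A i' j'"
      using that(1,2) unfolding xy P by auto
    have "j < j' \<or> (j = j' \<and> (i < i' \<or> (i = i' \<and> k < k')))"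
      using that(3) unfolding xy g_def fst_conv snd_conv less_prod_simp by arith
    then consider "j < j'" | "j = j'" "i < i'" | "i = i'" "j = j'" "k < k'" by blast
    then show ?thesis
    proof cases
      case 1
      then have "?N+1-j' < ?N+1-j" using r by linarith
      then show ?thesis unfolding xy \<iota>_def g_def fst_conv snd_conv less_prod_simp by simp
    next
      case 2
      then have "?N+1-i' < ?N+1-i" using r by linarith
      then show ?thesis using 2 unfolding xy \<iota>_def g_def fst_conv snd_conv less_prod_simp by simp
    next
      case 3
      then have "A i j + 1 - k' < A i j + 1 - k" using r by linarith
      then show ?thesis using 3 unfolding xy \<iota>_def g_def fst_conv snd_conv less_prod_simp by simp
    qed
  qed
  have \<alpha>_rev: "\<alpha> x + \<alpha> (\<iota> x) = 2*r + 1" if "x \<in> P" for x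
    unfolding \<alpha>_def cardP[symmetric]
    by (rule rank_reverse[where \<iota> = \<iota>, OF fin inj_on_id \<iota> _ that]) (simp_all only: id_apply rev)
  have \<beta>_rev: "\<beta> x + \<beta> (\<iota> x) = 2*r + 1" if "x \<in> P" for x
    unfolding \<beta>_def cardP[symmetric]
    by (rule rank_reverse[where \<iota> = \<iota>, OF fin ginj \<iota> revg that])
  have \<alpha>_in: "\<alpha> x \<in> {1..2*r}" and \<beta>_in: "\<beta> x \<in> {1..2*r}" if "x \<in> P" for x
    using bij_betwE[OF \<alpha>] bij_betwE[OF \<beta>] that by blast+
  have \<alpha>_col: "col n l (\<alpha> x) = fst x" if x: "x \<in> P" for x
  proof -
    have le: "col n l (\<alpha> x) \<le> i \<longleftrightarrow> fst x \<le> i" if "i \<le> ?N" for i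
    proof -
      have "card {y\<in>P. id y \<le> id x} \<le> card {y\<in>P. fst y \<le> i} \<longleftrightarrow> fst x \<le> i"
        by (rule rank_le_iff[OF fin x]) (auto simp: less_eq_prod_def)
      then show ?thesis using col_le[OF l, of "\<alpha> x" i] \<alpha>_in[OF x] unfolding rows[OF that] \<alpha>_def by simp
    qed
    have "fst x \<le> ?N" using x by (auto simp: P_def)
    moreover have "col n l (\<alpha> x) \<le> ?N" using col_range[OF l \<alpha>_in[OF x]] by simp
    ultimately show ?thesis using le[of "fst x"] le[of "col n l (\<alpha> x)"] by simp
  qed
  have \<beta>_col: "col n m (\<beta> x) = fst (snd x)" if x: "x \<in> P" for x
  proof -
    have le: "col n m (\<beta> x) \<le> i \<longleftrightarrow> fst (snd x) \<le> i" if "i \<le> ?N" for i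
    proof -
      have "card {y\<in>P. g y \<le> g x} \<le> card {y\<in>P. fst (snd y) \<le> i} \<longleftrightarrow> fst (snd x) \<le> i"
        by (rule rank_le_iff[OF fin x]) (auto simp: less_eq_prod_def g_def)
      then show ?thesis using col_le[OF m, of "\<beta> x" i] \<beta>_in[OF x] unfolding cols[OF that] \<beta>_def by simp
    qed
    have "fst (snd x) \<le> ?N" using x by (auto simp: P_def)
    moreover have "col n m (\<beta> x) \<le> ?N" using col_range[OF m \<beta>_in[OF x]] by simp
    ultimately show ?thesis using le[of "fst (snd x)"] le[of "col n m (\<beta> x)"] by simp
  qed
  \<comment> \<open>The place of a triple in the first listing is sent to its place in the second.
    Since \<iota> reverses both listings, v commutes with the mirror.\<close>
  define v where "v y = (if y \<in> {1..2*r} then \<beta> (inv_into P \<alpha> y) else y)" for y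
  have v\<alpha>: "v (\<alpha> x) = \<beta> x" if "x \<in> P" for x
    using \<alpha>_in[OF that] bij_betw_imp_inj_on[OF \<alpha>] that by (simp add: v_def)
  have vW: "v \<in> W"
  proof -
    have "bij_betw (\<beta> \<circ> inv_into P \<alpha>) {1..2*r} {1..2*r}"
      by (rule bij_betw_trans[OF bij_betw_inv_into[OF \<alpha>] \<beta>])
    then have "bij_betw v {1..2*r} {1..2*r}"
      by (rule bij_betw_cong[THEN iffD1, rotated]) (simp add: v_def)
    then have "v permutes {1..2*r}" by (rule bij_imp_permutes) (auto simp: v_def)
    moreover have "v y + v (2*r+1-y) = 2*r+1" if y: "y \<in> {1..2*r}" for y
    proof -
      have "y \<in> \<alpha> ` P" using \<alpha> y by (simp add: bij_betw_def)
      then obtain x where x: "x \<in> P" "y = \<alpha> x" by blast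
      have "2*r+1-y = \<alpha> (\<iota> x)" using \<alpha>_rev[OF x(1)] x(2) by simp
      then show ?thesis
        using v\<alpha>[OF x(1)] v\<alpha>[of "\<iota> x"] \<iota>[OF x(1)] \<beta>_rev[OF x(1)] x(2) by simp
    qed
    ultimately show ?thesis by (simp only: W_iff) blast
  qed
  have "cnt (col n l) (col n m) v i j = A i j" for i j
  proof -
    let ?S = "{x\<in>P. fst x = i \<and> fst (snd x) = j}"
    have "\<alpha> ` ?S = {y\<in>{1..2*r}. col n l y = i \<and> col n m (v y) = j}"
    proof (intro Set.set_eqI iffI)
      fix y assume "y \<in> \<alpha> ` ?S"
      then obtain x where x: "x \<in> P" "fst x = i" "fst (snd x) = j" "y = \<alpha> x" by blast
      show "y \<in> {y\<in>{1..2*r}. col n l y = i \<and> col n m (v y) = j}"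
        unfolding x(4) mem_Collect_eq v\<alpha>[OF x(1)] \<alpha>_col[OF x(1)] \<beta>_col[OF x(1)]
        using \<alpha>_in[OF x(1)] x(2,3) by blast
    next
      fix y assume y: "y \<in> {y\<in>{1..2*r}. col n l y = i \<and> col n m (v y) = j}"
      then have "y \<in> {1..2*r}" by blast
      then have "y \<in> \<alpha> ` P" using \<alpha> by (simp add: bij_betw_def)
      then obtain x where x: "x \<in> P" "y = \<alpha> x" by blast
      have "fst x = i" "fst (snd x) = j"
        using y v\<alpha>[OF x(1)] \<alpha>_col[OF x(1)] \<beta>_col[OF x(1)] unfolding x(2) by simp_all
      then show "y \<in> \<alpha> ` ?S" using x by blast
    qed
    moreover have "bij_betw \<alpha> ?S (\<alpha> ` ?S)"
      by (intro inj_on_imp_bij_betw inj_on_subset[OF bij_betw_imp_inj_on[OF \<alpha>]]) blast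
    ultimately have "bij_betw \<alpha> ?S {y\<in>{1..2*r}. col n l y = i \<and> col n m (v y) = j}" by simp
    then have "cnt (col n l) (col n m) v i j = card {x\<in>P. fst x = i \<and> fst (snd x) = j}"
      unfolding cnt_def by (rule bij_betw_same_card[symmetric])
    also have "\<dots> = A i j"
    proof (cases "i \<in> {1..?N} \<and> j \<in> {1..?N}")
      case True
      then have "{x\<in>P. fst x = i \<and> fst (snd x) = j} = {i} \<times> {j} \<times> {1..A i j}"
        unfolding P_def by auto
      then show ?thesis by simp
    next
      case False
      then have "{x\<in>P. fst x = i \<and> fst (snd x) = j} = {}" unfolding P_def by auto
      moreover have "A i j = 0" using A False unfolding Xi_def by blast
      ultimately show ?thesis by (simp only: card.empty)
    qed
    finally show ?thesis .
  qed
  then show ?thesis using vW by (intro bexI[of _ v] ext)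
qed


section \<open>The Hecke algebra as a quotient ring\<close>

abbreviation H where "H \<equiv> hecke r"

definition proj :: "free_elem \<Rightarrow> hecke_elem" where
  "proj f = hecke_ideal r +>\<^bsub>free_algebra r\<^esub> f"

sublocale HR: ring "hecke r"
  unfolding hecke_def by (rule HI.quotient_is_ring)

lemma proj_hom: "proj \<in> ring_hom (free_algebra r) H"
proof -
  have "proj = (+>\<^bsub>free_algebra r\<^esub>) (hecke_ideal r)" by (intro ext) (simp add: proj_def)
  then show ?thesis unfolding hecke_def using HI.rcos_ring_hom by simp
qed

lemma proj_closed [simp]: "f \<in> FA \<Longrightarrow> proj f \<in> carrier H"
  by (rule ring_hom_closed[OF proj_hom])

lemma proj_mult: "f \<in> FA \<Longrightarrow> g \<in> FA \<Longrightarrow> proj (f * g) = proj f \<otimes>\<^bsub>H\<^esub> proj g"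
  using ring_hom_mult[OF proj_hom, of f g] by (simp only: FA_ops)

lemma proj_add: "f \<in> FA \<Longrightarrow> g \<in> FA \<Longrightarrow> proj (f + g) = proj f \<oplus>\<^bsub>H\<^esub> proj g"
  using ring_hom_add[OF proj_hom, of f g] by (simp only: FA_ops)

lemma proj_one: "proj 1 = \<one>\<^bsub>H\<^esub>"
  using ring_hom_one[OF proj_hom] by (simp only: FA_ops)

lemma proj_zero: "proj 0 = \<zero>\<^bsub>H\<^esub>"
  using ring_hom_zero[OF proj_hom ring_free_algebra HR.ring_axioms] by (simp only: FA_ops)

lemma hecke_elem_proj:
  assumes "h \<in> carrier H"
  obtains f where "f \<in> FA" "h = proj f"
proof -
  have "h \<in> (\<Union>f\<in>FA. {hecke_ideal r +>\<^bsub>free_algebra r\<^esub> f})"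
    using assms unfolding hecke_def FactRing_def A_RCOSETS_def' by simp
  then show ?thesis using that unfolding proj_def by blast
qed

lemma proj_heq: "f \<doteq> g \<Longrightarrow> proj f = proj g"
proof -
  assume a: "f \<doteq> g"
  then have fg: "f \<in> FA" "g \<in> FA" "f - g \<in> hecke_ideal r" by (simp_all add: heq_def)
  have "f \<ominus>\<^bsub>free_algebra r\<^esub> g = f - g"
    using FA_a_inv[OF fg(2)] by (simp add: a_minus_def FA_ops)
  then show ?thesis
    using FR.quotient_eq_iff_same_a_r_cos[OF HI.ideal_axioms fg(1,2)] fg(3) by (simp add: proj_def)
qed

lemma hecke_const_proj: "hecke_const r c = proj (const c)"
  by (simp add: hecke_const_def proj_def)

lemma hecke_const_closed [simp]: "hecke_const r c \<in> carrier H"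
  by (simp add: hecke_const_proj)

lemma hecke_const_central: "h \<in> carrier H \<Longrightarrow> h \<otimes>\<^bsub>H\<^esub> hecke_const r c = hecke_const r c \<otimes>\<^bsub>H\<^esub> h"
proof -
  assume "h \<in> carrier H"
  then obtain f where f: "f \<in> FA" "h = proj f" by (rule hecke_elem_proj)
  show ?thesis unfolding f(2) hecke_const_proj
    using proj_mult[OF f(1) FA_const[of c]] proj_mult[OF FA_const[of c] f(1)] const_central[of c f] by simp
qed

lemma hecke_Tw_proj: "w \<in> W \<Longrightarrow> hecke_Tw r w = proj (Tw w)"
proof -
  have "foldr (\<lambda>i t. hecke_T r i \<otimes>\<^bsub>H\<^esub> t) xs \<one>\<^bsub>H\<^esub> = proj (gens xs)" if "set xs \<subseteq> {1..r}" for xs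
    using that
  proof (induction xs)
    case Nil
    then show ?case by (simp add: gens_simps proj_one)
  next
    case (Cons x xs)
    then have "x \<in> {1..r}" "set xs \<subseteq> {1..r}" by simp_all
    then have "proj (gen x * gens xs) = proj (gen x) \<otimes>\<^bsub>H\<^esub> proj (gens xs)"
      by (intro proj_mult FA_gen gens_FA)
    then show ?case using Cons by (simp add: gens_simps hecke_T_def proj_def)
  qed
  then show "w \<in> W \<Longrightarrow> hecke_Tw r w = proj (Tw w)"
    unfolding hecke_Tw_def Tw_def using reduced_word(1) by blast
qed

lemma Tsum_proj: "D \<subseteq> W \<Longrightarrow> Tsum r D = proj (tsum D)"
proof -
  assume D: "D \<subseteq> W"
  then have "finite D" using finite_W by (rule finite_subset)
  then show ?thesis using D unfolding Tsum_def
  proof (induction D rule: finite_induct)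
    case empty
    show ?case by (simp add: tsum_def proj_zero)
  next
    case (insert w D)
    have w: "w \<in> W" and D: "D \<subseteq> W" using insert.prems by simp_all
    have "(\<Oplus>\<^bsub>H\<^esub>w\<in>insert w D. hecke_Tw r w) = hecke_Tw r w \<oplus>\<^bsub>H\<^esub> (\<Oplus>\<^bsub>H\<^esub>w\<in>D. hecke_Tw r w)"
      using insert.hyps w D by (intro HR.finsum_insert) (auto simp: hecke_Tw_proj)
    also have "\<dots> = proj (Tw w + tsum D)"
      unfolding insert.IH[OF D] hecke_Tw_proj[OF w] using w D by (intro proj_add[symmetric]) simp_all
    also have "Tw w + tsum D = tsum (insert w D)" unfolding tsum_def using insert.hyps by simp
    finally show ?case .
  qed
qed

text \<open>With finitely many summands the direct sum has no support condition, see
  \<open>M_carrier\<close>.\<close>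

lemma finite_Comp: "finite (Comp k m)"
proof -
  have "Comp k m \<subseteq> {f. \<forall>x. (x \<in> {1..k} \<longrightarrow> f x \<in> {0..m}) \<and> (x \<notin> {1..k} \<longrightarrow> f x = 0)}"
  proof (intro subsetI CollectI allI conjI impI)
    fix f x assume f: "f \<in> Comp k m"
    then show "x \<notin> {1..k} \<Longrightarrow> f x = 0" unfolding Comp_def by blast
    show "f x \<in> {0..m}" if "x \<in> {1..k}"
      using f member_le_sum[of x "{1..k}" f] that unfolding Comp_def by simp
  qed
  then show ?thesis by (rule finite_subset) (intro finite_set_of_finite_funs; simp)
qed

section \<open>Endomorphisms given by elements of the Hecke algebra\<close>

context
  fixes n :: nat
  assumes n: "1 \<le> n"
begin

abbreviation Cs where "Cs \<equiv> Comp (n+1) r"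
abbreviation M where "M \<equiv> tensor_module n r"
abbreviation S where "S \<equiv> schur n r"

lemma x_elem_proj: "l \<in> Cs \<Longrightarrow> x_elem n r l = proj (tsum (stab (col n l)))"
  unfolding x_elem_def using parabolic_eq[OF _ n] by (simp add: Tsum_proj stab_def)

lemma x_elem_closed [simp]: "l \<in> Cs \<Longrightarrow> x_elem n r l \<in> carrier H"
  by (simp add: x_elem_proj stab_def)

lemma x_module_sub: "l \<in> Cs \<Longrightarrow> y \<in> carrier (x_module n r l) \<Longrightarrow> y \<in> carrier H"
  by (auto simp: x_module_def)

lemma x_moduleI: "h \<in> carrier H \<Longrightarrow> x_elem n r l \<otimes>\<^bsub>H\<^esub> h \<in> carrier (x_module n r l)"
  by (auto simp: x_module_def)

lemma x_moduleE:
  assumes "y \<in> carrier (x_module n r l)"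
  obtains h where "h \<in> carrier H" "y = x_elem n r l \<otimes>\<^bsub>H\<^esub> h"
  using assms by (auto simp: x_module_def)

lemma x_module_ops [simp]:
  "y \<otimes>\<^bsub>x_module n r l\<^esub> z = y \<oplus>\<^bsub>H\<^esub> z" "\<one>\<^bsub>x_module n r l\<^esub> = \<zero>\<^bsub>H\<^esub>"
  by (simp_all add: x_module_def)

lemma x_module_zero: "l \<in> Cs \<Longrightarrow> \<zero>\<^bsub>H\<^esub> \<in> carrier (x_module n r l)"
  using x_moduleI[OF HR.zero_closed, of l] by simp

lemma x_module_add:
  assumes "l \<in> Cs" "y \<in> carrier (x_module n r l)" "z \<in> carrier (x_module n r l)"
  shows "y \<oplus>\<^bsub>H\<^esub> z \<in> carrier (x_module n r l)"
proof -
  obtain h g where hg: "h \<in> carrier H" "y = x_elem n r l \<otimes>\<^bsub>H\<^esub> h"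
    "g \<in> carrier H" "z = x_elem n r l \<otimes>\<^bsub>H\<^esub> g"
    using assms by (elim x_moduleE) blast
  have "y \<oplus>\<^bsub>H\<^esub> z = x_elem n r l \<otimes>\<^bsub>H\<^esub> (h \<oplus>\<^bsub>H\<^esub> g)"
    unfolding hg(2,4) using hg assms(1) by (simp add: HR.r_distr)
  then show ?thesis using x_moduleI[of "h \<oplus>\<^bsub>H\<^esub> g" l] hg by simp
qed

lemma x_module_act:
  assumes "l \<in> Cs" "y \<in> carrier (x_module n r l)" "g \<in> carrier H"
  shows "y \<otimes>\<^bsub>H\<^esub> g \<in> carrier (x_module n r l)"
proof -
  obtain h where h: "h \<in> carrier H" "y = x_elem n r l \<otimes>\<^bsub>H\<^esub> h" using assms(2) by (rule x_moduleE)
  have "y \<otimes>\<^bsub>H\<^esub> g = x_elem n r l \<otimes>\<^bsub>H\<^esub> (h \<otimes>\<^bsub>H\<^esub> g)"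
    unfolding h(2) using h assms by (simp add: HR.m_assoc)
  then show ?thesis using x_moduleI[of "h \<otimes>\<^bsub>H\<^esub> g" l] h assms by simp
qed

lemma x_module_group: "l \<in> Cs \<Longrightarrow> group (x_module n r l)"
proof (rule groupI)
  fix y assume l: "l \<in> Cs" and y: "y \<in> carrier (x_module n r l)"
  obtain h where h: "h \<in> carrier H" "y = x_elem n r l \<otimes>\<^bsub>H\<^esub> h" using y by (rule x_moduleE)
  have "x_elem n r l \<otimes>\<^bsub>H\<^esub> (\<ominus>\<^bsub>H\<^esub> h) \<oplus>\<^bsub>H\<^esub> y = \<zero>\<^bsub>H\<^esub>"
    unfolding h(2) using h l by (simp add: HR.r_minus HR.l_neg)
  then show "\<exists>z\<in>carrier (x_module n r l). z \<otimes>\<^bsub>x_module n r l\<^esub> y = \<one>\<^bsub>x_module n r l\<^esub>"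
    using x_moduleI[of "\<ominus>\<^bsub>H\<^esub> h" l] h by (intro bexI[of _ "x_elem n r l \<otimes>\<^bsub>H\<^esub> (\<ominus>\<^bsub>H\<^esub> h)"]) simp_all
qed (simp_all add: x_module_add x_module_zero x_module_sub HR.a_assoc)

lemma M_carrier: "v \<in> carrier M \<longleftrightarrow> v \<in> (\<Pi>\<^sub>E l\<in>Cs. carrier (x_module n r l))"
  unfolding tensor_module_def
  using carrier_sum_group[of Cs "x_module n r", OF x_module_group] finite_Comp[of "n+1" r] by simp

lemma M_ops: "v \<otimes>\<^bsub>M\<^esub> w = (\<lambda>l\<in>Cs. v l \<oplus>\<^bsub>H\<^esub> w l)" "\<one>\<^bsub>M\<^esub> = (\<lambda>l\<in>Cs. \<zero>\<^bsub>H\<^esub>)"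
  by (simp_all add: tensor_module_def)

lemma M_group: "group M"
  unfolding tensor_module_def by (rule sum_group[OF x_module_group])

lemma M_at: "v \<in> carrier M \<Longrightarrow> l \<in> Cs \<Longrightarrow> v l \<in> carrier (x_module n r l)"
  unfolding M_carrier by (drule PiE_mem) simp_all

lemma M_atH [simp]: "v \<in> carrier M \<Longrightarrow> l \<in> Cs \<Longrightarrow> v l \<in> carrier H"
  by (rule x_module_sub[OF _ M_at])

lemma M_eqI: "v \<in> carrier M \<Longrightarrow> w \<in> carrier M \<Longrightarrow> (\<And>l. l \<in> Cs \<Longrightarrow> v l = w l) \<Longrightarrow> v = w"
  unfolding M_carrier by (rule PiE_ext)

lemma M_comm: "v \<in> carrier M \<Longrightarrow> w \<in> carrier M \<Longrightarrow> v \<otimes>\<^bsub>M\<^esub> w = w \<otimes>\<^bsub>M\<^esub> v"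
  unfolding M_ops by (rule restrict_ext) (simp add: HR.a_comm)

lemma M_comm_group: "comm_group M"
  by (rule group.group_comm_groupI[OF M_group M_comm])

lemma M_closed: "v \<in> carrier M \<Longrightarrow> w \<in> carrier M \<Longrightarrow> v \<otimes>\<^bsub>M\<^esub> w \<in> carrier M" "\<one>\<^bsub>M\<^esub> \<in> carrier M"
  using M_group by (simp_all add: group.is_monoid monoid.m_closed)

lemma right_act_closed: "v \<in> carrier M \<Longrightarrow> h \<in> carrier H \<Longrightarrow> right_act n r v h \<in> carrier M"
  unfolding M_carrier right_act_def using x_module_act by (intro restrict_PiE_iff[THEN iffD2] ballI) (auto elim: PiE_mem)

lemma right_act_mult: "v \<in> carrier M \<Longrightarrow> w \<in> carrier M \<Longrightarrow> h \<in> carrier H \<Longrightarrow>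
  right_act n r (v \<otimes>\<^bsub>M\<^esub> w) h = right_act n r v h \<otimes>\<^bsub>M\<^esub> right_act n r w h"
  unfolding M_ops right_act_def by (rule restrict_ext) (simp add: HR.l_distr)

lemma right_act_assoc: "v \<in> carrier M \<Longrightarrow> h \<in> carrier H \<Longrightarrow> g \<in> carrier H \<Longrightarrow>
  right_act n r (right_act n r v h) g = right_act n r v (h \<otimes>\<^bsub>H\<^esub> g)"
  unfolding right_act_def by (rule restrict_ext) (simp add: HR.m_assoc)

lemma right_act_one: "h \<in> carrier H \<Longrightarrow> right_act n r \<one>\<^bsub>M\<^esub> h = \<one>\<^bsub>M\<^esub>"
  unfolding M_ops right_act_def by (rule restrict_ext) simp

lemma incl_closed: "k \<in> Cs \<Longrightarrow> y \<in> carrier (x_module n r k) \<Longrightarrow> incl n r k y \<in> carrier M"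
  unfolding M_carrier incl_def by (auto simp: x_module_zero)

lemma incl_add: "incl n r k (y \<oplus>\<^bsub>H\<^esub> z) = incl n r k y \<otimes>\<^bsub>M\<^esub> incl n r k z"
  unfolding M_ops incl_def by (rule restrict_ext) simp

lemma incl_act: "k \<in> Cs \<Longrightarrow> h \<in> carrier H \<Longrightarrow> y \<in> carrier H \<Longrightarrow>
  right_act n r (incl n r k y) h = incl n r k (y \<otimes>\<^bsub>H\<^esub> h)"
  unfolding right_act_def incl_def by (rule restrict_ext) simp

lemma incl_zero: "incl n r k \<zero>\<^bsub>H\<^esub> = \<one>\<^bsub>M\<^esub>"
  unfolding M_ops incl_def by (rule restrict_ext) simp

lemma S_carrier: "f \<in> carrier S \<longleftrightarrow> f \<in> carrier M \<rightarrow> carrier M \<and>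
    (\<forall>v\<in>carrier M. \<forall>w\<in>carrier M. f (v \<otimes>\<^bsub>M\<^esub> w) = f v \<otimes>\<^bsub>M\<^esub> f w) \<and> f \<in> extensional (carrier M) \<and>
    (\<forall>v\<in>carrier M. \<forall>h\<in>carrier H. f (right_act n r v h) = right_act n r (f v) h)"
  by (auto simp: schur_def Let_def hom_def)

lemma S_carrierD:
  assumes "f \<in> carrier S"
  shows "v \<in> carrier M \<Longrightarrow> f v \<in> carrier M"
    "v \<in> carrier M \<Longrightarrow> w \<in> carrier M \<Longrightarrow> f (v \<otimes>\<^bsub>M\<^esub> w) = f v \<otimes>\<^bsub>M\<^esub> f w"
    "f \<in> extensional (carrier M)"
    "v \<in> carrier M \<Longrightarrow> h \<in> carrier H \<Longrightarrow> f (right_act n r v h) = right_act n r (f v) h"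
  using assms unfolding S_carrier by blast+

lemma S_carrierI:
  assumes "\<And>v. v \<in> carrier M \<Longrightarrow> f v \<in> carrier M"
    "\<And>v w. v \<in> carrier M \<Longrightarrow> w \<in> carrier M \<Longrightarrow> f (v \<otimes>\<^bsub>M\<^esub> w) = f v \<otimes>\<^bsub>M\<^esub> f w"
    "\<And>v h. v \<in> carrier M \<Longrightarrow> h \<in> carrier H \<Longrightarrow> f (right_act n r v h) = right_act n r (f v) h"
  shows "(\<lambda>v\<in>carrier M. f v) \<in> carrier S"
  unfolding S_carrier using assms by (simp add: M_closed right_act_closed Pi_iff)

lemma S_ops:
  "f \<oplus>\<^bsub>S\<^esub> g = (\<lambda>v\<in>carrier M. f v \<otimes>\<^bsub>M\<^esub> g v)" "\<zero>\<^bsub>S\<^esub> = (\<lambda>v\<in>carrier M. \<one>\<^bsub>M\<^esub>)"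
  "f \<otimes>\<^bsub>S\<^esub> g = compose (carrier M) f g"
  "c \<odot>\<^bsub>S\<^esub> f = (\<lambda>v\<in>carrier M. right_act n r (f v) (hecke_const r c))"
  by (simp_all add: schur_def Let_def)

lemma M_four: "a \<in> carrier M \<Longrightarrow> b \<in> carrier M \<Longrightarrow> c \<in> carrier M \<Longrightarrow> d \<in> carrier M \<Longrightarrow>
  (a \<otimes>\<^bsub>M\<^esub> b) \<otimes>\<^bsub>M\<^esub> (c \<otimes>\<^bsub>M\<^esub> d) = (a \<otimes>\<^bsub>M\<^esub> c) \<otimes>\<^bsub>M\<^esub> (b \<otimes>\<^bsub>M\<^esub> d)"
proof -
  interpret MM: comm_group M by (rule M_comm_group)
  assume "a \<in> carrier M" "b \<in> carrier M" "c \<in> carrier M" "d \<in> carrier M"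
  then show ?thesis by (simp add: MM.m_ac)
qed

lemma S_add_closed: "f \<in> carrier S \<Longrightarrow> g \<in> carrier S \<Longrightarrow> f \<oplus>\<^bsub>S\<^esub> g \<in> carrier S"
  unfolding S_ops
  by (rule S_carrierI) (simp_all add: S_carrierD M_closed M_four right_act_mult)

lemma S_zero_closed: "\<zero>\<^bsub>S\<^esub> \<in> carrier S"
  unfolding S_ops by (rule S_carrierI) (simp_all add: M_closed right_act_one group.is_monoid[OF M_group] monoid.l_one)

lemma S_smult_closed: "f \<in> carrier S \<Longrightarrow> c \<odot>\<^bsub>S\<^esub> f \<in> carrier S"
  unfolding S_ops
  by (rule S_carrierI)
    (simp_all add: S_carrierD M_closed right_act_closed right_act_mult right_act_assoc hecke_const_central)

lemma S_mult_closed: "f \<in> carrier S \<Longrightarrow> g \<in> carrier S \<Longrightarrow> f \<otimes>\<^bsub>S\<^esub> g \<in> carrier S"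
  unfolding S_ops compose_def by (rule S_carrierI) (simp_all add: S_carrierD)

lemma S_abelian_monoid: "abelian_monoid S"
proof (rule abelian_monoidI)
  interpret MM: comm_group M by (rule M_comm_group)
  show "\<zero>\<^bsub>S\<^esub> \<in> carrier S" by (rule S_zero_closed)
  fix f g h assume fg: "f \<in> carrier S" "g \<in> carrier S"
  show "f \<oplus>\<^bsub>S\<^esub> g \<in> carrier S" by (rule S_add_closed[OF fg])
  show "f \<oplus>\<^bsub>S\<^esub> g = g \<oplus>\<^bsub>S\<^esub> f"
    unfolding S_ops by (rule restrict_ext) (simp add: S_carrierD fg M_comm)
  show "\<zero>\<^bsub>S\<^esub> \<oplus>\<^bsub>S\<^esub> f = f"
    unfolding S_ops using S_carrierD(3)[OF fg(1)]
    by (intro extensionalityI[of _ "carrier M"]) (simp_all add: S_carrierD(1)[OF fg(1)])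
  assume h: "h \<in> carrier S"
  show "f \<oplus>\<^bsub>S\<^esub> g \<oplus>\<^bsub>S\<^esub> h = f \<oplus>\<^bsub>S\<^esub> (g \<oplus>\<^bsub>S\<^esub> h)"
    unfolding S_ops by (rule restrict_ext) (simp add: S_carrierD fg h MM.m_assoc)
qed

text \<open>The property that singles out e_A in \<open>e_elem\<close>, with t in place of the
  double coset sum. Sums, multiples and products of such maps are then computed on the elements
  t.\<close>

definition rep :: "(nat \<Rightarrow> nat) \<Rightarrow> (nat \<Rightarrow> nat) \<Rightarrow> hecke_elem \<Rightarrow> schur_elem \<Rightarrow> bool" where
  "rep l m t f \<longleftrightarrow> f \<in> carrier S \<and> (\<forall>k\<in>Cs. \<forall>h\<in>carrier H.
     f (incl n r k (x_elem n r k \<otimes>\<^bsub>H\<^esub> h)) = (if m = k then incl n r l (t \<otimes>\<^bsub>H\<^esub> h) else \<one>\<^bsub>M\<^esub>))"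

lemma repD:
  assumes "rep l m t f"
  shows "f \<in> carrier S"
    "m \<in> Cs \<Longrightarrow> h \<in> carrier H \<Longrightarrow> f (incl n r m (x_elem n r m \<otimes>\<^bsub>H\<^esub> h)) = incl n r l (t \<otimes>\<^bsub>H\<^esub> h)"
    "k \<in> Cs \<Longrightarrow> m \<noteq> k \<Longrightarrow> h \<in> carrier H \<Longrightarrow> f (incl n r k (x_elem n r k \<otimes>\<^bsub>H\<^esub> h)) = \<one>\<^bsub>M\<^esub>"
  using assms unfolding rep_def by auto

text \<open>An element of the direct sum is the finite sum of its components, each included from one
  summand.\<close>

lemma S_eqI:
  assumes f: "f \<in> carrier S" and g: "g \<in> carrier S"
    and eq: "\<And>k h. k \<in> Cs \<Longrightarrow> h \<in> carrier H \<Longrightarrow>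
      f (incl n r k (x_elem n r k \<otimes>\<^bsub>H\<^esub> h)) = g (incl n r k (x_elem n r k \<otimes>\<^bsub>H\<^esub> h))"
  shows "f = g"
proof (rule extensionalityI[OF S_carrierD(3)[OF f] S_carrierD(3)[OF g]])
  interpret MM: comm_group M by (rule M_comm_group)
  fix v assume v: "v \<in> carrier M"
  define part where "part K = (\<lambda>l\<in>Cs. if l \<in> K then v l else \<zero>\<^bsub>H\<^esub>)" for K
  have part: "part K \<in> carrier M" for K
    unfolding M_carrier part_def using M_at[OF v] by (auto simp: x_module_zero)
  have inc: "f (incl n r k (v k)) = g (incl n r k (v k))" "incl n r k (v k) \<in> carrier M" if "k \<in> Cs" for k
    using M_at[OF v that] eq[OF that] incl_closed[OF that] by (auto elim: x_moduleE)
  have one: "f \<one>\<^bsub>M\<^esub> = \<one>\<^bsub>M\<^esub>" if "f \<in> carrier S" for f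
  proof -
    have "f \<one>\<^bsub>M\<^esub> \<otimes>\<^bsub>M\<^esub> f \<one>\<^bsub>M\<^esub> = f \<one>\<^bsub>M\<^esub>"
      using S_carrierD(2)[OF that MM.one_closed MM.one_closed] by simp
    then show ?thesis using S_carrierD(1)[OF that MM.one_closed] by simp
  qed
  have "f (part K) = g (part K)" if "finite K" "K \<subseteq> Cs" for K
    using that
  proof (induction K rule: finite_induct)
    case empty
    have "part {} = \<one>\<^bsub>M\<^esub>" unfolding part_def M_ops by (rule restrict_ext) simp
    then show ?case using one[OF f] one[OF g] by simp
  next
    case (insert k K)
    then have k: "k \<in> Cs" by simp
    have "part (insert k K) = incl n r k (v k) \<otimes>\<^bsub>M\<^esub> part K"
      unfolding part_def M_ops incl_def
      by (rule restrict_ext) (use insert.hyps v in \<open>auto\<close>)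
    then show ?case
      using S_carrierD(2)[OF f inc(2)[OF k] part] S_carrierD(2)[OF g inc(2)[OF k] part] inc(1)[OF k]
        insert.IH insert.prems by simp
  qed
  moreover have "part Cs = v"
    by (rule M_eqI[OF part v]) (simp add: part_def)
  ultimately show "f v = g v" using finite_Comp[of "n+1" r] by force
qed

lemma rep_unique: "rep l m t f \<Longrightarrow> rep l m t g \<Longrightarrow> f = g"
  unfolding rep_def by (intro S_eqI) simp_all

text \<open>The map is left multiplication by y, so it does not depend on how an argument is written
  as x_m h; the factorisation through z puts its image into the summand of l.\<close>

lemma rep_exists:
  assumes l: "l \<in> Cs" and m: "m \<in> Cs" and y: "y \<in> carrier H" and z: "z \<in> carrier H"
    and t: "t = y \<otimes>\<^bsub>H\<^esub> x_elem n r m" "t = x_elem n r l \<otimes>\<^bsub>H\<^esub> z"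
  shows "\<exists>f. rep l m t f"
proof -
  define f where "f v = incl n r l (y \<otimes>\<^bsub>H\<^esub> v m)" for v
  have mem: "y \<otimes>\<^bsub>H\<^esub> v m \<in> carrier (x_module n r l)" if v: "v \<in> carrier M" for v
  proof -
    obtain h where h: "h \<in> carrier H" "v m = x_elem n r m \<otimes>\<^bsub>H\<^esub> h" using M_at[OF v m] by (rule x_moduleE)
    have "y \<otimes>\<^bsub>H\<^esub> v m = t \<otimes>\<^bsub>H\<^esub> h" unfolding h(2) t(1) using h(1) y m by (simp add: HR.m_assoc)
    also have "\<dots> = x_elem n r l \<otimes>\<^bsub>H\<^esub> (z \<otimes>\<^bsub>H\<^esub> h)" unfolding t(2) using h(1) z l by (simp add: HR.m_assoc)
    finally show ?thesis using x_moduleI[of "z \<otimes>\<^bsub>H\<^esub> h" l] h(1) z by simp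
  qed
  have "(\<lambda>v\<in>carrier M. f v) \<in> carrier S"
  proof (rule S_carrierI)
    fix v assume v: "v \<in> carrier M"
    show "f v \<in> carrier M" unfolding f_def by (rule incl_closed[OF l mem[OF v]])
    show "f (v \<otimes>\<^bsub>M\<^esub> w) = f v \<otimes>\<^bsub>M\<^esub> f w" if w: "w \<in> carrier M" for w
      unfolding f_def incl_add[symmetric] using v w m y by (simp add: M_ops HR.r_distr)
    show "f (right_act n r v h) = right_act n r (f v) h" if h: "h \<in> carrier H" for h
      using v m y h l by (simp add: f_def right_act_def[of _ _ v] incl_act HR.m_assoc)
  qed
  moreover have "(\<lambda>v\<in>carrier M. f v) (incl n r k (x_elem n r k \<otimes>\<^bsub>H\<^esub> h)) =
      (if m = k then incl n r l (t \<otimes>\<^bsub>H\<^esub> h) else \<one>\<^bsub>M\<^esub>)"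
    if k: "k \<in> Cs" and h: "h \<in> carrier H" for k h
  proof -
    have "(\<lambda>v\<in>carrier M. f v) (incl n r k (x_elem n r k \<otimes>\<^bsub>H\<^esub> h)) = f (incl n r k (x_elem n r k \<otimes>\<^bsub>H\<^esub> h))"
      using incl_closed[OF k x_moduleI[OF h]] by simp
    also have "\<dots> = incl n r l (y \<otimes>\<^bsub>H\<^esub> (if m = k then x_elem n r k \<otimes>\<^bsub>H\<^esub> h else \<zero>\<^bsub>H\<^esub>))"
      using m by (simp add: f_def incl_def[of _ _ k])
    also have "\<dots> = (if m = k then incl n r l (t \<otimes>\<^bsub>H\<^esub> h) else \<one>\<^bsub>M\<^esub>)"
    proof (cases "m = k")
      case True
      then show ?thesis unfolding t(1) using y h k by (simp add: HR.m_assoc)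
    qed (use y in \<open>simp add: incl_zero\<close>)
    finally show ?thesis .
  qed
  ultimately show ?thesis unfolding rep_def by blast
qed

lemma rep_zero: "l \<in> Cs \<Longrightarrow> m \<in> Cs \<Longrightarrow> rep l m \<zero>\<^bsub>H\<^esub> \<zero>\<^bsub>S\<^esub>"
  unfolding rep_def using S_zero_closed
  by (simp add: S_ops incl_closed x_moduleI incl_zero)

lemma rep_add:
  assumes "l \<in> Cs" "m \<in> Cs" "t \<in> carrier H" "t' \<in> carrier H" "rep l m t f" "rep l m t' g"
  shows "rep l m (t \<oplus>\<^bsub>H\<^esub> t') (f \<oplus>\<^bsub>S\<^esub> g)"
proof -
  interpret MM: comm_group M by (rule M_comm_group)
  have "f \<oplus>\<^bsub>S\<^esub> g \<in> carrier S" using assms(5,6) by (intro S_add_closed repD(1))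
  then show ?thesis
    using assms unfolding rep_def S_ops
    by (simp add: incl_closed x_moduleI incl_add[symmetric] HR.l_distr)
qed

lemma rep_smult:
  assumes "l \<in> Cs" "m \<in> Cs" "t \<in> carrier H" "rep l m t f"
  shows "rep l m (hecke_const r c \<otimes>\<^bsub>H\<^esub> t) (c \<odot>\<^bsub>S\<^esub> f)"
proof -
  have "c \<odot>\<^bsub>S\<^esub> f \<in> carrier S" using assms(4) by (intro S_smult_closed repD(1))
  moreover have "t \<otimes>\<^bsub>H\<^esub> h \<otimes>\<^bsub>H\<^esub> hecke_const r c = hecke_const r c \<otimes>\<^bsub>H\<^esub> t \<otimes>\<^bsub>H\<^esub> h" if "h \<in> carrier H" for h
    using that assms(3) hecke_const_central[of "t \<otimes>\<^bsub>H\<^esub> h" c] by (simp add: HR.m_assoc)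
  ultimately show ?thesis
    using assms unfolding rep_def S_ops
    by (simp add: incl_closed x_moduleI incl_act right_act_one)
qed

text \<open>The first map sends x_m h to x_l z h, on which f acts through the element z h.\<close>

lemma rep_mult:
  assumes "k \<in> Cs" "l \<in> Cs" "m \<in> Cs" "z \<in> carrier H" "t' \<in> carrier H"
    and g: "rep l m (x_elem n r l \<otimes>\<^bsub>H\<^esub> z) g" and f: "rep k l t' f"
  shows "rep k m (t' \<otimes>\<^bsub>H\<^esub> z) (f \<otimes>\<^bsub>S\<^esub> g)"
  unfolding rep_def
proof (intro conjI ballI)
  interpret MM: comm_group M by (rule M_comm_group)
  show "f \<otimes>\<^bsub>S\<^esub> g \<in> carrier S" using repD(1)[OF f] repD(1)[OF g] by (rule S_mult_closed)
  fix j h assume j: "j \<in> Cs" and h: "h \<in> carrier H"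
  have "(f \<otimes>\<^bsub>S\<^esub> g) (incl n r j (x_elem n r j \<otimes>\<^bsub>H\<^esub> h)) = f (g (incl n r j (x_elem n r j \<otimes>\<^bsub>H\<^esub> h)))"
    unfolding S_ops using j h by (simp add: compose_eq incl_closed x_moduleI)
  also have "\<dots> = (if m = j then incl n r k (t' \<otimes>\<^bsub>H\<^esub> z \<otimes>\<^bsub>H\<^esub> h) else \<one>\<^bsub>M\<^esub>)"
  proof (cases "m = j")
    case True
    have "g (incl n r j (x_elem n r j \<otimes>\<^bsub>H\<^esub> h)) = incl n r l (x_elem n r l \<otimes>\<^bsub>H\<^esub> (z \<otimes>\<^bsub>H\<^esub> h))"
      using repD(2)[OF g j[folded True] h] assms(2,4) h True by (simp add: HR.m_assoc)
    then show ?thesis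
      using repD(2)[OF f assms(2), of "z \<otimes>\<^bsub>H\<^esub> h"] True assms h by (simp add: HR.m_assoc)
  next
    case False
    have "f \<one>\<^bsub>M\<^esub> \<otimes>\<^bsub>M\<^esub> f \<one>\<^bsub>M\<^esub> = f \<one>\<^bsub>M\<^esub>"
      using S_carrierD(2)[OF repD(1)[OF f] MM.one_closed MM.one_closed] by simp
    then have "f \<one>\<^bsub>M\<^esub> = \<one>\<^bsub>M\<^esub>" using S_carrierD(1)[OF repD(1)[OF f] MM.one_closed] by simp
    then show ?thesis using repD(3)[OF g j False h] False by simp
  qed
  finally show "(f \<otimes>\<^bsub>S\<^esub> g) (incl n r j (x_elem n r j \<otimes>\<^bsub>H\<^esub> h)) =
      (if m = j then incl n r k (t' \<otimes>\<^bsub>H\<^esub> z \<otimes>\<^bsub>H\<^esub> h) else \<one>\<^bsub>M\<^esub>)" .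
qed

lemma rep_finsum:
  assumes "finite P" "l \<in> Cs" "m \<in> Cs"
    and "\<And>p. p \<in> P \<Longrightarrow> T p \<in> FA" "\<And>p. p \<in> P \<Longrightarrow> rep l m (proj (T p)) (f p)"
  shows "rep l m (proj (\<Sum>p\<in>P. T p)) (\<Oplus>\<^bsub>S\<^esub>p\<in>P. f p)"
  using assms(1,4,5)
proof (induction P rule: finite_induct)
  case empty
  show ?case
    unfolding sum.empty proj_zero abelian_monoid.finsum_empty[OF S_abelian_monoid]
    by (rule rep_zero[OF assms(2,3)])
next
  case (insert p P)
  have T: "T p \<in> FA" "(\<Sum>p\<in>P. T p) \<in> FA" using insert.prems(1) by (auto intro: FA_sum)
  have "f \<in> P \<rightarrow> carrier S" "f p \<in> carrier S" using repD(1)[OF insert.prems(2)] by auto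
  then have "(\<Oplus>\<^bsub>S\<^esub>p\<in>insert p P. f p) = f p \<oplus>\<^bsub>S\<^esub> (\<Oplus>\<^bsub>S\<^esub>p\<in>P. f p)"
    using insert.hyps by (intro abelian_monoid.finsum_insert[OF S_abelian_monoid])
  moreover have "proj (\<Sum>p\<in>insert p P. T p) = proj (T p) \<oplus>\<^bsub>H\<^esub> proj (\<Sum>p\<in>P. T p)"
    using insert.hyps T proj_add by simp
  ultimately show ?case
    using rep_add[OF assms(2,3) proj_closed[OF T(1)] proj_closed[OF T(2)]] insert by simp
qed

end

end

section \<open>Row and column sums of shifted matrices\<close>

lemma hat_inj:
  assumes "l \<in> Comp (n+1) r" "l' \<in> Comp (n+1) r" "\<And>i. i \<in> {1..2*n+1} \<Longrightarrow> hat n l i = hat n l' i"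
  shows "l = l'"
proof
  fix i
  consider "i \<in> {1..n}" | "i = n+1" | "i \<notin> {1..n+1}" by fastforce
  then show "l i = l' i"
  proof cases
    case 1
    then show ?thesis using assms(3)[of i] by (simp add: hat_def)
  next
    case 2
    then show ?thesis using assms(3)[of i] by (simp add: hat_def)
  next
    case 3
    then have "l i = 0" "l' i = 0" using assms(1,2) unfolding Comp_def by blast+
    then show ?thesis by simp
  qed
qed

lemma hat_outside: "i \<notin> {1..2*n+1} \<Longrightarrow> hat n l i = 0"
  by (auto simp: hat_def)

lemma E_theta_mirror:
  assumes "i \<in> {1..N}" "p \<in> {1..N}" "a \<in> {1..N}" "b \<in> {1..N}"
  shows "E_theta N i p (N+1-a) (N+1-b) = E_theta N i p a b"
proof -
  have "N+1-a = i \<longleftrightarrow> a = N+1-i" "N+1-a = N+1-i \<longleftrightarrow> a = i"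
    "N+1-b = p \<longleftrightarrow> b = N+1-p" "N+1-b = N+1-p \<longleftrightarrow> b = p" using assms by auto
  then show ?thesis unfolding E_theta_def unit_mat_def by simp
qed

lemma E_theta_sums:
  assumes "i \<in> {1..N}" "p \<in> {1..N}"
  shows "(\<Sum>b\<in>{1..N}. E_theta N i p a b) = (if a = i then 1 else 0) + (if a = N+1-i then 1 else 0)"
    "(\<Sum>a\<in>{1..N}. E_theta N i p a b) = (if b = p then 1 else 0) + (if b = N+1-p then 1 else 0)"
proof -
  have unit: "(\<Sum>b\<in>{1..N}. unit_mat i p a b) = (if a = i then 1 else 0)"
    "(\<Sum>a\<in>{1..N}. unit_mat i p a b) = (if b = p then 1 else 0)"
    if "i \<in> {1..N}" "p \<in> {1..N}" for i p a b
    using that by (cases "a = i"; cases "b = p"; simp add: unit_mat_def)+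
  have "N+1-i \<in> {1..N}" "N+1-p \<in> {1..N}" using assms by auto
  note u = unit[OF assms] unit[OF this]
  show "(\<Sum>b\<in>{1..N}. E_theta N i p a b) = (if a = i then 1 else 0) + (if a = N+1-i then 1 else 0)"
    "(\<Sum>a\<in>{1..N}. E_theta N i p a b) = (if b = p then 1 else 0) + (if b = N+1-p then 1 else 0)"
    unfolding E_theta_def sum.distrib u by simp_all
qed

text \<open>Both shifts lie in the same pair of columns, so the column sums stay; both are centrally
  symmetric with total 2, so symmetry and total are inherited from A.\<close>

lemma shift_Xi:
  assumes A: "A \<in> Xi N t" and i: "i \<in> {1..N}" "i' \<in> {1..N}" "p \<in> {1..N}"
    and eq: "\<And>a b. Y a b + E_theta N i p a b = A a b + E_theta N i' p a b"
  shows "Y \<in> Xi N t"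
    "ro N Y a + ((if a = i then 1 else 0) + (if a = N+1-i then 1 else 0)) =
      ro N A a + ((if a = i' then 1 else 0) + (if a = N+1-i' then 1 else 0))"
    "co N Y b = co N A b"
proof -
  have ro: "ro N Y a + ((if a = i then 1 else 0) + (if a = N+1-i then 1 else 0)) =
      ro N A a + ((if a = i' then 1 else 0) + (if a = N+1-i' then 1 else 0))" for a
    unfolding ro_def E_theta_sums(1)[OF i(1,3), symmetric] E_theta_sums(1)[OF i(2,3), symmetric]
      sum.distrib[symmetric] eq ..
  then show "ro N Y a + ((if a = i then 1 else 0) + (if a = N+1-i then 1 else 0)) =
      ro N A a + ((if a = i' then 1 else 0) + (if a = N+1-i' then 1 else 0))" .
  have "co N Y b + ((if b = p then 1 else 0) + (if b = N+1-p then 1 else 0)) =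
      co N A b + ((if b = p then 1 else 0) + (if b = N+1-p then 1 else 0))"
    unfolding co_def E_theta_sums(2)[OF i(1,3), symmetric] sum.distrib[symmetric] eq
    unfolding sum.distrib E_theta_sums(2)[OF i(1,3)] E_theta_sums(2)[OF i(2,3)] ..
  then show "co N Y b = co N A b" by (rule add_right_imp_eq)
  have A0: "A a b = 0" if "a \<notin> {1..N} \<or> b \<notin> {1..N}" for a b
    using A that unfolding Xi_def by blast
  have "Y a b = 0" if ab: "a \<notin> {1..N} \<or> b \<notin> {1..N}" for a b
  proof -
    have "N+1-i' \<in> {1..N}" "N+1-p \<in> {1..N}" using i by auto
    have "E_theta N i' p a b = 0"
    proof (cases "a \<in> {1..N}")
      case True
      then have "b \<noteq> p" "b \<noteq> N+1-p" using ab i(3) \<open>N+1-p \<in> _\<close> by blast+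
      then show ?thesis by (simp add: E_theta_def unit_mat_def)
    next
      case False
      then have "a \<noteq> i'" "a \<noteq> N+1-i'" using i(2) \<open>N+1-i' \<in> _\<close> by blast+
      then show ?thesis by (simp add: E_theta_def unit_mat_def)
    qed
    then show ?thesis using eq[of a b] A0[OF ab] by simp
  qed
  moreover have "Y a b = Y (N+1-a) (N+1-b)" if ab: "a \<in> {1..N}" "b \<in> {1..N}" for a b
    using eq[of a b] eq[of "N+1-a" "N+1-b"]
    unfolding E_theta_mirror[OF i(1,3) ab] E_theta_mirror[OF i(2,3) ab] Xi_mirror[OF A ab] by linarith
  moreover have "(\<Sum>a\<in>{1..N}. \<Sum>b\<in>{1..N}. Y a b) = t"
  proof -
    have two: "(\<Sum>a\<in>{1..N}. (if a = k then 1 else 0) + (if a = N+1-k then 1 else (0::nat))) = 2"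
      if "k \<in> {1..N}" for k
    proof -
      have "N+1-k \<in> {1..N}" using that by auto
      then show ?thesis using that by (simp add: sum.distrib)
    qed
    have "(\<Sum>a\<in>{1..N}. ro N Y a) + 2 = (\<Sum>a\<in>{1..N}. ro N A a) + 2"
      unfolding two[OF i(1), symmetric] sum.distrib[symmetric] ro
      unfolding sum.distrib two[OF i(2), unfolded sum.distrib] two[OF i(1), unfolded sum.distrib] ..
    moreover have "(\<Sum>a\<in>{1..N}. ro N A a) = t" using A unfolding Xi_def ro_def by blast
    ultimately show ?thesis by (simp add: ro_def)
  qed
  ultimately show "Y \<in> Xi N t" unfolding Xi_def by blast
qed

section \<open>Basis elements as maps and the general product\<close>

context type_B begin

lemma card_col:
  assumes "l \<in> Comp (n+1) r" "i \<in> {1..2*n+1}"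
  shows "card {k\<in>{1..2*r}. col n l k = i} = hat n l i"
proof -
  have "{k\<in>{1..2*r}. col n l k = i} = {bnd n l (i-1)<..bnd n l i}"
  proof -
    have "bnd n l i \<le> 2*r" using bnd_mono[of i "2*n+1" n l] bnd_total[OF assms(1)] assms(2) by simp
    then show ?thesis using col_eq_iff[OF assms(1), of _ i] assms(2) by (intro Set.set_eqI) fastforce
  qed
  moreover have "bnd n l i = bnd n l (i-1) + hat n l i" using bnd_Suc[of n l "i-1"] assms(2) by simp
  ultimately show ?thesis by simp
qed

lemma cnt_sums:
  assumes c: "c ` {1..2*r} \<subseteq> {1..N}" "c' ` {1..2*r} \<subseteq> {1..N}" and v: "v \<in> W"
  shows "ro N (cnt c c' v) i = card {k\<in>{1..2*r}. c k = i}"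
    "co N (cnt c c' v) j = card {k\<in>{1..2*r}. c' k = j}"
proof -
  have vr: "v k \<in> {1..2*r}" if "k \<in> {1..2*r}" for k using W_in[OF v, of k] that by simp
  have "{k\<in>{1..2*r}. c k = i} = (\<Union>j\<in>{1..N}. {k\<in>{1..2*r}. c k = i \<and> c' (v k) = j})"
    using subsetD[OF c(2) imageI[OF vr]] by blast
  moreover have "card (\<Union>j\<in>{1..N}. {k\<in>{1..2*r}. c k = i \<and> c' (v k) = j}) =
      (\<Sum>j\<in>{1..N}. card {k\<in>{1..2*r}. c k = i \<and> c' (v k) = j})"
    by (rule card_UN_disjoint) auto
  ultimately show "ro N (cnt c c' v) i = card {k\<in>{1..2*r}. c k = i}"
    unfolding ro_def cnt_def by (simp only:)
  have "{k\<in>{1..2*r}. c' (v k) = j} = (\<Union>i\<in>{1..N}. {k\<in>{1..2*r}. c k = i \<and> c' (v k) = j})"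
    using subsetD[OF c(1) imageI] by blast
  moreover have "card (\<Union>i\<in>{1..N}. {k\<in>{1..2*r}. c k = i \<and> c' (v k) = j}) =
      (\<Sum>i\<in>{1..N}. card {k\<in>{1..2*r}. c k = i \<and> c' (v k) = j})"
    by (rule card_UN_disjoint) auto
  moreover have "bij_betw v {k\<in>{1..2*r}. c' (v k) = j} {k\<in>{1..2*r}. c' k = j}"
  proof (rule bij_betw_byWitness[where f' = "pinv v"])
    show "v ` {k\<in>{1..2*r}. c' (v k) = j} \<subseteq> {k\<in>{1..2*r}. c' k = j}" using vr by blast
    show "pinv v ` {k\<in>{1..2*r}. c' k = j} \<subseteq> {k\<in>{1..2*r}. c' (v k) = j}"
    proof
      fix x assume "x \<in> pinv v ` {k\<in>{1..2*r}. c' k = j}"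
      then obtain k where k: "k \<in> {1..2*r}" "c' k = j" "x = pinv v k" by blast
      have "pinv v k \<in> {1..2*r}" using W_in[OF inv_W[OF v], of k] k(1) by simp
      then show "x \<in> {k\<in>{1..2*r}. c' (v k) = j}" unfolding k(3) using k(2) W_inv_f(2)[OF v, of k] by simp
    qed
  qed (simp_all add: W_inv_f[OF v])
  note bij_betw_same_card[OF this]
  ultimately show "co N (cnt c c' v) j = card {k\<in>{1..2*r}. c' k = j}"
    unfolding co_def cnt_def by (simp only:)
qed

lemma triple_mat_cnt:
  assumes "l \<in> Comp (n+1) r" "m \<in> Comp (n+1) r" "d \<in> W"
  shows "triple_mat n (l, d, m) = cnt (col n l) (col n m) (pinv d)"
proof (intro ext)
  fix i j
  have pr: "pinv d k \<in> {1..2*r}" if "k \<in> {1..2*r}" for k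
    using W_in[OF inv_W[OF assms(3)], of k] that by simp
  show "triple_mat n (l, d, m) i j = cnt (col n l) (col n m) (pinv d) i j"
  proof (cases "i \<in> {1..2*n+1} \<and> j \<in> {1..2*n+1}")
    case True
    have "block n l i \<inter> d ` block n m j = {k\<in>{1..2*r}. col n l k = i \<and> col n m (pinv d k) = j}"
    proof (intro Set.set_eqI iffI)
      fix k assume "k \<in> block n l i \<inter> d ` block n m j"
      then obtain x where x: "k \<in> block n l i" "x \<in> block n m j" "k = d x" by blast
      have "pinv d k = x" unfolding x(3) by (rule W_inv_f(1)[OF assms(3)])
      then show "k \<in> {k\<in>{1..2*r}. col n l k = i \<and> col n m (pinv d k) = j}"
        using x(1,2) mem_block[OF assms(1), of i k] mem_block[OF assms(2), of j x] True by simp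
    next
      fix k assume k: "k \<in> {k\<in>{1..2*r}. col n l k = i \<and> col n m (pinv d k) = j}"
      then have "k \<in> block n l i" "pinv d k \<in> block n m j"
        using mem_block[OF assms(1), of i k] mem_block[OF assms(2), of j "pinv d k"] True pr[of k] by simp_all
      moreover have "k = d (pinv d k)" using W_inv_f(2)[OF assms(3), of k] by simp
      ultimately show "k \<in> block n l i \<inter> d ` block n m j" by blast
    qed
    then show ?thesis unfolding triple_mat_def cnt_def using True by simp
  next
    case False
    have "{k\<in>{1..2*r}. col n l k = i \<and> col n m (pinv d k) = j} = {}"
      using False col_range[OF assms(1)] col_range[OF assms(2) pr] by blast
    then have "cnt (col n l) (col n m) (pinv d) i j = 0" unfolding cnt_def by (simp only: card.empty)
    moreover have "triple_mat n (l, d, m) i j = 0" using False unfolding triple_mat_def by auto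
    ultimately show ?thesis by simp
  qed
qed

lemma count_class_W: "count_class c c' A \<subseteq> W"
  unfolding count_class_def by blast

lemma count_class_right: "w \<in> count_class c c' A \<Longrightarrow> u \<in> stab c' \<Longrightarrow> w \<circ> u \<in> count_class c c' A"
  using cnt_double_coset[OF stab_id, of w u c' c] comp_W[OF _ stab_W, of w u c']
  unfolding count_class_def by simp

lemma count_class_left: "w \<in> count_class c c' A \<Longrightarrow> u \<in> stab c \<Longrightarrow> u \<circ> w \<in> count_class c c' A"
  using cnt_double_coset[OF _ _ stab_id, of u c w c'] comp_W[OF stab_W, of u c w]
  unfolding count_class_def by simp

text \<open>The inverses in \<open>count_class\<close> and in \<open>theta\<close> match, so the
  operators \<open>tau\<close> can be applied to double coset sums.\<close>

lemma tsum_count_class: "tsum (count_class c c' A) = theta (phi c c' A)"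
proof -
  have "phi c c' A v = (if pinv v \<in> count_class c c' A then 1 else 0)" if "v \<in> W" for v
    using inv_W[OF that] W_inv_inv[OF that] unfolding phi_def count_class_def by simp
  then show ?thesis
    unfolding theta_indicator[OF count_class_W, symmetric] by (intro theta_cong) simp
qed

lemma word_sum_act:
  fixes wd :: "nat \<Rightarrow> nat list"
  assumes wd: "finite K" "\<And>k. k \<in> K \<Longrightarrow> set (wd k) \<subseteq> {1..r}"
    and act: "\<And>v. v \<in> W \<Longrightarrow>
      (\<Sum>k\<in>K. foldr tau (wd k) (phi c c' Y) v) = (\<Sum>p\<in>P. a p * phi c1 c' (Z p) v)"
  shows "(\<Sum>k\<in>K. gens (wd k)) * tsum (count_class c c' Y) \<doteq>
    (\<Sum>p\<in>P. const (a p) * tsum (count_class c1 c' (Z p)))"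
proof -
  have 1: "(\<Sum>k\<in>K. gens (wd k)) * theta (phi c c' Y) = (\<Sum>k\<in>K. gens (wd k) * theta (phi c c' Y))"
    by (rule sum_distrib_right)
  have 2: "(\<Sum>k\<in>K. gens (wd k) * theta (phi c c' Y)) \<doteq> (\<Sum>k\<in>K. theta (foldr tau (wd k) (phi c c' Y)))"
    by (rule heq_sum) (rule gens_theta[OF wd(2)])
  have 3: "(\<Sum>k\<in>K. theta (foldr tau (wd k) (phi c c' Y))) =
      theta (\<lambda>v. \<Sum>k\<in>K. foldr tau (wd k) (phi c c' Y) v)"
    by (rule theta_sum[where \<phi> = "\<lambda>k. foldr tau (wd k) (phi c c' Y)", symmetric])
  have 4: "\<dots> = theta (\<lambda>v. \<Sum>p\<in>P. a p * phi c1 c' (Z p) v)"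
    by (rule theta_cong) (rule act)
  have 5: "\<dots> = (\<Sum>p\<in>P. theta (\<lambda>v. a p * phi c1 c' (Z p) v))"
    by (rule theta_sum[where \<phi> = "\<lambda>p v. a p * phi c1 c' (Z p) v"])
  have 6: "\<dots> = (\<Sum>p\<in>P. const (a p) * theta (phi c1 c' (Z p)))"
    by (rule sum.cong[OF refl]) (rule theta_scale)
  show ?thesis
    unfolding tsum_count_class 1 using 2 unfolding 3 4 5 6 .
qed

text \<open>The stabiliser is the double coset of the identity; for block colourings its matrix is
  diagonal by \<open>cnt_id\<close>.\<close>

lemma stab_count_class:
  assumes c: "sym_colouring N c"
  shows "stab c = count_class c c (cnt c c id)"
proof -
  have "pinv id = id" by (rule inv_id)
  then have "count_class c c (cnt c c id) = {u \<circ> id \<circ> u' | u u'. u \<in> stab c \<and> u' \<in> stab c}"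
    using count_class_double_coset[OF c c id_W] by simp
  also have "\<dots> = stab c"
  proof (intro Set.set_eqI iffI)
    fix w assume "w \<in> {u \<circ> id \<circ> u' | u u'. u \<in> stab c \<and> u' \<in> stab c}"
    then show "w \<in> stab c" using stab_comp by auto
  next
    fix w assume "w \<in> stab c"
    moreover have "w = w \<circ> id \<circ> id" by simp
    ultimately show "w \<in> {u \<circ> id \<circ> u' | u u'. u \<in> stab c \<and> u' \<in> stab c}" using stab_id by blast
  qed
  finally show ?thesis by simp
qed

lemma cnt_id:
  assumes "l \<in> Comp (n+1) r"
  shows "cnt (col n l) (col n l) id = diag (hat n l)"
proof (intro ext)
  fix i j
  show "cnt (col n l) (col n l) id i j = diag (hat n l) i j"
  proof (cases "i = j \<and> i \<in> {1..2*n+1}")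
    case True
    then have "cnt (col n l) (col n l) id i j = card {k\<in>{1..2*r}. col n l k = i}" by (simp add: cnt_def)
    then show ?thesis using card_col[OF assms, of i] True by (simp add: diag_def)
  next
    case False
    have "{k\<in>{1..2*r}. col n l k = i \<and> col n l (id k) = j} = {}"
      using False col_range[OF assms] unfolding id_apply by blast
    then have "cnt (col n l) (col n l) id i j = 0" unfolding cnt_def by (simp only: card.empty)
    then show ?thesis using False hat_outside[of i n l] by (auto simp: diag_def)
  qed
qed

context
  fixes n :: nat
  assumes n: "1 \<le> n"
begin

abbreviation Cls where "Cls l m A \<equiv> count_class (col n l) (col n m) A"

text \<open>By \<open>exists_count\<close> the class of A is nonempty, and a shortest element of it
  gives a triple, so the choice in \<open>e_elem\<close> is a triple with matrix A. Row and column
  sums recover l and m, and the double coset is the class of A. The two factorisations of its sum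
  give existence of the map, \<open>rep_unique\<close> uniqueness.\<close>

lemma e_elem_rep:
  assumes A: "A \<in> Xi (2*n+1) (2*r)" and l: "l \<in> Comp (n+1) r" and m: "m \<in> Comp (n+1) r"
    and ro: "\<And>i. i \<in> {1..2*n+1} \<Longrightarrow> hat n l i = ro (2*n+1) A i"
    and co: "\<And>i. i \<in> {1..2*n+1} \<Longrightarrow> hat n m i = co (2*n+1) A i"
  shows "rep n l m (proj (tsum (Cls l m A))) (e_elem n r A)"
proof -
  let ?D = "Cls l m A"
  obtain v where v: "v \<in> W" "cnt (col n l) (col n m) v = A" using exists_count[OF A l m ro co] by blast
  have "pinv v \<in> ?D" using v inv_W[OF v(1)] W_inv_inv[OF v(1)] by (simp add: count_class_def)
  then obtain d where d: "d \<in> ?D" "\<And>w. w \<in> ?D \<Longrightarrow> cox_length r d \<le> cox_length r w"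
    using ex_has_least_nat[of "\<lambda>w. w \<in> ?D" "pinv v" "cox_length r"] by blast
  have dW: "d \<in> W" and dA: "cnt (col n l) (col n m) (pinv d) = A" using d(1) by (simp_all add: count_class_def)
  have "double_coset n r l d m = ?D" unfolding double_coset_eq[OF l m n dW] dA ..
  then have "(l, d, m) \<in> triples n r" using l m dW d(2) by (simp add: triples_def min_reps_def)
  moreover have "triple_mat n (l, d, m) = A" using triple_mat_cnt[OF l m dW] dA by simp
  ultimately have "A \<in> triple_mat n ` triples n r" by blast
  then have inv: "inv_into (triples n r) (triple_mat n) A \<in> triples n r"
    "triple_mat n (inv_into (triples n r) (triple_mat n) A) = A"
    by (rule inv_into_into, rule f_inv_into_f)
  obtain l' d' m' where t: "inv_into (triples n r) (triple_mat n) A = (l', d', m')" by (rule prod_cases3)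
  have l': "l' \<in> Comp (n+1) r" and m': "m' \<in> Comp (n+1) r" and d'W: "d' \<in> W"
    using inv(1) unfolding t by (simp_all add: triples_def min_reps_def)
  have cA: "cnt (col n l') (col n m') (pinv d') = A"
    using inv(2) unfolding t triple_mat_cnt[OF l' m' d'W] .
  note cs = cnt_sums[OF colouringD(2)[OF colouring_col[OF l']] colouringD(2)[OF colouring_col[OF m']] inv_W[OF d'W],
      unfolded cA]
  have "l' = l"
    by (rule hat_inj[OF l' l]) (simp only: ro cs(1) card_col[OF l'])
  moreover have "m' = m"
    by (rule hat_inj[OF m' m]) (simp only: co cs(2) card_col[OF m'])
  ultimately have D: "double_coset n r l d' m = ?D" "inv_into (triples n r) (triple_mat n) A = (l, d', m)"
    using double_coset_eq[OF l m n d'W] cA t by simp_all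
  have "e_elem n r A = (THE f. rep n l m (Tsum r ?D) f)"
    unfolding e_elem_def if_P[OF A] D prod.case rep_def[OF n] ..
  moreover have "\<exists>f. rep n l m (Tsum r ?D) f"
  proof -
    obtain y where y: "y \<in> FA" "tsum ?D \<doteq> y * tsum (stab (col n m))"
      using tsum_right_factor[OF colouringD(1)[OF colouring_col[OF m]] count_class_W count_class_right] by blast
    obtain z where z: "z \<in> FA" "tsum ?D \<doteq> tsum (stab (col n l)) * z"
      using tsum_left_factor[OF colouringD(1)[OF colouring_col[OF l]] count_class_W count_class_left] by blast
    have FAs: "tsum (stab c) \<in> FA" for c by (intro tsum_FA) (auto simp: stab_def)
    have T: "Tsum r ?D = proj y \<otimes>\<^bsub>H\<^esub> x_elem n r m" "Tsum r ?D = x_elem n r l \<otimes>\<^bsub>H\<^esub> proj z"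
      unfolding Tsum_proj[OF count_class_W] x_elem_proj[OF n l] x_elem_proj[OF n m]
        proj_mult[OF y(1) FAs, symmetric] proj_mult[OF FAs z(1), symmetric]
      by (rule proj_heq[OF y(2)], rule proj_heq[OF z(2)])
    show ?thesis by (rule rep_exists[OF n l m proj_closed[OF y(1)] proj_closed[OF z(1)] T])
  qed
  then have "\<exists>!f. rep n l m (Tsum r ?D) f" using rep_unique[OF n] by blast
  then have "rep n l m (Tsum r ?D) (THE f. rep n l m (Tsum r ?D) f)" by (rule theI')
  ultimately show ?thesis unfolding Tsum_proj[OF count_class_W] by simp
qed

text \<open>The action of \<open>\<Sum> T\<^bsub>wd k\<^esub>\<close> on the sums \<open>tsum (Cls l m A)\<close> is known for all \<open>A\<close>; the special
  case of a diagonal matrix identifies \<open>e\<^sub>B\<close>.\<close>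

lemma product_formula:
  fixes wd :: "nat \<Rightarrow> nat list" and new :: "mat \<Rightarrow> nat \<Rightarrow> mat"
  assumes l: "l \<in> Comp (n+1) r" and lt: "lt \<in> Comp (n+1) r"
    and wd: "finite K" "\<And>k. k \<in> K \<Longrightarrow> set (wd k) \<subseteq> {1..r}"
    and act: "\<And>A c' v. A \<in> Xi (2*n+1) (2*r) \<Longrightarrow> colouring n c' \<Longrightarrow> v \<in> W \<Longrightarrow>
      (\<Sum>k\<in>K. foldr tau (wd k) (phi (col n l) c' A) v) =
      (\<Sum>p | p \<in> {1..2*n+1} \<and> Q A p. coef A p * phi (col n lt) c' (new A p) v)"
    and new: "\<And>A p. A \<in> Xi (2*n+1) (2*r) \<Longrightarrow> p \<in> {1..2*n+1} \<Longrightarrow> Q A p \<Longrightarrow> new A p \<in> Xi (2*n+1) (2*r) \<and>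
      (\<forall>i\<in>{1..2*n+1}. ro (2*n+1) A i = hat n l i \<longrightarrow> ro (2*n+1) (new A p) i = hat n lt i) \<and>
      (\<forall>i. co (2*n+1) (new A p) i = co (2*n+1) A i)"
    and unit: "diag (hat n l) \<in> Xi (2*n+1) (2*r)" "{p. p \<in> {1..2*n+1} \<and> Q (diag (hat n l)) p} = {pd}"
      "coef (diag (hat n l)) pd = 1" "new (diag (hat n l)) pd = B"
    and B: "B \<in> Xi (2*n+1) (2*r)" "\<And>i. i \<in> {1..2*n+1} \<Longrightarrow> ro (2*n+1) B i = hat n lt i"
      "\<And>i. i \<in> {1..2*n+1} \<Longrightarrow> co (2*n+1) B i = hat n l i"
    and A: "A \<in> Xi (2*n+1) (2*r)" "\<And>i. i \<in> {1..2*n+1} \<Longrightarrow> ro (2*n+1) A i = hat n l i"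
  shows "e_elem n r B \<otimes>\<^bsub>schur n r\<^esub> e_elem n r A =
    (\<Oplus>\<^bsub>schur n r\<^esub>p\<in>{p. p \<in> {1..2*n+1} \<and> Q A p}. coef A p \<odot>\<^bsub>schur n r\<^esub> e_elem n r (new A p))"
proof -
  let ?N = "2*n+1"
  \<comment> \<open>The composition of the source summand of e_A, recovered from the column
    sums.\<close>
  define m where "m = comp_of n (co ?N A)"
  have m: "m \<in> Comp (n+1) r" "\<And>i. i \<in> {1..?N} \<Longrightarrow> hat n m i = co ?N A i"
    unfolding m_def
    by (rule comp_of(1)[OF ro_mirror(2)[OF A(1)] ro_total(2)[OF A(1)]], assumption)
      (rule comp_of(2)[OF ro_mirror(2)[OF A(1)] ro_total(2)[OF A(1)]], assumption+)
  define G where "G = (\<Sum>k\<in>K. gens (wd k))"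
  have GFA: "G \<in> FA" unfolding G_def by (intro FA_sum gens_FA wd(2))
  have gact: "G * tsum (count_class (col n l) c' Y) \<doteq>
      (\<Sum>p\<in>{p. p \<in> {1..?N} \<and> Q Y p}. const (coef Y p) * tsum (count_class (col n lt) c' (new Y p)))"
    if "Y \<in> Xi ?N (2*r)" "colouring n c'" for Y c'
    unfolding G_def
    by (rule word_sum_act[where a = "coef Y" and Z = "new Y", OF wd(1)])
      (erule wd(2), rule act[OF that], assumption)
  have cl: "colouring n (col n l)" and cm: "colouring n (col n m)"
    by (rule colouring_col[OF l], rule colouring_col[OF m(1)])
  have "stab (col n l) = Cls l l (diag (hat n l))"
    using stab_count_class[OF colouringD(1)[OF cl]] unfolding cnt_id[OF l] .
  \<comment> \<open>For the diagonal matrix only p = pd occurs, with coefficient 1 and new matrix B,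
    so G x_l is the double coset sum of B.\<close>
  then have GB: "G * tsum (stab (col n l)) \<doteq> tsum (Cls lt l B)"
    using gact[OF unit(1) cl] unfolding unit(2) by (simp add: unit(3,4) const_def)
  obtain z where z: "z \<in> FA" "tsum (Cls l m A) \<doteq> tsum (stab (col n l)) * z"
    using tsum_left_factor[OF colouringD(1)[OF cl] count_class_W count_class_left] by blast
  have FAs: "tsum (stab (col n l)) \<in> FA" by (intro tsum_FA) (auto simp: stab_def)
  have FAc: "tsum (count_class c c' A) \<in> FA" for c c' A by (rule tsum_FA[OF count_class_W])
  have eA: "rep n l m (x_elem n r l \<otimes>\<^bsub>H\<^esub> proj z) (e_elem n r A)"
    using e_elem_rep[OF A(1) l m(1) A(2)[symmetric] m(2)]
    unfolding x_elem_proj[OF n l] proj_mult[OF FAs z(1), symmetric] proj_heq[OF z(2)] .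
  have eB: "rep n lt l (proj (tsum (Cls lt l B))) (e_elem n r B)"
    by (rule e_elem_rep[OF B(1) lt l B(2)[symmetric] B(3)[symmetric]])
  have lhs: "rep n lt m (proj (tsum (Cls lt l B)) \<otimes>\<^bsub>H\<^esub> proj z) (e_elem n r B \<otimes>\<^bsub>schur n r\<^esub> e_elem n r A)"
    by (rule rep_mult[OF n lt l m(1) proj_closed[OF z(1)] proj_closed[OF FAc] eA eB])
  \<comment> \<open>The sum of B is G x_l and the sum of A is x_l z, so reassociating leaves G
    applied to the sum of A.\<close>
  have "tsum (Cls lt l B) * z \<doteq> G * tsum (stab (col n l)) * z"
    by (rule heq_multR[OF z(1) heq_sym[OF GB]])
  also have "\<dots> = G * (tsum (stab (col n l)) * z)" by (rule mult.assoc)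
  also have "\<dots> \<doteq> G * tsum (Cls l m A)" by (rule heq_multL[OF GFA heq_sym[OF z(2)]])
  also have "\<dots> \<doteq> (\<Sum>p | p \<in> {1..?N} \<and> Q A p. const (coef A p) * tsum (Cls lt m (new A p)))"
    by (rule gact[OF A(1) cm])
  finally have eq: "proj (tsum (Cls lt l B)) \<otimes>\<^bsub>H\<^esub> proj z =
      proj (\<Sum>p | p \<in> {1..?N} \<and> Q A p. const (coef A p) * tsum (Cls lt m (new A p)))"
    unfolding proj_mult[OF FAc z(1), symmetric] by (rule proj_heq)
  have rhs: "rep n lt m (proj (\<Sum>p | p \<in> {1..?N} \<and> Q A p. const (coef A p) * tsum (Cls lt m (new A p))))
      (\<Oplus>\<^bsub>schur n r\<^esub>p\<in>{p. p \<in> {1..?N} \<and> Q A p}. coef A p \<odot>\<^bsub>schur n r\<^esub> e_elem n r (new A p))"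
  proof (rule rep_finsum[OF n _ lt m(1)])
    show "finite {p. p \<in> {1..?N} \<and> Q A p}" by simp
    fix p assume "p \<in> {p. p \<in> {1..?N} \<and> Q A p}"
    then have p: "p \<in> {1..?N}" "Q A p" by blast+
    show "const (coef A p) * tsum (Cls lt m (new A p)) \<in> FA" by (rule FA_mult[OF FA_const FAc])
    note nw = new[OF A(1) p]
    have "rep n lt m (proj (tsum (Cls lt m (new A p)))) (e_elem n r (new A p))"
    proof (rule e_elem_rep[OF conjunct1[OF nw] lt m(1)])
      show "hat n lt i = ro ?N (new A p) i" if "i \<in> {1..?N}" for i using nw A(2)[OF that] that by simp
      show "hat n m i = co ?N (new A p) i" if "i \<in> {1..?N}" for i using nw m(2)[OF that] by simp
    qed
    then show "rep n lt m (proj (const (coef A p) * tsum (Cls lt m (new A p))))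
        (coef A p \<odot>\<^bsub>schur n r\<^esub> e_elem n r (new A p))"
      unfolding proj_mult[OF FA_const FAc] hecke_const_proj[symmetric]
      by (rule rep_smult[OF n lt m(1) proj_closed[OF FAc]])
  qed
  show ?thesis by (rule rep_unique[OF n lhs[unfolded eq] rhs])
qed

end

end

section \<open>Compositions enlarged by one\<close>

definition inc :: "(nat \<Rightarrow> nat) \<Rightarrow> nat \<Rightarrow> nat \<Rightarrow> nat" where
  "inc m i = (\<lambda>k. m k + (if k = i then 1 else 0))"

lemma inc_Comp:
  assumes "m \<in> Comp k t" "i \<in> {1..k}"
  shows "inc m i \<in> Comp k (t+1)"
  using assms unfolding Comp_def inc_def by (auto simp: sum.distrib)

lemma hat_inc:
  "k \<in> {1..2*n+1} \<Longrightarrow> i \<in> {1..n+1} \<Longrightarrow>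
    hat n (inc m i) k = hat n m k + ((if k = i then 1 else 0) + (if k = 2*n+2-i then 1 else 0))"
  by (auto simp: hat_def inc_def)

lemma bnd_inc:
  assumes "i \<ge> 1" "j \<le> n"
  shows "bnd n (inc m i) j = bnd n m j + (if i \<le> j then 1 else 0)"
  using assms by (simp add: bnd_low inc_def sum.distrib)

lemma diag_inc:
  assumes "i \<in> {1..n+1}"
  shows "diag (hat n (inc m i)) a b = diag (hat n m) a b + E_theta (2*n+1) i i a b"
proof (cases "a = b \<and> a \<in> {1..2*n+1}")
  case True
  then show ?thesis using hat_inc[of a n i m] assms by (simp add: diag_def E_theta_def unit_mat_def)
next
  case False
  have "2*n+1+1-i \<in> {1..2*n+1}" "i \<in> {1..2*n+1}" using assms by auto
  then have "E_theta (2*n+1) i i a b = 0"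
    using False by (cases "a = b") (auto simp: E_theta_def unit_mat_def)
  moreover have "diag (hat n l) a b = 0" for l using False hat_outside[of a n l] by (auto simp: diag_def)
  ultimately show ?thesis by simp
qed

lemma diag_sums:
  assumes "a \<in> {1..2*n+1}"
  shows "ro (2*n+1) (diag (hat n l)) a = hat n l a" "co (2*n+1) (diag (hat n l)) a = hat n l a"
  using assms by (simp_all add: ro_def co_def diag_def)

lemma diag_Xi:
  assumes "l \<in> Comp (n+1) r"
  shows "diag (hat n l) \<in> Xi (2*n+1) (2*r)"
proof -
  have "(\<Sum>i\<in>{1..2*n+1}. \<Sum>j\<in>{1..2*n+1}. diag (hat n l) i j) = (\<Sum>i\<in>{1..2*n+1}. hat n l i)"
    by (rule sum.cong[OF refl]) (simp add: diag_def)
  also have "\<dots> = 2*r" using bnd_total[OF assms] by (simp add: bnd_def)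
  finally have "(\<Sum>i\<in>{1..2*n+1}. \<Sum>j\<in>{1..2*n+1}. diag (hat n l) i j) = 2*r" .
  moreover have "diag (hat n l) i j = diag (hat n l) (2*n+1+1-i) (2*n+1+1-j)"
    if "i \<in> {1..2*n+1}" "j \<in> {1..2*n+1}" for i j
  proof -
    have "2*n+1+1-i = 2*n+1+1-j \<longleftrightarrow> i = j" using that by auto
    then show ?thesis using hat_mirror[OF that(1), of l] by (auto simp: diag_def)
  qed
  moreover have "diag (hat n l) i j = 0" if "i \<notin> {1..2*n+1} \<or> j \<notin> {1..2*n+1}" for i j
    using that hat_outside[of i n l] by (auto simp: diag_def)
  ultimately show ?thesis unfolding Xi_def by blast
qed

lemma offdiag_sums:
  assumes "i \<in> {1..n+1}" "j \<in> {1..n+1}" "a \<in> {1..2*n+1}"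
  shows "ro (2*n+1) (\<lambda>a b. E_theta (2*n+1) i j a b + diag (hat n m) a b) a = hat n (inc m i) a"
    "co (2*n+1) (\<lambda>a b. E_theta (2*n+1) i j a b + diag (hat n m) a b) a = hat n (inc m j) a"
proof -
  have ij: "i \<in> {1..2*n+1}" "j \<in> {1..2*n+1}" using assms by auto
  note d = diag_sums[OF assms(3), unfolded ro_def co_def]
  show "ro (2*n+1) (\<lambda>a b. E_theta (2*n+1) i j a b + diag (hat n m) a b) a = hat n (inc m i) a"
    unfolding ro_def sum.distrib E_theta_sums[OF ij] d hat_inc[OF assms(3,1)] by simp
  show "co (2*n+1) (\<lambda>a b. E_theta (2*n+1) i j a b + diag (hat n m) a b) a = hat n (inc m j) a"
    unfolding co_def sum.distrib E_theta_sums[OF ij] d hat_inc[OF assms(3,2)] by simp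
qed

lemma shift_sums:
  assumes A: "A \<in> Xi (2*n+1) t" and i: "i \<in> {1..n+1}" "i' \<in> {1..n+1}" and p: "p \<in> {1..2*n+1}"
    and eq: "\<And>a b. Y a b + E_theta (2*n+1) i p a b = A a b + E_theta (2*n+1) i' p a b"
  shows "Y \<in> Xi (2*n+1) t \<and>
    (\<forall>a\<in>{1..2*n+1}. ro (2*n+1) A a = hat n (inc m i) a \<longrightarrow> ro (2*n+1) Y a = hat n (inc m i') a) \<and>
    (\<forall>b. co (2*n+1) Y b = co (2*n+1) A b)"
proof -
  have i2: "i \<in> {1..2*n+1}" "i' \<in> {1..2*n+1}" using i by auto
  note sh = shift_Xi[OF A i2 p eq]
  have "ro (2*n+1) Y a = hat n (inc m i') a"
    if "a \<in> {1..2*n+1}" "ro (2*n+1) A a = hat n (inc m i) a" for a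
    using sh(2)[of a] that(2) unfolding hat_inc[OF that(1) i(1)] hat_inc[OF that(1) i(2)] by simp
  then show ?thesis using sh(1,3) by blast
qed

lemma mat_up_sums:
  assumes "A \<in> Xi (2*n+1) (2*r)" "h \<in> {1..n}" "p \<in> {1..2*n+1}" "A (h+1) p > 0"
  shows "mat_up (2*n+1) A h p \<in> Xi (2*n+1) (2*r) \<and>
    (\<forall>a\<in>{1..2*n+1}. ro (2*n+1) A a = hat n (inc m (h+1)) a \<longrightarrow>
      ro (2*n+1) (mat_up (2*n+1) A h p) a = hat n (inc m h) a) \<and>
    (\<forall>b. co (2*n+1) (mat_up (2*n+1) A h p) b = co (2*n+1) A b)"
proof (rule shift_sums[OF assms(1) _ _ assms(3)])
  show "h + 1 \<in> {1..n+1}" "h \<in> {1..n+1}" using assms(2) by auto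
  show "mat_up (2*n+1) A h p a b + E_theta (2*n+1) (h+1) p a b = A a b + E_theta (2*n+1) h p a b" for a b
    unfolding mat_up_def using mat_up_le[OF assms, of a b] by (rule le_add_diff_inverse2)
qed

lemma mat_down_sums:
  assumes "A \<in> Xi (2*n+1) (2*r)" "h \<in> {1..n}" "p \<in> {1..2*n+1}" "A h p > 0"
  shows "mat_down (2*n+1) A h p \<in> Xi (2*n+1) (2*r) \<and>
    (\<forall>a\<in>{1..2*n+1}. ro (2*n+1) A a = hat n (inc m h) a \<longrightarrow>
      ro (2*n+1) (mat_down (2*n+1) A h p) a = hat n (inc m (h+1)) a) \<and>
    (\<forall>b. co (2*n+1) (mat_down (2*n+1) A h p) b = co (2*n+1) A b)"
proof (rule shift_sums[OF assms(1) _ _ assms(3)])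
  show "h + 1 \<in> {1..n+1}" "h \<in> {1..n+1}" using assms(2) by auto
  show "mat_down (2*n+1) A h p a b + E_theta (2*n+1) h p a b = A a b + E_theta (2*n+1) (h+1) p a b" for a b
    unfolding mat_down_def using mat_down_le[OF assms, of a b] by (rule le_add_diff_inverse2)
qed

text \<open>Enlarging part h instead of part h + 1 moves one block boundary in the left half: t is
  the last position of block h in one colouring and the first of block h + 1 in the other. For h = n
  the latter block is central, hence symmetric.\<close>

lemma inc_colours:
  assumes h: "h \<in> {1..n}" and m: "m \<in> Comp (n+1) (r-1)" and r: "r \<ge> 1" and t_def: "t = bnd n m h + 1"
  shows "t \<in> {1..r}" "col n (inc m h) t = h" "col n (inc m (h+1)) t = h+1"
    "\<And>x. x \<in> {1..r} \<Longrightarrow> x \<noteq> t \<Longrightarrow> col n (inc m h) x = col n (inc m (h+1)) x"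
    "bnd n m (h-1) + 1 \<le> t" "{x\<in>{1..2*r}. col n (inc m h) x = h} = {bnd n m (h-1) + 1..t}"
    "{x\<in>{1..2*r}. col n (inc m (h+1)) x = h+1} = {t..bnd n (inc m (h+1)) (h+1)}"
    "t \<le> bnd n (inc m (h+1)) (h+1)"
    "h < n \<Longrightarrow> bnd n (inc m (h+1)) (h+1) \<le> r" "h = n \<Longrightarrow> bnd n (inc m (h+1)) (h+1) = 2*r+1-t"
proof -
  let ?l = "inc m h" and ?l' = "inc m (h+1)"
  have l: "?l \<in> Comp (n+1) r" and l': "?l' \<in> Comp (n+1) r"
    using inc_Comp[OF m, of h] inc_Comp[OF m, of "h+1"] h r by simp_all
  have mid: "r \<le> bnd n y (n+1)" "bnd n y n \<le> r" if "y \<in> Comp (n+1) r" for y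
    using bnd_mirror[OF that, of n] bnd_mono[of n "n+1" n y] by simp_all
  have bl: "bnd n ?l j = bnd n m j + (if h \<le> j then 1 else 0)"
    "bnd n ?l' j = bnd n m j + (if h+1 \<le> j then 1 else 0)" if "j \<le> n" for j
    using bnd_inc[of h j n m] bnd_inc[of "h+1" j n m] that h by simp_all
  have tl: "bnd n ?l h = t" "bnd n ?l' h = t - 1" "bnd n ?l (h-1) = bnd n m (h-1)"
    using bl[of h] bl(1)[of "h-1"] h by (auto simp: t_def)
  have tr: "t \<in> {1..r}" using mid(2)[OF l] bnd_mono[of h n n ?l] h tl(1) by (simp add: t_def)
  have low: "bnd n m (h-1) + 1 \<le> t" using bnd_mono[of "h-1" h n m] by (simp add: t_def)
  have tb: "t \<le> bnd n ?l' (h+1)"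
  proof (cases "h < n")
    case True
    then show ?thesis using bl(2)[of "h+1"] bnd_mono[of h "h+1" n m] by (simp add: t_def)
  next
    case False
    then show ?thesis using mid(1)[OF l'] tr h by simp
  qed
  have top: "bnd n ?l' (h+1) \<le> 2*r" using bnd_mono[of "h+1" "2*n+1" n ?l'] bnd_total[OF l'] h by simp
  have eq: "col n ?l x = col n ?l' x" if x: "x \<in> {1..r}" "x \<noteq> t" for x
  proof -
    have x2: "x \<le> 2*r" using x by simp
    have "col n ?l x \<le> j \<longleftrightarrow> col n ?l' x \<le> j" for j
    proof (cases "j \<le> n")
      case True
      then show ?thesis
        unfolding col_le[OF l x2] col_le[OF l' x2] using bl[OF True] tl(1,2) x(2)
        by (cases "j = h") auto
    next
      case False
      then have "x \<le> bnd n ?l j" "x \<le> bnd n ?l' j"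
        using mid(1)[OF l] mid(1)[OF l'] bnd_mono[of "n+1" j n ?l] bnd_mono[of "n+1" j n ?l'] x by simp_all
      then show ?thesis unfolding col_le[OF l x2] col_le[OF l' x2] by simp
    qed
    then show ?thesis by (meson order_antisym order_refl)
  qed
  have iff: "col n ?l x = h \<longleftrightarrow> bnd n m (h-1) < x \<and> x \<le> t" "col n ?l' x = h+1 \<longleftrightarrow> t \<le> x \<and> x \<le> bnd n ?l' (h+1)"
    if "x \<in> {1..2*r}" for x
    using col_eq_iff[OF l that, of h] col_eq_iff[OF l' that, of "h+1"] h tl by (auto simp: t_def)
  have t2: "t \<in> {1..2*r}" using tr by auto
  show "t \<in> {1..r}" "bnd n m (h-1) + 1 \<le> t" by (rule tr, rule low)
  show "col n ?l x = col n ?l' x" if "x \<in> {1..r}" "x \<noteq> t" for x by (rule eq[OF that])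
    show "col n ?l t = h" "col n ?l' t = h+1" using iff[OF t2] low tb by auto
    show "{x\<in>{1..2*r}. col n ?l x = h} = {bnd n m (h-1) + 1..t}"
      using iff(1) t2 by (intro Set.set_eqI) (fastforce simp: Suc_le_eq)
    show "{x\<in>{1..2*r}. col n ?l' x = h+1} = {t..bnd n ?l' (h+1)}"
      using iff(2) t2 top by (intro Set.set_eqI) fastforce
    show "t \<le> bnd n ?l' (h+1)" by (rule tb)
    show "bnd n ?l' (h+1) \<le> r" if "h < n"
      using that mid(2)[OF l'] bnd_mono[of "h+1" n n ?l'] by simp
    show "bnd n ?l' (h+1) = 2*r+1-t" if "h = n"
      using that bnd_mirror[OF l', of n] tl(2) tr by (simp, linarith)
qed

text \<open>Indexes two families of words by one interval, the second family by mirror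
  images.\<close>

lemma sum_split_mirror:
  fixes f :: "'b \<Rightarrow> 'a :: comm_monoid_add" and r :: nat
  assumes "t \<in> {1..r}"
  shows "(\<Sum>k\<in>{t..2*r+1-t}. f (if k \<le> r then a k else b (2*r+1-k))) =
    (\<Sum>k\<in>{t..r}. f (a k)) + (\<Sum>k\<in>{t..r}. f (b k))"
proof -
  have "{t..2*r+1-t} = {t..r} \<union> {r+1..2*r+1-t}" using assms by auto
  then have "(\<Sum>k\<in>{t..2*r+1-t}. f (if k \<le> r then a k else b (2*r+1-k))) =
      (\<Sum>k\<in>{t..r}. f (if k \<le> r then a k else b (2*r+1-k))) +
      (\<Sum>k\<in>{r+1..2*r+1-t}. f (if k \<le> r then a k else b (2*r+1-k)))"
    by (simp only:) (rule sum.union_disjoint, auto)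
  also have "(\<Sum>k\<in>{r+1..2*r+1-t}. f (if k \<le> r then a k else b (2*r+1-k))) = (\<Sum>k\<in>{t..r}. f (b k))"
    by (rule sum.reindex_bij_witness[of _ "\<lambda>k. 2*r+1-k" "\<lambda>k. 2*r+1-k"]) (use assms in auto)
  finally show ?thesis by simp
qed

section \<open>The raising and lowering products\<close>

context type_B begin

lemma up_product:
  assumes h: "h \<in> {1..n}" and m: "m \<in> Comp (n+1) (r-1)" and A: "A \<in> Xi (2*n+1) (2*r)"
    and B: "B = (\<lambda>i j. E_theta (2*n+1) h (h+1) i j + diag (hat n m) i j)" "B \<in> Xi (2*n+1) (2*r)"
    and AB: "ro (2*n+1) A = co (2*n+1) B"
  shows "e_elem n r B \<otimes>\<^bsub>schur n r\<^esub> e_elem n r A =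
    (\<Oplus>\<^bsub>schur n r\<^esub>p\<in>{p \<in> {1..2*n+1}. A (h+1) p > 0}.
       (qv ^ (\<Sum>j\<in>{p<..2*n+1}. A h j) * qnum (A h p + 1)) \<odot>\<^bsub>schur n r\<^esub> e_elem n r (mat_up (2*n+1) A h p))"
proof -
  let ?N = "2*n+1" and ?l = "inc m h" and ?l' = "inc m (h+1)"
  have n: "1 \<le> n" and hh: "h \<in> {1..n+1}" "h+1 \<in> {1..n+1}" using h by auto
  have r1: "r \<ge> 1" using r2 by simp
  have l: "?l \<in> Comp (n+1) r" and l': "?l' \<in> Comp (n+1) r"
    using inc_Comp[OF m hh(1)] inc_Comp[OF m hh(2)] r2 by simp_all
  define t where "t = bnd n m h + 1"
  note c = inc_colours[OF h m r1 t_def]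
  have act: "(\<Sum>k\<in>{bnd n m (h-1) + 1..t}. foldr tau [k..<t] (phi (col n ?l') c' Y) v) =
    (\<Sum>p | p \<in> {1..?N} \<and> Y (h+1) p > 0.
      (qv ^ (\<Sum>j\<in>{p<..?N}. Y h j) * qnum (Y h p + 1)) * phi (col n ?l) c' (mat_up ?N Y h p) v)"
    if "Y \<in> Xi ?N (2*r)" "colouring n c'" "v \<in> W" for Y c' v
    by (rule multiply_up[OF colouring_col[OF l'] colouring_col[OF l] that(2) h c(1,3,2,4) _ c(5,6) that(1,3)]) simp_all
  \<comment> \<open>Row h + 1 is positive on the diagonal thanks to the added unit and zero
    elsewhere, so the diagonal case of \<open>product_formula\<close> has only the column h +
    1.\<close>
  have diag0: "diag (hat n ?l') (h+1) p > 0 \<longleftrightarrow> p = h+1" for p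
    using hh(2) by (auto simp: diag_def hat_def inc_def)
  have off: "diag f i j = 0" if "i \<noteq> j" for f i j using that by (simp add: diag_def)
  show ?thesis
  proof (rule product_formula[where K = "{bnd n m (h-1) + 1..t}" and wd = "\<lambda>k. [k..<t]" and l = ?l' and lt = ?l
        and Q = "\<lambda>A p. A (h+1) p > 0" and new = "\<lambda>A p. mat_up ?N A h p" and pd = "h+1"
        and coef = "\<lambda>A p. qv ^ (\<Sum>j\<in>{p<..?N}. A h j) * qnum (A h p + 1)", OF n l' l finite_atLeastAtMost _ act])
    show "set [k..<t] \<subseteq> {1..r}" if "k \<in> {bnd n m (h-1) + 1..t}" for k using that c(1) by auto
    show "mat_up ?N Y h p \<in> Xi ?N (2*r) \<and>
      (\<forall>i\<in>{1..?N}. ro ?N Y i = hat n ?l' i \<longrightarrow> ro ?N (mat_up ?N Y h p) i = hat n ?l i) \<and>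
      (\<forall>i. co ?N (mat_up ?N Y h p) i = co ?N Y i)" if "Y \<in> Xi ?N (2*r)" "p \<in> {1..?N}" "Y (h+1) p > 0" for Y p
      using mat_up_sums[OF that(1) h that(2,3)] .
    show "diag (hat n ?l') \<in> Xi ?N (2*r)" by (rule diag_Xi[OF l'])
    show "{p. p \<in> {1..?N} \<and> diag (hat n ?l') (h+1) p > 0} = {h+1}" unfolding diag0 using h by auto
    have "(\<Sum>j\<in>{h+1<..?N}. diag (hat n ?l') h j) = 0" by (rule sum.neutral) (auto simp: diag_def)
    then show "qv ^ (\<Sum>j\<in>{h+1<..?N}. diag (hat n ?l') h j) * qnum (diag (hat n ?l') h (h+1) + 1) = 1"
      using off[of h "h+1" "hat n ?l'"] qnum_1 by simp
    show "mat_up ?N (diag (hat n ?l')) h (h+1) = B"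
      unfolding B(1) mat_up_def diag_inc[OF hh(2)] by (intro ext) simp
    show "B \<in> Xi ?N (2*r)" by (rule B(2))
    show "ro ?N B i = hat n ?l i" "co ?N B i = hat n ?l' i" if "i \<in> {1..?N}" for i
      unfolding B(1) by (rule offdiag_sums(1)[OF hh that], rule offdiag_sums(2)[OF hh that])
    then show "ro ?N A i = hat n ?l' i" if "i \<in> {1..?N}" for i using that unfolding AB by blast
    show "A \<in> Xi ?N (2*r)" by (rule A)
  qed
qed

text \<open>The part common to both lowering formulas; words and coefficients remain parameters
  because they differ for h = n.\<close>

lemma down_product:
  fixes wd :: "nat \<Rightarrow> nat list"
  assumes h: "h \<in> {1..n}" and m: "m \<in> Comp (n+1) (r-1)" and A: "A \<in> Xi (2*n+1) (2*r)"
    and C: "C = (\<lambda>i j. E_theta (2*n+1) (h+1) h i j + diag (hat n m) i j)" "C \<in> Xi (2*n+1) (2*r)"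
    and AC: "ro (2*n+1) A = co (2*n+1) C"
    and wd: "finite K" "\<And>k. k \<in> K \<Longrightarrow> set (wd k) \<subseteq> {1..r}"
    and act: "\<And>Y c' v. Y \<in> Xi (2*n+1) (2*r) \<Longrightarrow> colouring n c' \<Longrightarrow> v \<in> W \<Longrightarrow>
      (\<Sum>k\<in>K. foldr tau (wd k) (phi (col n (inc m h)) c' Y) v) =
      (\<Sum>p | p \<in> {1..2*n+1} \<and> Y h p > 0. coef Y p * phi (col n (inc m (h+1))) c' (mat_down (2*n+1) Y h p) v)"
    and coef: "coef (diag (hat n (inc m h))) h = 1"
  shows "e_elem n r C \<otimes>\<^bsub>schur n r\<^esub> e_elem n r A =
    (\<Oplus>\<^bsub>schur n r\<^esub>p\<in>{p \<in> {1..2*n+1}. A h p > 0}. coef A p \<odot>\<^bsub>schur n r\<^esub> e_elem n r (mat_down (2*n+1) A h p))"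
proof -
  let ?N = "2*n+1" and ?l = "inc m h" and ?l' = "inc m (h+1)"
  have n: "1 \<le> n" and hh: "h \<in> {1..n+1}" "h+1 \<in> {1..n+1}" using h by auto
  have l: "?l \<in> Comp (n+1) r" and l': "?l' \<in> Comp (n+1) r"
    using inc_Comp[OF m hh(1)] inc_Comp[OF m hh(2)] r2 by simp_all
  have diag0: "diag (hat n ?l) h p > 0 \<longleftrightarrow> p = h" for p
    using h by (auto simp: diag_def hat_def inc_def)
  show ?thesis
  proof (rule product_formula[where K = K and wd = wd and l = ?l and lt = ?l'
        and Q = "\<lambda>A p. A h p > 0" and new = "\<lambda>A p. mat_down ?N A h p" and pd = h
        and coef = coef, OF n l l' wd(1) _ act])
    show "set (wd k) \<subseteq> {1..r}" if "k \<in> K" for k using that by (rule wd(2))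
    show "mat_down ?N Y h p \<in> Xi ?N (2*r) \<and>
      (\<forall>i\<in>{1..?N}. ro ?N Y i = hat n ?l i \<longrightarrow> ro ?N (mat_down ?N Y h p) i = hat n ?l' i) \<and>
      (\<forall>i. co ?N (mat_down ?N Y h p) i = co ?N Y i)" if "Y \<in> Xi ?N (2*r)" "p \<in> {1..?N}" "Y h p > 0" for Y p
      using mat_down_sums[OF that(1) h that(2,3)] .
    show "diag (hat n ?l) \<in> Xi ?N (2*r)" by (rule diag_Xi[OF l])
    show "{p. p \<in> {1..?N} \<and> diag (hat n ?l) h p > 0} = {h}" unfolding diag0 using h by auto
    show "coef (diag (hat n ?l)) h = 1" by (rule coef)
    show "mat_down ?N (diag (hat n ?l)) h h = C"
      unfolding C(1) mat_down_def diag_inc[OF hh(1)] by (intro ext) simp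
    show "C \<in> Xi ?N (2*r)" by (rule C(2))
    show "ro ?N C i = hat n ?l' i" "co ?N C i = hat n ?l i" if "i \<in> {1..?N}" for i
      unfolding C(1) by (rule offdiag_sums(1)[OF hh(2,1) that], rule offdiag_sums(2)[OF hh(2,1) that])
    then show "ro ?N A i = hat n ?l i" if "i \<in> {1..?N}" for i using that unfolding AC by blast
    show "A \<in> Xi ?N (2*r)" by (rule A)
  qed
qed

lemma diag_coef: "qv ^ (\<Sum>j\<in>{1..<h}. diag f (h+1) j) * qnum (diag f (h+1) h + 1) = 1"
proof -
  have "(\<Sum>j\<in>{1..<h}. diag f (h+1) j) = 0" by (rule sum.neutral) (auto simp: diag_def)
  moreover have "diag f (h+1) h = 0" by (simp add: diag_def)
  ultimately show ?thesis using qnum_1 by simp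
qed

lemma down_product_low:
  assumes h: "h \<in> {1..<n}" and m: "m \<in> Comp (n+1) (r-1)" and A: "A \<in> Xi (2*n+1) (2*r)"
    and C: "C = (\<lambda>i j. E_theta (2*n+1) (h+1) h i j + diag (hat n m) i j)" "C \<in> Xi (2*n+1) (2*r)"
    and AC: "ro (2*n+1) A = co (2*n+1) C"
  shows "e_elem n r C \<otimes>\<^bsub>schur n r\<^esub> e_elem n r A =
    (\<Oplus>\<^bsub>schur n r\<^esub>p\<in>{p \<in> {1..2*n+1}. A h p > 0}.
       (qv ^ (\<Sum>j\<in>{1..<p}. A (h+1) j) * qnum (A (h+1) p + 1))
         \<odot>\<^bsub>schur n r\<^esub> e_elem n r (mat_down (2*n+1) A h p))"
proof -
  let ?l = "inc m h" and ?l' = "inc m (h+1)"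
  have hn: "h \<in> {1..n}" and r1: "r \<ge> 1" using h r2 by auto
  have l: "?l \<in> Comp (n+1) r" and l': "?l' \<in> Comp (n+1) r"
    using inc_Comp[OF m, of h] inc_Comp[OF m, of "h+1"] h r2 by simp_all
  define t where "t = bnd n m h + 1"
  let ?b = "bnd n (inc m (h+1)) (h+1)"
  note c = inc_colours[OF hn m r1 t_def]
  have br: "?b \<le> r" using c(9) h by simp
  show ?thesis
  proof (rule down_product[where K = "{t..?b}" and wd = "\<lambda>k. rev [t..<k]"
        and coef = "\<lambda>Y p. qv ^ (\<Sum>j\<in>{1..<p}. Y (h+1) j) * qnum (Y (h+1) p + 1)",
        OF hn m A C AC finite_atLeastAtMost _ _ diag_coef])
    show "set (rev [t..<k]) \<subseteq> {1..r}" if "k \<in> {t..?b}" for k using that c(1) br by auto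
  next
    fix Y c' v assume "Y \<in> Xi (2*n+1) (2*r)" "colouring n c'" "v \<in> W"
    then show "(\<Sum>k\<in>{t..?b}. foldr tau (rev [t..<k]) (phi (col n ?l) c' Y) v) =
      (\<Sum>p | p \<in> {1..2*n+1} \<and> Y h p > 0. (qv ^ (\<Sum>j\<in>{1..<p}. Y (h+1) j) * qnum (Y (h+1) p + 1)) *
        phi (col n ?l') c' (mat_down (2*n+1) Y h p) v)"
      using multiply_down[OF colouring_col[OF l] colouring_col[OF l'] _ h c(1-3) c(4)[symmetric] c(8) br c(7)] by blast
  qed
qed

lemma down_product_center:
  assumes n: "n \<ge> 1" and m: "m \<in> Comp (n+1) (r-1)" and A: "A \<in> Xi (2*n+1) (2*r)"
    and C: "C = (\<lambda>i j. E_theta (2*n+1) (n+1) n i j + diag (hat n m) i j)" "C \<in> Xi (2*n+1) (2*r)"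
    and AC: "ro (2*n+1) A = co (2*n+1) C"
  shows "e_elem n r C \<otimes>\<^bsub>schur n r\<^esub> e_elem n r A =
    (\<Oplus>\<^bsub>schur n r\<^esub>p\<in>{p \<in> {1..2*n+1}. A n p > 0}.
      (if p = n + 1
       then qv ^ (\<Sum>j\<in>{1..<p}. A (n+1) j) * (qnum (A (n+1) p + 1) + qv ^ (A (n+1) p div 2))
       else qv ^ (\<Sum>j\<in>{1..<p}. A (n+1) j) * qnum (A (n+1) p + 1))
         \<odot>\<^bsub>schur n r\<^esub> e_elem n r (mat_down (2*n+1) A n p))"
proof -
  let ?l = "inc m n" and ?l' = "inc m (n+1)"
  let ?coef = "\<lambda>Y p. if p = n + 1
       then qv ^ (\<Sum>j\<in>{1..<p}. Y (n+1) j) * (qnum (Y (n+1) p + 1) + qv ^ (Y (n+1) p div 2))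
       else qv ^ (\<Sum>j\<in>{1..<p}. Y (n+1) j) * qnum (Y (n+1) p + 1)"
  have hn: "n \<in> {1..n}" and r1: "r \<ge> 1" using n r2 by auto
  have l: "?l \<in> Comp (n+1) r" and l': "?l' \<in> Comp (n+1) r"
    using inc_Comp[OF m, of n] inc_Comp[OF m, of "n+1"] n r2 by simp_all
  define t where "t = bnd n m n + 1"
  note c = inc_colours[OF hn m r1 t_def]
  note bb = c(7)[unfolded c(10)[OF refl]]
  \<comment> \<open>A position up to r is reached by a word inside the left half, a position beyond
    r by a word through s_r whose left factor starts at the mirror image of that position.\<close>
  let ?wd = "\<lambda>k. if k \<le> r then rev [t..<k] else [2*r+1-k..<r] @ [r] @ rev [t..<r]"
  show ?thesis
  proof (rule down_product[where K = "{t..2*r+1-t}" and wd = ?wd and coef = ?coef,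
        OF hn m A C AC finite_atLeastAtMost])
    show "set (?wd k) \<subseteq> {1..r}" if "k \<in> {t..2*r+1-t}" for k using that c(1) by auto
    show "?coef (diag (hat n ?l)) n = 1" using diag_coef[where h = n and f = "hat n ?l"] by simp
  next
    fix Y c' v assume Y: "Y \<in> Xi (2*n+1) (2*r)" and c': "colouring n c'" and v: "v \<in> W"
    have "(\<Sum>k\<in>{t..2*r+1-t}. foldr tau (?wd k) (phi (col n ?l) c' Y) v) =
      (\<Sum>k\<in>{t..r}. foldr tau (rev [t..<k]) (phi (col n ?l) c' Y) v) +
      (\<Sum>k\<in>{t..r}. foldr tau ([k..<r] @ [r] @ rev [t..<r]) (phi (col n ?l) c' Y) v)"
      by (rule sum_split_mirror[OF c(1), where f = "\<lambda>w. foldr tau w (phi (col n ?l) c' Y) v"])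
    also have "\<dots> = (\<Sum>p | p \<in> {1..2*n+1} \<and> Y n p > 0. ?coef Y p *
        phi (col n ?l') c' (mat_down (2*n+1) Y n p) v)"
      by (rule multiply_center[OF colouring_col[OF l] colouring_col[OF l'] c' n c(1-3) c(4)[symmetric] bb Y v])
    finally show "(\<Sum>k\<in>{t..2*r+1-t}. foldr tau (?wd k) (phi (col n ?l) c' Y) v) =
      (\<Sum>p | p \<in> {1..2*n+1} \<and> Y n p > 0. ?coef Y p * phi (col n ?l') c' (mat_down (2*n+1) Y n p) v)" .
  qed
qed

text \<open>Covers every matrix, the value being zero outside \<open>Xi\<close>, so terms with a
  truncated shift also lie in the carrier.\<close>

lemma e_elem_closed:
  assumes n: "n \<ge> 1"
  shows "e_elem n r A \<in> carrier (schur n r)"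
proof (cases "A \<in> Xi (2*n+1) (2*r)")
  case True
  note l = comp_of[of n "ro (2*n+1) A" r, OF ro_mirror(1)[OF True] ro_total(1)[OF True]]
    and m = comp_of[of n "co (2*n+1) A" r, OF ro_mirror(2)[OF True] ro_total(2)[OF True]]
  show ?thesis by (rule repD(1)[OF n e_elem_rep[OF n True l(1) m(1) l(2) m(2)]])
next
  case False
  then show ?thesis using S_zero_closed[OF n] by (simp add: e_elem_def)
qed

lemma S_zero_smult:
  assumes n: "n \<ge> 1" and f: "f \<in> carrier (schur n r)"
  shows "0 \<odot>\<^bsub>schur n r\<^esub> f = \<zero>\<^bsub>schur n r\<^esub>"
proof -
  have "hecke_const r 0 = \<zero>\<^bsub>H\<^esub>" unfolding hecke_const_proj const_simps by (rule proj_zero)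
  moreover have "right_act n r w \<zero>\<^bsub>H\<^esub> = \<one>\<^bsub>tensor_module n r\<^esub>" if "w \<in> carrier (tensor_module n r)" for w
  proof -
    show ?thesis unfolding right_act_def M_ops[OF n] using M_atH[OF n that] by (intro restrict_ext) simp
  qed
  ultimately show ?thesis
    unfolding S_ops[OF n] using S_carrierD(1)[OF n f] by (intro restrict_ext) simp
qed

end

theorem theorem5p2:
  fixes n r N h :: nat and A :: mat
  assumes "n \<ge> 1" and "r \<ge> 2" and "N = 2*n+1"
    and "h \<in> {1..n}" and "A \<in> Xi N (2*r)"
  shows
    "(\<forall>l B. l \<in> Comp (n+1) (r-1) \<and>
        B = (\<lambda>i j. E_theta N h (h+1) i j + diag (hat n l) i j) \<and>
        B \<in> Xi N (2*r) \<and> ro N A = co N B \<longrightarrow>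
        e_elem n r B \<otimes>\<^bsub>schur n r\<^esub> e_elem n r A =
          (\<Oplus>\<^bsub>schur n r\<^esub>p\<in>{p \<in> {1..N}. A (h+1) p > 0}.
             (qv ^ (\<Sum>j\<in>{p<..N}. A h j) * qnum (A h p + 1))
               \<odot>\<^bsub>schur n r\<^esub> e_elem n r (mat_up N A h p)))
   \<and> (\<forall>m C. m \<in> Comp (n+1) (r-1) \<and>
        C = (\<lambda>i j. E_theta N (h+1) h i j + diag (hat n m) i j) \<and>
        C \<in> Xi N (2*r) \<and> ro N A = co N C \<longrightarrow>
        (h \<noteq> n \<longrightarrow>
          e_elem n r C \<otimes>\<^bsub>schur n r\<^esub> e_elem n r A =
            (\<Oplus>\<^bsub>schur n r\<^esub>p\<in>{p \<in> {1..N}. A h p > 0}.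
               (qv ^ (\<Sum>j\<in>{1..<p}. A (h+1) j) * qnum (A (h+1) p + 1))
                 \<odot>\<^bsub>schur n r\<^esub> e_elem n r (mat_down N A h p))) \<and>
        (h = n \<longrightarrow>
          e_elem n r C \<otimes>\<^bsub>schur n r\<^esub> e_elem n r A =
            (\<Oplus>\<^bsub>schur n r\<^esub>p\<in>{p \<in> {1..N}. p \<noteq> n+1 \<and> A n p > 0}.
               (qv ^ (\<Sum>j\<in>{1..<p}. A (n+1) j) * qnum (A (n+1) p + 1))
                 \<odot>\<^bsub>schur n r\<^esub> e_elem n r (mat_down N A n p))
            \<oplus>\<^bsub>schur n r\<^esub>
            ((1 - (if A n (n+1) = 0 then 1 else 0)) * qv ^ (\<Sum>j\<in>{1..<n+1}. A (n+1) j) *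
              (qnum (A (n+1) (n+1) + 1) + qv ^ (A (n+1) (n+1) div 2)))
              \<odot>\<^bsub>schur n r\<^esub> e_elem n r (mat_down N A n (n+1))))"
proof -
  interpret type_B r by unfold_locales (rule assms(2))
  note A = assms(5)[unfolded assms(3)]
  let ?S = "schur n r"
  interpret S: abelian_monoid ?S by (rule S_abelian_monoid[OF assms(1)])
  define f where "f a p = a \<odot>\<^bsub>?S\<^esub> e_elem n r (mat_down N A n p)" for a p
  have fS: "f a p \<in> carrier ?S" for a p
    unfolding f_def by (rule S_smult_closed[OF assms(1) e_elem_closed[OF assms(1)]])
  have f0: "f 0 p = \<zero>\<^bsub>?S\<^esub>" for p
    unfolding f_def by (rule S_zero_smult[OF assms(1) e_elem_closed[OF assms(1)]])
  define P where "P = {p \<in> {1..N}. p \<noteq> n+1 \<and> A n p > 0}"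
  define a where "a p = qv ^ (\<Sum>j\<in>{1..<p}. A (n+1) j) * qnum (A (n+1) p + 1)" for p
  define a' where "a' = qv ^ (\<Sum>j\<in>{1..<n+1}. A (n+1) j) * (qnum (A (n+1) (n+1) + 1) + qv ^ (A (n+1) (n+1) div 2))"
  have split: "(\<Oplus>\<^bsub>?S\<^esub>p\<in>{p \<in> {1..N}. A n p > 0}. f (if p = n+1 then a' else a p) p) =
      (\<Oplus>\<^bsub>?S\<^esub>p\<in>P. f (a p) p) \<oplus>\<^bsub>?S\<^esub> f ((1 - (if A n (n+1) = 0 then 1 else 0)) * a') (n+1)"
  proof -
    have fin: "finite P" "n + 1 \<notin> P" unfolding P_def by simp_all
    have rest: "(\<Oplus>\<^bsub>?S\<^esub>p\<in>P. f (if p = n+1 then a' else a p) p) = (\<Oplus>\<^bsub>?S\<^esub>p\<in>P. f (a p) p)"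
      by (rule S.finsum_cong') (use fin fS in auto)
    have sumS: "(\<Oplus>\<^bsub>?S\<^esub>p\<in>P. f (a p) p) \<in> carrier ?S" by (rule S.finsum_closed) (use fS in auto)
    show ?thesis
    \<comment> \<open>If the entry vanishes, column n + 1 is absent from the sum and the extra term
      has coefficient 0; otherwise that column is split off.\<close>
    proof (cases "A n (n+1) = 0")
      case True
      then have "{p \<in> {1..N}. A n p > 0} = P" unfolding P_def by auto
      then show ?thesis using True sumS by (simp only: rest) (simp add: f0)
    next
      case False
      then have "{p \<in> {1..N}. A n p > 0} = insert (n+1) P" unfolding P_def using assms(3) by auto
      then have "(\<Oplus>\<^bsub>?S\<^esub>p\<in>{p \<in> {1..N}. A n p > 0}. f (if p = n+1 then a' else a p) p) =
          f a' (n+1) \<oplus>\<^bsub>?S\<^esub> (\<Oplus>\<^bsub>?S\<^esub>p\<in>P. f (a p) p)"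
        using S.finsum_insert[OF fin, of "\<lambda>p. f (if p = n+1 then a' else a p) p"] fS unfolding rest by auto
      then show ?thesis using False S.a_comm[OF fS sumS] by simp
    qed
  qed
  have center: "e_elem n r C \<otimes>\<^bsub>?S\<^esub> e_elem n r A =
      (\<Oplus>\<^bsub>?S\<^esub>p\<in>P. f (a p) p) \<oplus>\<^bsub>?S\<^esub> f ((1 - (if A n (n+1) = 0 then 1 else 0)) * a') (n+1)"
    if "m \<in> Comp (n+1) (r-1)" "C = (\<lambda>i j. E_theta N (n+1) n i j + diag (hat n m) i j)"
      "C \<in> Xi N (2*r)" "ro N A = co N C" for m C
  proof -
    have coef: "(if p = n + 1
       then qv ^ (\<Sum>j\<in>{1..<p}. A (n+1) j) * (qnum (A (n+1) p + 1) + qv ^ (A (n+1) p div 2))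
       else qv ^ (\<Sum>j\<in>{1..<p}. A (n+1) j) * qnum (A (n+1) p + 1)) = (if p = n+1 then a' else a p)" for p
      unfolding a_def a'_def by simp
    show ?thesis
      using down_product_center[OF assms(1) that(1) A that(2,3,4)[unfolded assms(3)], unfolded coef]
      unfolding split[unfolded f_def assms(3), symmetric] f_def assms(3) .
  qed
  show ?thesis
  proof (intro conjI allI impI, goal_cases)
    case (1 l B)
    then show ?case using up_product[OF assms(4) _ A] unfolding assms(3) by blast
  next
    case (2 m C)
    then have "h \<in> {1..<n}" using assms(4) by simp
    then show ?case using 2 down_product_low[OF _ _ A] unfolding assms(3) by blast
  next
    case (3 m C)
    then show ?case using center[of m C] unfolding f_def P_def a_def a'_def mult.assoc by blast
  qed
qed

end
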